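(* Let $\mathbf{s}$ be a cofinality spectrum problem. Then $\mathcal{C}(\mathbf{s}, \mathfrak{t}_\mathbf{s}) = \emptyset$; that is, there are no regular cardinals $\kappa_1,\kappa_2$ with $\kappa_1+\kappa_2<\mathfrak{t}_\mathbf{s}$ such that some linear order $(X_\mathbf{a},\le_\mathbf{a})$, $\mathbf{a}\in \operatorname{Or}(\mathbf{s})$, has a $(\kappa_1,\kappa_2)$-cut.
   Context: A cofinality spectrum problem is a tuple $\mathbf{s}=(M,M_1,M^+,M_1^+,T,\Delta)$ such that $M\preceq M_1$; $T\supseteq Th(M)$ is a theory in a possibly larger vocabulary; $M^+,M_1^+$ expand $M,M_1$ with $M^+\preceq M_1^+\models T$; $\Delta$ is a nonempty set of formulas $\varphi(x,y;\bar z)$ of the language of $M$ with $\ell(x)=\ell(y)$ (not necessarily $1$); and the following hold, where "definable" means definable with parameters in $M_1^+$: (i) for each $\varphi\in\Delta$ and each parameter tuple $\bar c$ from $M_1$, $\varphi(x,y;\bar c)$ is a discrete linear order on $X(\varphi,\bar c)=\{a: M_1\models\varphi(a,a;\bar c)\}$, and every nonempty definable subset of $X(\varphi,\bar c)$ has a first and a last element; (ii) $\operatorname{Or}(\mathbf{s})$ is the set of tuples $\mathbf{a}=(X_\mathbf{a},\le_\mathbf{a},\varphi_\mathbf{a},\bar c_\mathbf{a},d_\mathbf{a})$ with $\varphi_\mathbf{a}\in\Delta$, $\le_\mathbf{a}$ the order $\varphi_\mathbf{a}(x,y;\bar c_\mathbf{a})$ on $X_\mathbf{a}=X(\varphi_\mathbf{a},\bar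 c_\mathbf{a})$, and $d_\mathbf{a}\in X_\mathbf{a}$; $\mathbf{a}$ is nontrivial if $\{d:d<_\mathbf{a} d_\mathbf{a}\}$ is infinite; (iii) for nontrivial $\mathbf{a},\mathbf{b}\in\operatorname{Or}(\mathbf{s})$ there is a nontrivial $\mathbf{c}\in\operatorname{Or}(\mathbf{s})$ with $X_\mathbf{c}$ the image of $X_\mathbf{a}\times X_\mathbf{b}$ under a definable pairing function $\operatorname{Pr}$ (with definable coordinate projections); (iv) for some nontrivial $\mathbf{a}$ there is a nontrivial $\mathbf{c}$ with $X_\mathbf{c}=\operatorname{Pr}(X_\mathbf{a}\times X_\mathbf{a})$ such that for every $x\in X_\mathbf{a}$ there is $y\in X_\mathbf{c}$ with $\max\{x_1,x_2\}\le_\mathbf{a} x \iff \operatorname{Pr}(x_1,x_2)\le_\mathbf{c} y$ for all $x_1,x_2\in X_\mathbf{a}$; (v) for each $\varphi\in\Delta$ there are formulas uniformly defining, for each $\mathbf{a}\in\operatorname{Or}(\mathbf{s})$ with $\varphi_\mathbf{a}=\varphi$, a set $\mathcal{T}_\mathbf{a}$ (a "tree of sequences"), a length function $\operatorname{lg}_\mathbf{a}:\mathcal{T}_\mathbf{a}\to X_\mathbf{a}$, a value function assigning $\operatorname{val}_\mathbf{a}(b(a))\in X_\mathbf{a}$ to $b\in\mathcal{T}_\mathbf{a}$ and $a<_\mathbf{a}\operatorname{lg}_\mathbf{a}(b)$, and a partial order $\trianglelefteq_\mathbf{a}$ on $\mathcal{T}_\mathbf{a}$, such that: $\operatorname{lg}_\mathbf{a}(b)\le_\mathbf{a}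 d_\mathbf{a}$; if $\operatorname{lg}_\mathbf{a}(c)<_\mathbf{a} d_\mathbf{a}$ and $a\in X_\mathbf{a}$ then there is $c'\in\mathcal{T}_\mathbf{a}$ of length $\operatorname{lg}_\mathbf{a}(c)+1$ agreeing with $c$ at all points below $\operatorname{lg}_\mathbf{a}(c)$ and with value $a$ at $\operatorname{lg}_\mathbf{a}(c)$; $b_1\trianglelefteq_\mathbf{a} b_2$ implies $\operatorname{lg}_\mathbf{a}(b_1)\le_\mathbf{a}\operatorname{lg}_\mathbf{a}(b_2)$ and $b_2$ agrees with $b_1$ below $\operatorname{lg}_\mathbf{a}(b_1)$; distinct elements of $\mathcal{T}_\mathbf{a}$ of equal length differ in value at some point. Standing convention: cofinality spectrum problems are nontrivial (some element of $\operatorname{Or}(\mathbf{s})$ is nontrivial), and "$\mathbf{a}\in\operatorname{Or}(\mathbf{s})$" means a nontrivial element. For regular $\kappa_1,\kappa_2$, a $(\kappa_1,\kappa_2)$-cut in $(X_\mathbf{a},\le_\mathbf{a})$ is a partition $X_\mathbf{a}=C_1\cup C_2$ with $C_1$ downward closed, $C_2$ upward closed, every element of $C_1$ below every element of $C_2$, $C_1$ having a strictly increasing cofinal sequence of length $\kappa_1$ and $C_2$ a strictly decreasing coinitial sequence of length $\kappa_2$. $\mathcal{C}^{\mathrm{ct}}(\mathbf{s})$ is the set of pairs $(\kappa_1,\kappa_2)$ of regular cardinals such that some $\mathbf{a}\in\operatorname{Or}(\mathbf{s})$ has a $(\kappa_1,\kappa_2)$-cut in $X_\mathbf{a}$. $\mathfrak{t}_\mathbf{s}$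 is the least $\kappa\ge\aleph_0$ such that for some $\mathbf{a}\in\operatorname{Or}(\mathbf{s})$ the tree $(\mathcal{T}_\mathbf{a},\trianglelefteq_\mathbf{a})$ contains a strictly increasing sequence of cofinality $\operatorname{cf}(\kappa)$ with no upper bound. For a cardinal $\lambda$, $\mathcal{C}(\mathbf{s},\lambda)=\{(\kappa_1,\kappa_2)\in\mathcal{C}^{\mathrm{ct}}(\mathbf{s}):\kappa_1+\kappa_2<\lambda\}$.
   Formalization: In clause (v) each tree of sequences is additionally required to be nonempty and closed under initial segments, and its order to be exactly the initial-segment relation (not merely to imply it); with empty or trivial trees allowed the claim fails. *)

theory Defs
  imports Main
begin

unbundle cardinal_syntax

section \<open>First-order logic\<close>

datatype 'f tm = Var nat | Fn 'f "'f tm list"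

datatype ('f, 'r) fm =
    Eq "'f tm" "'f tm"
  | Rel 'r "'f tm list"
  | Neg "('f, 'r) fm"
  | Conj "('f, 'r) fm" "('f, 'r) fm"
  | Ex nat "('f, 'r) fm"

record ('f, 'r) vocabulary =
  fun_syms :: "('f \<times> nat) set"
  rel_syms :: "('r \<times> nat) set"

record ('f, 'r, 'a) fo_structure =
  dom_of :: "'a set"
  fun_int :: "'f \<Rightarrow> 'a list \<Rightarrow> 'a"
  rel_int :: "'r \<Rightarrow> 'a list \<Rightarrow> bool"

definition sub_vocabulary :: "('f, 'r) vocabulary \<Rightarrow> ('f, 'r) vocabulary \<Rightarrow> bool" where
  "sub_vocabulary L L' \<longleftrightarrow> fun_syms L \<subseteq> fun_syms L' \<and> rel_syms L \<subseteq> rel_syms L'"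

fun tm_vars :: "'f tm \<Rightarrow> nat set" where
  "tm_vars (Var n) = {n}"
| "tm_vars (Fn f ts) = (\<Union>t\<in>set ts. tm_vars t)"

fun free_vars :: "('f, 'r) fm \<Rightarrow> nat set" where
  "free_vars (Eq s t) = tm_vars s \<union> tm_vars t"
| "free_vars (Rel R ts) = (\<Union>t\<in>set ts. tm_vars t)"
| "free_vars (Neg \<phi>) = free_vars \<phi>"
| "free_vars (Conj \<phi> \<psi>) = free_vars \<phi> \<union> free_vars \<psi>"
| "free_vars (Ex n \<phi>) = free_vars \<phi> - {n}"

fun tm_in :: "('f, 'r) vocabulary \<Rightarrow> 'f tm \<Rightarrow> bool" where
  "tm_in L (Var n) \<longleftrightarrow> True"
| "tm_in L (Fn f ts) \<longleftrightarrow> (f, length ts) \<in> fun_syms L \<and> (\<forall>t\<in>set ts. tm_in L t)"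

fun fm_in :: "('f, 'r) vocabulary \<Rightarrow> ('f, 'r) fm \<Rightarrow> bool" where
  "fm_in L (Eq s t) \<longleftrightarrow> tm_in L s \<and> tm_in L t"
| "fm_in L (Rel R ts) \<longleftrightarrow> (R, length ts) \<in> rel_syms L \<and> (\<forall>t\<in>set ts. tm_in L t)"
| "fm_in L (Neg \<phi>) \<longleftrightarrow> fm_in L \<phi>"
| "fm_in L (Conj \<phi> \<psi>) \<longleftrightarrow> fm_in L \<phi> \<and> fm_in L \<psi>"
| "fm_in L (Ex n \<phi>) \<longleftrightarrow> fm_in L \<phi>"

fun tm_val :: "('f, 'r, 'a) fo_structure \<Rightarrow> (nat \<Rightarrow> 'a) \<Rightarrow> 'f tm \<Rightarrow> 'a" where
  "tm_val M e (Var n) = e n"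
| "tm_val M e (Fn f ts) = fun_int M f (map (tm_val M e) ts)"

fun sat :: "('f, 'r, 'a) fo_structure \<Rightarrow> (nat \<Rightarrow> 'a) \<Rightarrow> ('f, 'r) fm \<Rightarrow> bool" where
  "sat M e (Eq s t) \<longleftrightarrow> tm_val M e s = tm_val M e t"
| "sat M e (Rel R ts) \<longleftrightarrow> rel_int M R (map (tm_val M e) ts)"
| "sat M e (Neg \<phi>) \<longleftrightarrow> \<not> sat M e \<phi>"
| "sat M e (Conj \<phi> \<psi>) \<longleftrightarrow> sat M e \<phi> \<and> sat M e \<psi>"
| "sat M e (Ex n \<phi>) \<longleftrightarrow> (\<exists>a\<in>dom_of M. sat M (e(n := a)) \<phi>)"

definition tuples :: "('f, 'r, 'a) fo_structure \<Rightarrow> nat \<Rightarrow> 'a list set" where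
  "tuples M n = {as. length as = n \<and> set as \<subseteq> dom_of M}"

(* The free variables of a formula with n distinguished argument places are 0, ..., n - 1;
   "holds M \<phi> as" is meaningful only if free_vars \<phi> is contained in {..<length as}. *)
definition holds :: "('f, 'r, 'a) fo_structure \<Rightarrow> ('f, 'r) fm \<Rightarrow> 'a list \<Rightarrow> bool" where
  "holds M \<phi> as \<longleftrightarrow> sat M (\<lambda>i. as ! i) \<phi>"

definition fm_places :: "('f, 'r) vocabulary \<Rightarrow> nat \<Rightarrow> ('f, 'r) fm \<Rightarrow> bool" where
  "fm_places L n \<phi> \<longleftrightarrow> fm_in L \<phi> \<and> free_vars \<phi> \<subseteq> {..<n}"

definition is_structure :: "('f, 'r) vocabulary \<Rightarrow> ('f, 'r, 'a) fo_structure \<Rightarrow> bool" where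
  "is_structure L M \<longleftrightarrow> dom_of M \<noteq> {} \<and>
     (\<forall>(f, n)\<in>fun_syms L. \<forall>as\<in>tuples M n. fun_int M f as \<in> dom_of M)"

definition agree_on ::
  "('f, 'r) vocabulary \<Rightarrow> 'a set \<Rightarrow> ('f, 'r, 'a) fo_structure \<Rightarrow> ('f, 'r, 'a) fo_structure \<Rightarrow> bool"
where
  "agree_on L A M N \<longleftrightarrow>
     (\<forall>(f, n)\<in>fun_syms L. \<forall>as. length as = n \<and> set as \<subseteq> A \<longrightarrow> fun_int M f as = fun_int N f as) \<and>
     (\<forall>(R, n)\<in>rel_syms L. \<forall>as. length as = n \<and> set as \<subseteq> A \<longrightarrow> rel_int M R as = rel_int N R as)"

definition expands ::
  "('f, 'r) vocabulary \<Rightarrow> ('f, 'r, 'a) fo_structure \<Rightarrow> ('f, 'r, 'a) fo_structure \<Rightarrow> bool" where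
  "expands L M' M \<longleftrightarrow> dom_of M' = dom_of M \<and> agree_on L (dom_of M) M' M"

definition elementary_sub ::
  "('f, 'r) vocabulary \<Rightarrow> ('f, 'r, 'a) fo_structure \<Rightarrow> ('f, 'r, 'a) fo_structure \<Rightarrow> bool" where
  "elementary_sub L M N \<longleftrightarrow> is_structure L M \<and> is_structure L N \<and>
     dom_of M \<subseteq> dom_of N \<and> agree_on L (dom_of M) M N \<and>
     (\<forall>\<phi> e. fm_in L \<phi> \<and> range e \<subseteq> dom_of M \<longrightarrow> sat M e \<phi> = sat N e \<phi>)"

definition sentences :: "('f, 'r) vocabulary \<Rightarrow> ('f, 'r) fm set" where
  "sentences L = {\<phi>. fm_in L \<phi> \<and> free_vars \<phi> = {}}"

definition models :: "('f, 'r, 'a) fo_structure \<Rightarrow> ('f, 'r) fm \<Rightarrow> bool" where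
  "models M \<phi> \<longleftrightarrow> (\<forall>e. range e \<subseteq> dom_of M \<longrightarrow> sat M e \<phi>)"

definition theory_of :: "('f, 'r) vocabulary \<Rightarrow> ('f, 'r, 'a) fo_structure \<Rightarrow> ('f, 'r) fm set" where
  "theory_of L M = {\<phi> \<in> sentences L. models M \<phi>}"

definition definable ::
  "('f, 'r) vocabulary \<Rightarrow> ('f, 'r, 'a) fo_structure \<Rightarrow> nat \<Rightarrow> 'a list set \<Rightarrow> bool" where
  "definable L M k D \<longleftrightarrow>
     (\<exists>\<psi> p. fm_places L (k + length p) \<psi> \<and> set p \<subseteq> dom_of M \<and>
            D = {as \<in> tuples M k. holds M \<psi> (as @ p)})"


section \<open>Discrete linear orders\<close>

definition imm_succ :: "'b rel \<Rightarrow> 'b \<Rightarrow> 'b \<Rightarrow> bool" where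
  "imm_succ r x y \<longleftrightarrow> (x, y) \<in> r \<and> x \<noteq> y \<and> (\<forall>z. (x, z) \<in> r \<and> (z, y) \<in> r \<longrightarrow> z = x \<or> z = y)"

definition discrete_linear_order_on :: "'b set \<Rightarrow> 'b rel \<Rightarrow> bool" where
  "discrete_linear_order_on X r \<longleftrightarrow> linear_order_on X r \<and>
     (\<forall>x. (\<exists>y. (x, y) \<in> r \<and> x \<noteq> y) \<longrightarrow> (\<exists>y. imm_succ r x y)) \<and>
     (\<forall>y. (\<exists>x. (x, y) \<in> r \<and> x \<noteq> y) \<longrightarrow> (\<exists>x. imm_succ r x y))"


section \<open>Cofinality spectrum problems\<close>

(* A formula \<phi>(x, y; z) with l(x) = l(y) = xlen and l(z) = zlen;
   its argument places are listed in the order x, y, z. *)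
record ('f, 'r) order_fm =
  matrix :: "('f, 'r) fm"
  xlen :: nat
  zlen :: nat

(* Formulas defining the tree attached to a formula of \<Delta>, with parameters (c, d). The argument
   places are (b; c, d), (b, u; c, d), (b, u, v; c, d) and (b1, b2; c, d) respectively, where
   b, b1, b2 are tuples of length tlen: "b is in the tree", "b has length u",
   "b has value v at u", "b1 precedes b2 in the tree order". *)
record ('f, 'r) tree_fms =
  tlen :: nat
  mem_fm :: "('f, 'r) fm"
  lg_fm :: "('f, 'r) fm"
  val_fm :: "('f, 'r) fm"
  tle_fm :: "('f, 'r) fm"

(* The tuple (M, M1, M+, M1+, T, \<Delta>), with the vocabularies of M, M1 and of M+, M1+ and with the
   choice of the tree-defining formulas made explicit. *)
record ('f, 'r, 'a) csp =
  voc :: "('f, 'r) vocabulary"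
  vocp :: "('f, 'r) vocabulary"
  M0 :: "('f, 'r, 'a) fo_structure"
  M1 :: "('f, 'r, 'a) fo_structure"
  M0p :: "('f, 'r, 'a) fo_structure"
  M1p :: "('f, 'r, 'a) fo_structure"
  thy :: "('f, 'r) fm set"
  Delta :: "('f, 'r) order_fm set"
  tree_of :: "('f, 'r) order_fm \<Rightarrow> ('f, 'r) tree_fms"

(* Elements of Or(s). The components X and \<le> are determined by \<phi> and c. *)
record ('f, 'r, 'a) ord_inst =
  ofm :: "('f, 'r) order_fm"
  par :: "'a list"
  bnd :: "'a list"

definition X_set :: "('f, 'r, 'a) fo_structure \<Rightarrow> ('f, 'r) order_fm \<Rightarrow> 'a list \<Rightarrow> 'a list set" where
  "X_set M \<phi> c = {a \<in> tuples M (xlen \<phi>). holds M (matrix \<phi>) (a @ a @ c)}"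

definition X_rel :: "('f, 'r, 'a) fo_structure \<Rightarrow> ('f, 'r) order_fm \<Rightarrow> 'a list \<Rightarrow> 'a list rel" where
  "X_rel M \<phi> c = {(a, b). a \<in> X_set M \<phi> c \<and> b \<in> X_set M \<phi> c \<and> holds M (matrix \<phi>) (a @ b @ c)}"

context
  fixes s :: "('f, 'r, 'a) csp"
begin

definition X_of :: "('f, 'r, 'a) ord_inst \<Rightarrow> 'a list set" where
  "X_of a = X_set (M1 s) (ofm a) (par a)"

definition ord_of :: "('f, 'r, 'a) ord_inst \<Rightarrow> 'a list rel" where
  "ord_of a = X_rel (M1 s) (ofm a) (par a)"

definition le :: "('f, 'r, 'a) ord_inst \<Rightarrow> 'a list \<Rightarrow> 'a list \<Rightarrow> bool" where
  "le a x y \<longleftrightarrow> (x, y) \<in> ord_of a"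

definition lt :: "('f, 'r, 'a) ord_inst \<Rightarrow> 'a list \<Rightarrow> 'a list \<Rightarrow> bool" where
  "lt a x y \<longleftrightarrow> le a x y \<and> x \<noteq> y"

definition max_of :: "('f, 'r, 'a) ord_inst \<Rightarrow> 'a list \<Rightarrow> 'a list \<Rightarrow> 'a list" where
  "max_of a x y = (if le a x y then y else x)"

definition all_orders :: "('f, 'r, 'a) ord_inst set" where
  "all_orders = {a. ofm a \<in> Delta s \<and> par a \<in> tuples (M1 s) (zlen (ofm a)) \<and> bnd a \<in> X_of a}"

definition nontrivial_orders :: "('f, 'r, 'a) ord_inst set" where
  "nontrivial_orders = {a \<in> all_orders. infinite {d. lt a d (bnd a)}}"

definition orders_ok :: bool where
  "orders_ok \<longleftrightarrow>
     (\<forall>\<phi>\<in>Delta s. \<forall>c\<in>tuples (M1 s) (zlen \<phi>).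
        discrete_linear_order_on (X_set (M1 s) \<phi> c) (X_rel (M1 s) \<phi> c) \<and>
        (\<forall>D. D \<subseteq> X_set (M1 s) \<phi> c \<and> D \<noteq> {} \<and> definable (vocp s) (M1p s) (xlen \<phi>) D \<longrightarrow>
           (\<exists>x\<in>D. \<forall>y\<in>D. (x, y) \<in> X_rel (M1 s) \<phi> c) \<and>
           (\<exists>x\<in>D. \<forall>y\<in>D. (y, x) \<in> X_rel (M1 s) \<phi> c)))"

definition is_pairing ::
  "('f, 'r, 'a) ord_inst \<Rightarrow> ('f, 'r, 'a) ord_inst \<Rightarrow> ('f, 'r, 'a) ord_inst \<Rightarrow>
   ('a list \<Rightarrow> 'a list \<Rightarrow> 'a list) \<Rightarrow> bool" where
  "is_pairing a b c Pr \<longleftrightarrow>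
     inj_on (\<lambda>(x, y). Pr x y) (X_of a \<times> X_of b) \<and>
     X_of c = (\<lambda>(x, y). Pr x y) ` (X_of a \<times> X_of b) \<and>
     definable (vocp s) (M1p s) (xlen (ofm a) + xlen (ofm b) + xlen (ofm c))
       {x @ y @ Pr x y | x y. x \<in> X_of a \<and> y \<in> X_of b} \<and>
     definable (vocp s) (M1p s) (xlen (ofm c) + xlen (ofm a))
       {Pr x y @ x | x y. x \<in> X_of a \<and> y \<in> X_of b} \<and>
     definable (vocp s) (M1p s) (xlen (ofm c) + xlen (ofm b))
       {Pr x y @ y | x y. x \<in> X_of a \<and> y \<in> X_of b}"

definition has_products :: bool where
  "has_products \<longleftrightarrow>
     (\<forall>a\<in>nontrivial_orders. \<forall>b\<in>nontrivial_orders.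
        \<exists>c\<in>nontrivial_orders. \<exists>Pr. is_pairing a b c Pr)"

definition has_max_product :: bool where
  "has_max_product \<longleftrightarrow>
     (\<exists>a\<in>nontrivial_orders. \<exists>c\<in>nontrivial_orders. \<exists>Pr. is_pairing a a c Pr \<and>
        (\<forall>x\<in>X_of a. \<exists>y\<in>X_of c. \<forall>x1\<in>X_of a. \<forall>x2\<in>X_of a.
           le a (max_of a x1 x2) x \<longleftrightarrow> le c (Pr x1 x2) y))"

definition tree_set :: "('f, 'r, 'a) ord_inst \<Rightarrow> 'a list set" where
  "tree_set a =
     {b \<in> tuples (M1p s) (tlen (tree_of s (ofm a))).
        holds (M1p s) (mem_fm (tree_of s (ofm a))) (b @ par a @ bnd a)}"

definition is_lg :: "('f, 'r, 'a) ord_inst \<Rightarrow> 'a list \<Rightarrow> 'a list \<Rightarrow> bool" where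
  "is_lg a b u \<longleftrightarrow>
     u \<in> X_of a \<and> holds (M1p s) (lg_fm (tree_of s (ofm a))) (b @ u @ par a @ bnd a)"

definition lg :: "('f, 'r, 'a) ord_inst \<Rightarrow> 'a list \<Rightarrow> 'a list" where
  "lg a b = (THE u. is_lg a b u)"

definition is_val :: "('f, 'r, 'a) ord_inst \<Rightarrow> 'a list \<Rightarrow> 'a list \<Rightarrow> 'a list \<Rightarrow> bool" where
  "is_val a b u v \<longleftrightarrow>
     v \<in> X_of a \<and> holds (M1p s) (val_fm (tree_of s (ofm a))) (b @ u @ v @ par a @ bnd a)"

definition val :: "('f, 'r, 'a) ord_inst \<Rightarrow> 'a list \<Rightarrow> 'a list \<Rightarrow> 'a list" where
  "val a b u = (THE v. is_val a b u v)"

definition tle :: "('f, 'r, 'a) ord_inst \<Rightarrow> 'a list \<Rightarrow> 'a list \<Rightarrow> bool" where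
  "tle a b1 b2 \<longleftrightarrow> b1 \<in> tree_set a \<and> b2 \<in> tree_set a \<and>
     holds (M1p s) (tle_fm (tree_of s (ofm a))) (b1 @ b2 @ par a @ bnd a)"

definition tree_formulas_ok :: "('f, 'r) order_fm \<Rightarrow> bool" where
  "tree_formulas_ok \<phi> \<longleftrightarrow>
     (let t = tree_of s \<phi>; k = tlen t; n = xlen \<phi>; m = zlen \<phi> + xlen \<phi> in
        fm_places (vocp s) (k + m) (mem_fm t) \<and>
        fm_places (vocp s) (k + n + m) (lg_fm t) \<and>
        fm_places (vocp s) (k + n + n + m) (val_fm t) \<and>
        fm_places (vocp s) (k + k + m) (tle_fm t))"

(* T_a is a tree of sequences ordered by initial segment: it is nonempty and closed under
   initial segments, and the tree order is exactly the initial segment relation. (If T_a could be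
   empty, or the tree order could be equality, a tree would say nothing about its order X_a.) *)
definition tree_ok :: "('f, 'r, 'a) ord_inst \<Rightarrow> bool" where
  "tree_ok a \<longleftrightarrow>
     (\<forall>b\<in>tree_set a. \<exists>!u. is_lg a b u) \<and>
     (\<forall>b\<in>tree_set a. \<forall>u. lt a u (lg a b) \<longrightarrow> (\<exists>!v. is_val a b u v)) \<and>
     (\<forall>b\<in>tree_set a. le a (lg a b) (bnd a)) \<and>
     (\<forall>c\<in>tree_set a. \<forall>x\<in>X_of a. lt a (lg a c) (bnd a) \<longrightarrow>
        (\<exists>c'\<in>tree_set a. imm_succ (ord_of a) (lg a c) (lg a c') \<and>
           (\<forall>u. lt a u (lg a c) \<longrightarrow> val a c' u = val a c u) \<and>
           val a c' (lg a c) = x)) \<and>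
     partial_order_on (tree_set a) {(b1, b2). tle a b1 b2} \<and>
     (\<forall>b1\<in>tree_set a. \<forall>b2\<in>tree_set a.
        tle a b1 b2 \<longleftrightarrow>
          le a (lg a b1) (lg a b2) \<and> (\<forall>u. lt a u (lg a b1) \<longrightarrow> val a b2 u = val a b1 u)) \<and>
     (\<forall>b1\<in>tree_set a. \<forall>b2\<in>tree_set a. b1 \<noteq> b2 \<and> lg a b1 = lg a b2 \<longrightarrow>
        (\<exists>u. lt a u (lg a b1) \<and> val a b1 u \<noteq> val a b2 u)) \<and>
     tree_set a \<noteq> {} \<and>
     (\<forall>b\<in>tree_set a. \<forall>u. le a u (lg a b) \<longrightarrow> (\<exists>b'\<in>tree_set a. lg a b' = u \<and> tle a b' b))"

definition cofinality_spectrum_problem :: bool where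
  "cofinality_spectrum_problem \<longleftrightarrow>
     sub_vocabulary (voc s) (vocp s) \<and>
     elementary_sub (voc s) (M0 s) (M1 s) \<and>
     elementary_sub (vocp s) (M0p s) (M1p s) \<and>
     expands (voc s) (M0p s) (M0 s) \<and>
     expands (voc s) (M1p s) (M1 s) \<and>
     theory_of (voc s) (M0 s) \<subseteq> thy s \<and>
     thy s \<subseteq> sentences (vocp s) \<and>
     (\<forall>\<phi>\<in>thy s. models (M1p s) \<phi>) \<and>
     Delta s \<noteq> {} \<and>
     (\<forall>\<phi>\<in>Delta s. fm_places (voc s) (xlen \<phi> + xlen \<phi> + zlen \<phi>) (matrix \<phi>)) \<and>
     orders_ok \<and>
     nontrivial_orders \<noteq> {} \<and>
     has_products \<and>
     has_max_product \<and>
     (\<forall>\<phi>\<in>Delta s. tree_formulas_ok \<phi>) \<and>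
     (\<forall>a\<in>nontrivial_orders. tree_ok a)"

end


section \<open>Cuts and unbounded towers\<close>

(* Cardinals are represented by cardinal orders on 'a list. Every X_a and every T_a is a subset
   of this type, so every length of a strictly monotone sequence in them is represented. *)

definition least_card :: "'b rel set \<Rightarrow> 'b rel" where
  "least_card R = (SOME r. r \<in> R \<and> (\<forall>r'\<in>R. r \<le>o r'))"

definition cf :: "'b rel \<Rightarrow> 'b rel" where
  "cf r = least_card {|K| | K. K \<subseteq> Field r \<and> (\<forall>i\<in>Field r. \<exists>j\<in>K. (i, j) \<in> r)}"

definition is_cut ::
  "('f, 'r, 'a) csp \<Rightarrow> ('f, 'r, 'a) ord_inst \<Rightarrow> 'a list rel \<Rightarrow> 'a list rel \<Rightarrow>
   'a list set \<Rightarrow> 'a list set \<Rightarrow> bool" where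
  "is_cut s a \<kappa>1 \<kappa>2 C1 C2 \<longleftrightarrow>
     C1 \<union> C2 = X_of s a \<and> C1 \<inter> C2 = {} \<and>
     (\<forall>x\<in>C1. \<forall>y. le s a y x \<longrightarrow> y \<in> C1) \<and>
     (\<forall>x\<in>C2. \<forall>y. le s a x y \<longrightarrow> y \<in> C2) \<and>
     (\<forall>x\<in>C1. \<forall>y\<in>C2. lt s a x y) \<and>
     (\<exists>f. f ` Field \<kappa>1 \<subseteq> C1 \<and>
          (\<forall>i j. (i, j) \<in> \<kappa>1 \<and> i \<noteq> j \<longrightarrow> lt s a (f i) (f j)) \<and>
          (\<forall>x\<in>C1. \<exists>i\<in>Field \<kappa>1. le s a x (f i))) \<and>
     (\<exists>g. g ` Field \<kappa>2 \<subseteq> C2 \<and>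
          (\<forall>i j. (i, j) \<in> \<kappa>2 \<and> i \<noteq> j \<longrightarrow> lt s a (g j) (g i)) \<and>
          (\<forall>x\<in>C2. \<exists>i\<in>Field \<kappa>2. le s a (g i) x))"

definition cut_spectrum :: "('f, 'r, 'a) csp \<Rightarrow> ('a list rel \<times> 'a list rel) set" where
  "cut_spectrum s =
     {(\<kappa>1, \<kappa>2). Cinfinite \<kappa>1 \<and> regularCard \<kappa>1 \<and> Cinfinite \<kappa>2 \<and> regularCard \<kappa>2 \<and>
        (\<exists>a\<in>nontrivial_orders s. \<exists>C1 C2. is_cut s a \<kappa>1 \<kappa>2 C1 C2)}"

definition unbounded_tower ::
  "('f, 'r, 'a) csp \<Rightarrow> ('f, 'r, 'a) ord_inst \<Rightarrow> 'a list rel \<Rightarrow> ('a list \<Rightarrow> 'a list) \<Rightarrow> bool" where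
  "unbounded_tower s a \<delta> b \<longleftrightarrow>
     b ` Field \<delta> \<subseteq> tree_set s a \<and>
     (\<forall>i j. (i, j) \<in> \<delta> \<and> i \<noteq> j \<longrightarrow> tle s a (b i) (b j) \<and> b i \<noteq> b j) \<and>
     \<not> (\<exists>c\<in>tree_set s a. \<forall>i\<in>Field \<delta>. tle s a (b i) c)"

definition t_of :: "('f, 'r, 'a) csp \<Rightarrow> 'a list rel" where
  "t_of s = least_card
     {\<kappa>. Cinfinite \<kappa> \<and>
        (\<exists>a\<in>nontrivial_orders s. \<exists>\<delta> b. Well_order \<delta> \<and> cf \<delta> =o cf \<kappa> \<and> unbounded_tower s a \<delta> b)}"

definition cut_spectrum_below ::
  "('f, 'r, 'a) csp \<Rightarrow> 'b rel \<Rightarrow> ('a list rel \<times> 'a list rel) set" where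
  "cut_spectrum_below s \<mu> = {(\<kappa>1, \<kappa>2) \<in> cut_spectrum s. \<kappa>1 +c \<kappa>2 <o \<mu>}"

end

theory Submission
  imports Defs
begin

text \<open>
  Choose a cut for which \<open>\<kappa>1 + \<kappa>2\<close> is minimal and let \<open>lam\<close> be the length of its longer side. By
  minimality, fewer than \<open>lam\<close> many definable constraints on positions in a tree can be met
  simultaneously, and by \<open>lam < t\<close> towers of length at most \<open>lam\<close> have upper bounds. Together these
  give a construction of towers of length \<open>lam\<close> with prescribed entries, and every subset of
  cardinality less than \<open>lam\<close> is covered by the range of an internal sequence that respects a given
  definable relation. If both sides of the cut have length \<open>lam\<close>, the upper bound of a tower listing
  pairs from the two sides has a last entry that fills the cut. If one side has length
  \<open>\<kappa> < lam\<close>, then, by overspill, internal sets over a small infinite initial segment of the order are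
  coded by its elements, and a tower of coded sets leads to a contradiction with the fact that a
  well-order of cardinality greater than \<open>\<kappa>\<close> cannot have injections of its proper initial segments
  into \<open>\<kappa>\<close> that are bounded by one \<open>\<epsilon> < \<kappa>\<close> on a set of cardinality greater than \<open>\<kappa>\<close>.
\<close>

section \<open>Definable predicates\<close>

text \<open>Nothing is known beforehand about the entries of a bound above its tower. Control is
  regained because the positions up to which a definable condition holds have a last element, and
  this element lies above the whole tower. A single condition is handled that way; several at once
  need interpolation, and this is where the minimality of the cut enters. A bound may also leave no
  room for further steps, so that positions close to the end have to be avoided as well.

  If \<open>\<kappa> < lam\<close>, the shorter side is exhausted before the tower ends and cannot
  be listed along with the longer one. It is reached through functions with values in
  \<open>\<kappa>\<close> instead. Sets of such functions must then occur in single entries of a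
  tower, hence as elements of an order, whereas covering produces sequences, which are elements of a
  tree. This is the reason for the coding, and it is applied twice: to the functions and to sets of
  their codes. Since a coding is faithful only below a small position, the gap is moved below that
  position, each of its points being replaced by a place in a sequence.\<close>

fun rename_tm :: "(nat \<Rightarrow> nat) \<Rightarrow> 'f tm \<Rightarrow> 'f tm" where
  "rename_tm f (Var n) = Var (f n)"
| "rename_tm f (Fn g ts) = Fn g (map (rename_tm f) ts)"

text \<open>The bound variable becomes an index above the images of all free variables of the body,
  so that nothing is captured even if \<open>f\<close> is not injective. Inserting \<open>0\<close>
  keeps the argument of \<open>Max\<close> nonempty.\<close>

fun rename_fm :: "(nat \<Rightarrow> nat) \<Rightarrow> ('f, 'r) fm \<Rightarrow> ('f, 'r) fm" where
  "rename_fm f (Eq s t) = Eq (rename_tm f s) (rename_tm f t)"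
| "rename_fm f (Rel R ts) = Rel R (map (rename_tm f) ts)"
| "rename_fm f (Neg \<phi>) = Neg (rename_fm f \<phi>)"
| "rename_fm f (Conj \<phi> \<psi>) = Conj (rename_fm f \<phi>) (rename_fm f \<psi>)"
| "rename_fm f (Ex n \<phi>) =
     (let m = Suc (Max (insert 0 (f ` free_vars \<phi>))) in Ex m (rename_fm (f(n := m)) \<phi>))"

lemma finite_tm_vars [simp]: "finite (tm_vars t)"
  by (induction t) auto

lemma finite_free_vars [simp]: "finite (free_vars \<phi>)"
  by (induction \<phi>) auto

lemma tm_val_cong: "(\<And>x. x \<in> tm_vars t \<Longrightarrow> e x = e' x) \<Longrightarrow> tm_val M e t = tm_val M e' t"
proof (induction t)
  case (Var n)
  then show ?case by simp
next
  case (Fn f ts)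
  have "map (tm_val M e) ts = map (tm_val M e') ts"
  proof (rule map_cong[OF refl])
    fix t assume "t \<in> set ts"
    then show "tm_val M e t = tm_val M e' t"
      by (rule Fn.IH) (use Fn.prems \<open>t \<in> set ts\<close> in auto)
  qed
  then show ?case by (metis tm_val.simps(2))
qed

lemma sat_cong: "(\<And>x. x \<in> free_vars \<phi> \<Longrightarrow> e x = e' x) \<Longrightarrow> sat M e \<phi> = sat M e' \<phi>"
proof (induction \<phi> arbitrary: e e')
  case (Eq s t)
  then show ?case using tm_val_cong[of s e e' M] tm_val_cong[of t e e' M] by simp
next
  case (Rel R ts)
  have "map (tm_val M e) ts = map (tm_val M e') ts"
  proof (rule map_cong[OF refl])
    fix t assume "t \<in> set ts"
    then show "tm_val M e t = tm_val M e' t"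
      by (intro tm_val_cong) (use Rel.prems in auto)
  qed
  then show ?case by (metis sat.simps(2))
next
  case (Conj \<phi> \<psi>)
  have "sat M e \<phi> = sat M e' \<phi>" "sat M e \<psi> = sat M e' \<psi>"
    by (rule Conj.IH, simp add: Conj.prems)+
  then show ?case by simp
next
  case (Ex n \<phi>)
  have "sat M (e(n := a)) \<phi> = sat M (e'(n := a)) \<phi>" for a
    by (rule Ex.IH) (use Ex.prems in auto)
  then show ?case by simp
next
  case (Neg \<phi>)
  have "sat M e \<phi> = sat M e' \<phi>" by (rule Neg.IH) (use Neg.prems in auto)
  then show ?case by simp
qed

lemma tm_val_rename: "tm_val M e (rename_tm f t) = tm_val M (e \<circ> f) t"
proof (induction t)
  case (Fn g ts)
  have "map (tm_val M e) (map (rename_tm f) ts) = map (tm_val M (e \<circ> f)) ts"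
    unfolding map_map by (rule map_cong[OF refl]) (simp add: Fn.IH comp_def)
  then show ?case by (metis tm_val.simps(2) rename_tm.simps(2))
qed auto

lemma sat_rename: "sat M e (rename_fm f \<phi>) = sat M (e \<circ> f) \<phi>"
proof (induction \<phi> arbitrary: e f)
  case (Rel R ts)
  have "map (tm_val M e \<circ> rename_tm f) ts = map (tm_val M (e \<circ> f)) ts"
    by (simp add: tm_val_rename)
  then show ?case by (simp only: sat.simps rename_fm.simps map_map)
next
  case (Ex n \<phi>)
  define m where "m = Suc (Max (insert 0 (f ` free_vars \<phi>)))"
  have fresh: "f x \<noteq> m" if "x \<in> free_vars \<phi>" for x
    using that Max_ge[of "insert 0 (f ` free_vars \<phi>)" "f x"] unfolding m_def by fastforce
  have "sat M (e(m := a) \<circ> f(n := m)) \<phi> = sat M ((e \<circ> f)(n := a)) \<phi>" for a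
    by (rule sat_cong) (auto simp: fresh)
  then show ?case by (simp only: rename_fm.simps Let_def m_def[symmetric] sat.simps Ex.IH)
qed (auto simp: tm_val_rename)

lemma tm_in_rename [simp]: "tm_in L (rename_tm f t) = tm_in L t"
  by (induction t) auto

lemma fm_in_rename [simp]: "fm_in L (rename_fm f \<phi>) = fm_in L \<phi>"
  by (induction \<phi> arbitrary: f) (auto simp: Let_def)

lemma tm_vars_rename: "tm_vars (rename_tm f t) = f ` tm_vars t"
  by (induction t) auto

lemma free_vars_rename: "free_vars (rename_fm f \<phi>) \<subseteq> f ` free_vars \<phi>"
proof (induction \<phi> arbitrary: f)
  case (Ex n \<phi>)
  define m where "m = Suc (Max (insert 0 (f ` free_vars \<phi>)))"
  have "free_vars (rename_fm (f(n := m)) \<phi>) \<subseteq> f(n := m) ` free_vars \<phi>" by (rule Ex.IH)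
  then show ?case by (auto simp: Let_def m_def[symmetric])
next
  case (Conj \<phi> \<psi>)
  then show ?case by (simp add: image_Un) blast
qed (auto simp: tm_vars_rename)

lemma tm_val_in_dom:
  assumes "is_structure L M" "tm_in L t" "range e \<subseteq> dom_of M"
  shows "tm_val M e t \<in> dom_of M"
  using assms(2)
proof (induction t)
  case (Var n)
  then show ?case using assms(3) by auto
next
  case (Fn f ts)
  then have "map (tm_val M e) ts \<in> tuples M (length ts)" by (auto simp: tuples_def)
  then show ?case using assms(1) Fn.prems by (auto simp: is_structure_def)
qed

lemma tm_val_expands:
  assumes "is_structure L M" "expands L M' M" "tm_in L t" "range e \<subseteq> dom_of M"
  shows "tm_val M' e t = tm_val M e t"
  using assms(3)
proof (induction t)
  case (Fn f ts)
  have eq: "map (tm_val M' e) ts = map (tm_val M e) ts" using Fn by auto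
  have "set (map (tm_val M e) ts) \<subseteq> dom_of M"
    using Fn.prems tm_val_in_dom[OF assms(1) _ assms(4)] by auto
  then have "fun_int M' f (map (tm_val M e) ts) = fun_int M f (map (tm_val M e) ts)"
    using assms(2) Fn.prems by (fastforce simp: expands_def agree_on_def)
  then show ?case using eq by (simp only: tm_val.simps)
qed auto

lemma sat_expands:
  assumes "is_structure L M" "expands L M' M" "fm_in L \<phi>" "range e \<subseteq> dom_of M"
  shows "sat M' e \<phi> = sat M e \<phi>"
  using assms(3,4)
proof (induction \<phi> arbitrary: e)
  case (Eq s t)
  then show ?case using tm_val_expands[OF assms(1,2)] by auto
next
  case (Rel R ts)
  have eq: "map (tm_val M' e) ts = map (tm_val M e) ts"
    using Rel tm_val_expands[OF assms(1,2)] by auto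
  have "set (map (tm_val M e) ts) \<subseteq> dom_of M"
    using Rel.prems tm_val_in_dom[OF assms(1)] by auto
  then have "rel_int M' R (map (tm_val M e) ts) = rel_int M R (map (tm_val M e) ts)"
    using assms(2) Rel.prems by (fastforce simp: expands_def agree_on_def)
  then show ?case using eq by (simp only: sat.simps)
next
  case (Ex n \<phi>)
  have "dom_of M' = dom_of M" using assms(2) by (simp add: expands_def)
  moreover have "sat M' (e(n := a)) \<phi> = sat M (e(n := a)) \<phi>" if "a \<in> dom_of M" for a
    using Ex.prems that by (intro Ex.IH) auto
  ultimately show ?case by auto
qed auto

section \<open>Closure properties of predicates definable with parameters\<close>

definition subst_env :: "(nat \<Rightarrow> nat + 'a) \<Rightarrow> (nat \<Rightarrow> 'a) \<Rightarrow> nat \<Rightarrow> 'a" where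
  "subst_env \<sigma> e i = case_sum e id (\<sigma> i)"

definition shift :: "nat \<Rightarrow> (nat \<Rightarrow> 'a) \<Rightarrow> nat \<Rightarrow> 'a" where
  "shift m e i = e (i + m)"

definition front :: "nat \<Rightarrow> (nat \<Rightarrow> 'a) \<Rightarrow> 'a list" where
  "front m e = map e [0..<m]"

text \<open>
  \<open>DP\<close> holds of the predicates on assignments that are definable with parameters, and \<open>TM k\<close> of the
  maps from assignments to \<open>k\<close>-tuples whose components are variables and parameters. The rules are
  in a higher-order style: binding a tuple of length \<open>m\<close> makes it the first \<open>m\<close> values of the
  assignment and shifts all other variables by \<open>m\<close>.
\<close>

locale defs_in =
  fixes L :: "('f, 'r) vocabulary" and M :: "('f, 'r, 'a) fo_structure"
  assumes dom_nonempty: "dom_of M \<noteq> {}"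
begin

abbreviation env :: "(nat \<Rightarrow> 'a) \<Rightarrow> bool" where
  "env e \<equiv> range e \<subseteq> dom_of M"

definition DP :: "((nat \<Rightarrow> 'a) \<Rightarrow> bool) \<Rightarrow> bool" where
  "DP P \<longleftrightarrow> (\<exists>\<psi> \<sigma>. fm_in L \<psi> \<and> range \<sigma> \<subseteq> range Inl \<union> Inr ` dom_of M \<and>
     (\<forall>e. env e \<longrightarrow> P e = sat M (subst_env \<sigma> e) \<psi>))"

definition TM :: "nat \<Rightarrow> ((nat \<Rightarrow> 'a) \<Rightarrow> 'a list) \<Rightarrow> bool" where
  "TM k t \<longleftrightarrow> (\<exists>vs. length vs = k \<and> set vs \<subseteq> range Inl \<union> Inr ` dom_of M \<and>
     t = (\<lambda>e. map (case_sum e id) vs))"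

lemma env_subst:
  assumes "env e" "range \<sigma> \<subseteq> range Inl \<union> Inr ` dom_of M"
  shows "env (subst_env \<sigma> e)"
proof
  fix x assume "x \<in> range (subst_env \<sigma> e)"
  then obtain i where "x = case_sum e id (\<sigma> i)" by (auto simp: subst_env_def)
  moreover have "\<sigma> i \<in> range Inl \<union> Inr ` dom_of M" using assms(2) by auto
  ultimately show "x \<in> dom_of M" using assms(1) by auto
qed

lemma DP_cong: "(\<And>e. env e \<Longrightarrow> P e = Q e) \<Longrightarrow> DP P = DP Q"
  unfolding DP_def by (intro iff_exI) auto

lemma DP_subst:
  assumes "DP P" "range \<sigma> \<subseteq> range Inl \<union> Inr ` dom_of M"
  shows "DP (\<lambda>e. P (subst_env \<sigma> e))"
proof -
  obtain \<psi> \<tau> where 1: "fm_in L \<psi>" "range \<tau> \<subseteq> range Inl \<union> Inr ` dom_of M"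
    "\<And>e. env e \<Longrightarrow> P e = sat M (subst_env \<tau> e) \<psi>"
    using assms(1) unfolding DP_def by blast
  define \<rho> where "\<rho> i = (case \<tau> i of Inl n \<Rightarrow> \<sigma> n | Inr c \<Rightarrow> Inr c)" for i
  have "subst_env \<tau> (subst_env \<sigma> e) = subst_env \<rho> e" for e
    by (auto simp: subst_env_def \<rho>_def fun_eq_iff split: sum.split)
  moreover have "\<rho> i \<in> range Inl \<union> Inr ` dom_of M" for i
  proof (cases "\<tau> i")
    case (Inl n)
    then show ?thesis using assms(2) by (auto simp: \<rho>_def)
  next
    case (Inr c)
    have "\<tau> i \<in> range Inl \<union> Inr ` dom_of M" using 1(2) by auto
    then show ?thesis using Inr by (auto simp: \<rho>_def)
  qed
  ultimately show ?thesis unfolding DP_def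
    using 1 env_subst[OF _ assms(2)] by (intro exI[of _ \<psi>] exI[of _ \<rho>]) auto
qed

lemma DP_not: "DP P \<Longrightarrow> DP (\<lambda>e. \<not> P e)"
  unfolding DP_def
proof (elim exE conjE)
  fix \<psi> \<sigma>
  assume "fm_in L \<psi>" "range \<sigma> \<subseteq> range Inl \<union> Inr ` dom_of M"
    "\<forall>e. env e \<longrightarrow> P e = sat M (subst_env \<sigma> e) \<psi>"
  then show "\<exists>\<psi> \<sigma>. fm_in L \<psi> \<and> range \<sigma> \<subseteq> range Inl \<union> Inr ` dom_of M \<and>
     (\<forall>e. env e \<longrightarrow> (\<not> P e) = sat M (subst_env \<sigma> e) \<psi>)"
    by (intro exI[of _ "Neg \<psi>"] exI[of _ \<sigma>]) simp
qed

lemma DP_conj: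
  assumes "DP P" "DP Q"
  shows "DP (\<lambda>e. P e \<and> Q e)"
proof -
  obtain \<psi> \<sigma> where 1: "fm_in L \<psi>" "range \<sigma> \<subseteq> range Inl \<union> Inr ` dom_of M"
    "\<And>e. env e \<Longrightarrow> P e = sat M (subst_env \<sigma> e) \<psi>"
    using assms(1) unfolding DP_def by blast
  obtain \<psi>' \<sigma>' where 2: "fm_in L \<psi>'" "range \<sigma>' \<subseteq> range Inl \<union> Inr ` dom_of M"
    "\<And>e. env e \<Longrightarrow> Q e = sat M (subst_env \<sigma>' e) \<psi>'"
    using assms(2) unfolding DP_def by blast
  \<comment> \<open>The variables of the two formulas are kept apart: even indices read
    \<open>\<sigma>\<close>, odd ones \<open>\<sigma>'\<close>.\<close>
  define \<rho> where "\<rho> i = (if even i then \<sigma> (i div 2) else \<sigma>' (i div 2))" for i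
  define \<chi> where "\<chi> = Conj (rename_fm (\<lambda>i. 2 * i) \<psi>) (rename_fm (\<lambda>i. Suc (2 * i)) \<psi>')"
  have "subst_env \<rho> e \<circ> (\<lambda>i. 2 * i) = subst_env \<sigma> e" for e
    by (auto simp: subst_env_def \<rho>_def fun_eq_iff)
  moreover have "subst_env \<rho> e \<circ> (\<lambda>i. Suc (2 * i)) = subst_env \<sigma>' e" for e
    by (auto simp: subst_env_def \<rho>_def fun_eq_iff)
  moreover have "range \<rho> \<subseteq> range Inl \<union> Inr ` dom_of M"
    using 1(2) 2(2) unfolding \<rho>_def by (intro image_subsetI) (metis rangeI subsetD)
  ultimately show ?thesis unfolding DP_def using 1 2
    by (intro exI[of _ \<chi>] exI[of _ \<rho>]) (auto simp: \<chi>_def sat_rename)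
qed

lemma DP_ex1:
  assumes "DP P"
  shows "DP (\<lambda>e. \<exists>a\<in>dom_of M. P (e(n := a)))"
proof -
  obtain \<psi> \<sigma> where 1: "fm_in L \<psi>" "range \<sigma> \<subseteq> range Inl \<union> Inr ` dom_of M"
    "\<And>e. env e \<Longrightarrow> P e = sat M (subst_env \<sigma> e) \<psi>"
    using assms(1) unfolding DP_def by blast
  \<comment> \<open>All formula variables that read place \<open>n\<close> are merged into the
    quantified variable \<open>0\<close>, and the others move up by one. The value of
    \<open>\<rho>\<close> at \<open>0\<close> is a dummy.\<close>
  define f where "f i = (if \<sigma> i = Inl n then 0 else Suc i)" for i
  define \<rho> where "\<rho> i = (case i of 0 \<Rightarrow> Inl 0 | Suc j \<Rightarrow> \<sigma> j)" for i
  have "((subst_env \<rho> e)(0 := a)) \<circ> f = subst_env \<sigma> (e(n := a))" for e a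
    by (auto simp: subst_env_def \<rho>_def f_def fun_eq_iff split: sum.split)
  moreover have "range \<rho> \<subseteq> range Inl \<union> Inr ` dom_of M"
    using 1(2) unfolding \<rho>_def by (intro image_subsetI) (auto split: nat.split)
  moreover have "P (e(n := a)) = sat M (subst_env \<sigma> (e(n := a))) \<psi>" if "env e" "a \<in> dom_of M" for e a
    using that by (intro 1(3)) auto
  ultimately show ?thesis unfolding DP_def using 1(1)
    by (intro exI[of _ "Ex 0 (rename_fm f \<psi>)"] exI[of _ \<rho>]) (auto simp: sat_rename)
qed

lemma TM_tuples: "TM k t \<Longrightarrow> env e \<Longrightarrow> t e \<in> tuples M k"
  unfolding TM_def tuples_def by force

lemma TM_const: "c \<in> tuples M k \<Longrightarrow> TM k (\<lambda>e. c)"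
  unfolding TM_def tuples_def by (intro exI[of _ "map Inr c"]) (auto simp: comp_def)

lemma TM_front: "TM k (\<lambda>e. front k e)"
  unfolding TM_def front_def by (intro exI[of _ "map Inl [0..<k]"]) (auto simp: comp_def)

lemma TM_shift:
  assumes "TM k t"
  shows "TM k (\<lambda>e. t (shift m e))"
proof -
  obtain vs where vs: "length vs = k" "set vs \<subseteq> range Inl \<union> Inr ` dom_of M"
    "t = (\<lambda>e. map (case_sum e id) vs)"
    using assms unfolding TM_def by blast
  show ?thesis unfolding TM_def
  proof (intro exI conjI)
    let ?vs = "map (case_sum (\<lambda>i. Inl (i + m)) Inr) vs"
    show "length ?vs = k" by (simp add: vs)
    have "case_sum (\<lambda>i. Inl (i + m)) Inr x \<in> range Inl \<union> Inr ` dom_of M" if "x \<in> set vs" for x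
      using vs(2) that by (cases x) auto
    then show "set ?vs \<subseteq> range Inl \<union> Inr ` dom_of M"
      unfolding set_map by (rule image_subsetI)
    show "(\<lambda>e. t (shift m e)) = (\<lambda>e. map (case_sum e id) ?vs)"
      by (auto simp: vs(3) shift_def fun_eq_iff split: sum.split)
  qed
qed

lemma TM_append: "TM k t \<Longrightarrow> TM l u \<Longrightarrow> TM (k + l) (\<lambda>e. t e @ u e)"
  unfolding TM_def
proof (elim exE conjE)
  fix vs ws assume "length vs = k" "set vs \<subseteq> range Inl \<union> Inr ` dom_of M" "t = (\<lambda>e. map (case_sum e id) vs)"
    "length ws = l" "set ws \<subseteq> range Inl \<union> Inr ` dom_of M" "u = (\<lambda>e. map (case_sum e id) ws)"
  then show "\<exists>vs. length vs = k + l \<and> set vs \<subseteq> range Inl \<union> Inr ` dom_of M \<and>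
     (\<lambda>e. t e @ u e) = (\<lambda>e. map (case_sum e id) vs)"
    by (intro exI[of _ "vs @ ws"]) auto
qed

lemma DP_holds:
  assumes "fm_places L k \<phi>" "TM k t"
  shows "DP (\<lambda>e. holds M \<phi> (t e))"
proof -
  obtain vs where vs: "length vs = k" "set vs \<subseteq> range Inl \<union> Inr ` dom_of M"
    "t = (\<lambda>e. map (case_sum e id) vs)"
    using assms(2) unfolding TM_def by blast
  define \<sigma> where "\<sigma> i = (if i < k then vs ! i else Inl 0)" for i
  have "holds M \<phi> (t e) = sat M (subst_env \<sigma> e) \<phi>" for e
    unfolding holds_def using assms(1)
    by (intro sat_cong) (auto simp: vs subst_env_def \<sigma>_def fm_places_def)
  moreover have "range \<sigma> \<subseteq> range Inl \<union> Inr ` dom_of M"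
    using vs(1) subsetD[OF vs(2) nth_mem] by (auto simp: \<sigma>_def)
  ultimately show ?thesis unfolding DP_def
    using assms(1) by (auto simp: fm_places_def)
qed

lemma DP_in_definable:
  assumes "definable L M k D" "TM k t"
  shows "DP (\<lambda>e. t e \<in> D)"
proof -
  obtain \<psi> p where 1: "fm_places L (k + length p) \<psi>" "set p \<subseteq> dom_of M"
    "D = {as \<in> tuples M k. holds M \<psi> (as @ p)}"
    using assms(1) unfolding definable_def by blast
  have "TM (k + length p) (\<lambda>e. t e @ p)"
    using 1(2) by (intro TM_append TM_const assms(2)) (simp add: tuples_def)
  from DP_holds[OF 1(1) this] show ?thesis
    by (rule DP_cong[THEN iffD1, rotated]) (use TM_tuples[OF assms(2)] in \<open>auto simp: 1(3)\<close>)
qed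

lemma DP_True: "DP (\<lambda>e. True)"
  unfolding DP_def
  by (intro exI[of _ "Eq (Var 0) (Var 0)"] exI[of _ Inl]) auto

lemma DP_eq:
  assumes "TM k t" "TM k u"
  shows "DP (\<lambda>e. t e = u e)"
proof -
  obtain vs where vs: "length vs = k" "set vs \<subseteq> range Inl \<union> Inr ` dom_of M"
    "t = (\<lambda>e. map (case_sum e id) vs)"
    using assms(1) unfolding TM_def by blast
  obtain ws where ws: "length ws = k" "set ws \<subseteq> range Inl \<union> Inr ` dom_of M"
    "u = (\<lambda>e. map (case_sum e id) ws)"
    using assms(2) unfolding TM_def by blast
  have "DP (\<lambda>e. \<forall>j<n. t e ! j = u e ! j)" if "n \<le> k" for n
    using that
  proof (induction n)
    case 0
    then show ?case using DP_True by simp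
  next
    case (Suc n)
    define \<sigma> where "\<sigma> i = (if i = 0 then vs ! n else ws ! n)" for i :: nat
    have "range \<sigma> \<subseteq> range Inl \<union> Inr ` dom_of M"
      using Suc.prems vs(1) ws(1) subsetD[OF vs(2) nth_mem, of n] subsetD[OF ws(2) nth_mem, of n]
      unfolding \<sigma>_def by (intro image_subsetI) auto
    moreover have "(t e ! n = u e ! n) = sat M (subst_env \<sigma> e) (Eq (Var 0) (Var 1))" for e
      using Suc.prems vs(1) ws(1) by (auto simp: \<sigma>_def subst_env_def vs(3) ws(3))
    ultimately have "DP (\<lambda>e. t e ! n = u e ! n)"
      unfolding DP_def by (intro exI[of _ "Eq (Var 0) (Var 1)"] exI[of _ \<sigma>]) auto
    then have "DP (\<lambda>e. (\<forall>j<n. t e ! j = u e ! j) \<and> t e ! n = u e ! n)"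
      using Suc by (intro DP_conj) auto
    then show ?case by (simp add: All_less_Suc conj_commute)
  qed
  from this[of k] show ?thesis
    by (rule DP_cong[THEN iffD1, rotated]) (auto simp: list_eq_iff_nth_eq vs ws)
qed

lemma DP_ex_front:
  assumes "DP P"
  shows "DP (\<lambda>e. \<exists>x\<in>tuples M m. P (\<lambda>i. if i < m then x ! i else e i))"
  using assms
proof (induction m arbitrary: P)
  case 0
  then show ?case by (simp add: tuples_def)
next
  case (Suc m)
  have "DP (\<lambda>e. \<exists>a\<in>dom_of M. P (e(m := a)))" by (rule DP_ex1) fact
  from Suc.IH[OF this]
  have "DP (\<lambda>e. \<exists>x\<in>tuples M m. \<exists>a\<in>dom_of M. P ((\<lambda>i. if i < m then x ! i else e i)(m := a)))" .
  moreover have "(\<exists>x\<in>tuples M m. \<exists>a\<in>dom_of M. P ((\<lambda>i. if i < m then x ! i else e i)(m := a)))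
      \<longleftrightarrow> (\<exists>x\<in>tuples M (Suc m). P (\<lambda>i. if i < Suc m then x ! i else e i))" for e :: "nat \<Rightarrow> 'a"
  proof -
    have tup: "tuples M (Suc m) = (\<lambda>(x, a). x @ [a]) ` (tuples M m \<times> dom_of M)"
    proof (intro equalityI subsetI)
      fix y assume y: "y \<in> tuples M (Suc m)"
      then have "y = butlast y @ [last y]" "last y \<in> set y" "set (butlast y) \<subseteq> set y"
        by (cases "y = []"; auto simp: tuples_def dest: in_set_butlastD)+
      with y show "y \<in> (\<lambda>(x, a). x @ [a]) ` (tuples M m \<times> dom_of M)"
        by (intro image_eqI[of _ _ "(butlast y, last y)"]) (auto simp: tuples_def)
    qed (auto simp: tuples_def)
    have "(\<lambda>i. if i < m then x ! i else e i)(m := a) =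
        (\<lambda>i. if i < Suc m then (x @ [a]) ! i else e i)" if "x \<in> tuples M m" for x a
      using that by (auto simp: tuples_def fun_eq_iff nth_append)
    then show ?thesis unfolding tup by (auto cong: bex_cong)
  qed
  ultimately show ?case by simp
qed

lemma DP_ex:
  assumes "DP (\<lambda>e. P (shift m e) (front m e))"
  shows "DP (\<lambda>e. \<exists>x\<in>tuples M m. P e x)"
proof -
  obtain d where d: "d \<in> dom_of M" using dom_nonempty by blast
  \<comment> \<open>This substitution moves the assignment up by \<open>m\<close> places; the dummy
    \<open>d\<close> in the first \<open>m\<close> of them is overwritten by
    \<open>g x\<close>.\<close>
  define \<sigma> :: "nat \<Rightarrow> nat + 'a" where "\<sigma> i = (if i < m then Inr d else Inl (i - m))" for i
  have r: "range \<sigma> \<subseteq> range Inl \<union> Inr ` dom_of M" using d by (auto simp: \<sigma>_def)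
  define g where "g x e i = (if i < m then x ! i else e i)" for x :: "'a list" and e i
  have "DP (\<lambda>e. \<exists>x\<in>tuples M m. P (shift m (g x e)) (front m (g x e)))"
    using DP_ex_front[OF assms, of m] unfolding g_def .
  then have "DP (\<lambda>e. \<exists>x\<in>tuples M m. P (shift m (g x (subst_env \<sigma> e))) (front m (g x (subst_env \<sigma> e))))"
    by (rule DP_subst[OF _ r])
  moreover have "(\<exists>x\<in>tuples M m. P (shift m (g x (subst_env \<sigma> e))) (front m (g x (subst_env \<sigma> e))))
      = (\<exists>x\<in>tuples M m. P e x)" for e
  proof (rule bex_cong)
    fix x assume x: "x \<in> tuples M m"
    have "shift m (g x (subst_env \<sigma> e)) = e"
      by (auto simp: shift_def subst_env_def \<sigma>_def g_def)
    moreover have "front m (g x (subst_env \<sigma> e)) = x"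
      using x by (auto simp: front_def tuples_def list_eq_iff_nth_eq g_def)
    ultimately show "P (shift m (g x (subst_env \<sigma> e))) (front m (g x (subst_env \<sigma> e))) = P e x"
      by simp
  qed simp
  ultimately show ?thesis by simp
qed

lemma DP_disj:
  assumes "DP P" "DP Q"
  shows "DP (\<lambda>e. P e \<or> Q e)"
proof -
  have "DP (\<lambda>e. \<not> (\<not> P e \<and> \<not> Q e))" by (intro DP_not DP_conj assms)
  then show ?thesis by simp
qed

lemma DP_imp:
  assumes "DP P" "DP Q"
  shows "DP (\<lambda>e. P e \<longrightarrow> Q e)"
proof -
  have "DP (\<lambda>e. \<not> P e \<or> Q e)" by (intro DP_not DP_disj assms)
  moreover have "(\<lambda>e. \<not> P e \<or> Q e) = (\<lambda>e. P e \<longrightarrow> Q e)" by auto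
  ultimately show ?thesis by (rule subst[rotated])
qed

lemma DP_iff:
  assumes "DP P" "DP Q"
  shows "DP (\<lambda>e. P e \<longleftrightarrow> Q e)"
proof -
  have "DP (\<lambda>e. (P e \<longrightarrow> Q e) \<and> (Q e \<longrightarrow> P e))" by (intro DP_imp DP_conj assms)
  moreover have "(\<lambda>e. (P e \<longrightarrow> Q e) \<and> (Q e \<longrightarrow> P e)) = (\<lambda>e. P e \<longleftrightarrow> Q e)" by auto
  ultimately show ?thesis by (rule subst[rotated])
qed

lemma definable_Collect:
  assumes "DP (\<lambda>e. P (front k e))"
  shows "definable L M k {x \<in> tuples M k. P x}"
proof -
  obtain d where d: "d \<in> dom_of M" using dom_nonempty by blast
  obtain \<psi> \<sigma> where 1: "fm_in L \<psi>" "range \<sigma> \<subseteq> range Inl \<union> Inr ` dom_of M"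
    "\<And>e. env e \<Longrightarrow> P (front k e) = sat M (subst_env \<sigma> e) \<psi>"
    using assms unfolding DP_def by blast
  define n where "n = Suc (Max (insert 0 (free_vars \<psi>)))"
  have n: "i < n" if "i \<in> free_vars \<psi>" for i
    using that Max_ge[of "insert 0 (free_vars \<psi>)" i] by (simp add: n_def less_Suc_eq_le)
  \<comment> \<open>Parameter place \<open>i\<close> serves formula variable \<open>i\<close>. If
    that variable reads an assignment place not below \<open>k\<close>, any value will do, because
    \<open>front k e\<close> ignores the place; \<open>d\<close> is taken.\<close>
  define p where "p = map (\<lambda>i. case \<sigma> i of Inl _ \<Rightarrow> d | Inr c \<Rightarrow> c) [0..<n]"
  define f where "f i = (case \<sigma> i of Inl j \<Rightarrow> if j < k then j else k + i | Inr c \<Rightarrow> k + i)" for i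
  have \<sigma>: "c \<in> dom_of M" if "\<sigma> i = Inr c" for i c
  proof -
    have "\<sigma> i \<in> range Inl \<union> Inr ` dom_of M" using 1(2) by blast
    then show ?thesis using that by auto
  qed
  have p: "set p \<subseteq> dom_of M" using d \<sigma> by (auto simp: p_def split: sum.split)
  have lp: "length p = n" by (simp add: p_def)
  have "f i < k + n" if "i \<in> free_vars \<psi>" for i
    using n[OF that] by (auto simp: f_def split: sum.split)
  then have "free_vars (rename_fm f \<psi>) \<subseteq> {..<k + n}"
    using free_vars_rename[of f \<psi>] by blast
  then have "fm_places L (k + length p) (rename_fm f \<psi>)"
    using 1(1) by (simp add: fm_places_def lp)
  moreover have "P x = holds M (rename_fm f \<psi>) (x @ p)" if x: "x \<in> tuples M k" for x
  proof -
    define e where "e i = (if i < k then x ! i else d)" for i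
    have "env e" using d x by (auto simp: e_def tuples_def)
    moreover have "front k e = x" using x by (auto simp: e_def front_def tuples_def list_eq_iff_nth_eq)
    moreover have "sat M (subst_env \<sigma> e) \<psi> = sat M ((!) (x @ p) \<circ> f) \<psi>"
    proof (rule sat_cong)
      fix i assume "i \<in> free_vars \<psi>"
      then have "i < n" by (rule n)
      then show "subst_env \<sigma> e i = ((!) (x @ p) \<circ> f) i"
        using x by (auto simp: subst_env_def e_def f_def p_def nth_append tuples_def split: sum.split)
    qed
    ultimately show ?thesis using 1(3)[of e] by (simp add: holds_def sat_rename)
  qed
  ultimately show ?thesis unfolding definable_def
    using p by (intro exI[of _ "rename_fm f \<psi>"] exI[of _ p]) auto
qed

end

section \<open>Cofinalities of linear orders\<close>

lemma finite_strict_order_has_greatest: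
  fixes prec :: "'b \<Rightarrow> 'b \<Rightarrow> bool"
  assumes "finite K" "K \<noteq> {}"
    and "\<And>x y z. x \<in> K \<Longrightarrow> y \<in> K \<Longrightarrow> z \<in> K \<Longrightarrow> prec x y \<Longrightarrow> prec y z \<Longrightarrow> prec x z"
    and "\<And>x y. x \<in> K \<Longrightarrow> y \<in> K \<Longrightarrow> x \<noteq> y \<Longrightarrow> prec x y \<or> prec y x"
  shows "\<exists>m\<in>K. \<forall>y\<in>K. y = m \<or> prec y m"
  using assms
proof (induction rule: finite_ne_induct)
  case (insert a F)
  have "\<exists>m\<in>F. \<forall>y\<in>F. y = m \<or> prec y m"
    by (rule insert.IH) (use insert.prems in blast)+
  then obtain m where m: "m \<in> F" "\<forall>y\<in>F. y = m \<or> prec y m" by blast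
  show ?case
  proof (cases "prec m a")
    case True
    then have "\<forall>y\<in>insert a F. y = a \<or> prec y a"
      using m insert.prems(1)[of _ m a] by (metis insert_iff)
    then show ?thesis by blast
  next
    case False
    then show ?thesis using m insert.prems(2)[of m a] by blast
  qed
qed simp

text \<open>A cofinal subset \<open>K\<close> of least cardinality also serves as the index set,
  well-ordered by \<open>|K|\<close>. Smaller sets are not cofinal and hence strictly bounded, so
  the recursion can always pass its earlier values. Regularity follows from the minimality of
  \<open>K\<close> once more.\<close>

lemma exists_cofinal_sequence:
  fixes prec :: "'b \<Rightarrow> 'b \<Rightarrow> bool"
  assumes tr: "\<And>x y z. x \<in> A \<Longrightarrow> y \<in> A \<Longrightarrow> z \<in> A \<Longrightarrow> prec x y \<Longrightarrow> prec y z \<Longrightarrow> prec x z"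
    and ir: "\<And>x. x \<in> A \<Longrightarrow> \<not> prec x x"
    and tot: "\<And>x y. x \<in> A \<Longrightarrow> y \<in> A \<Longrightarrow> x \<noteq> y \<Longrightarrow> prec x y \<or> prec y x"
    and ne: "A \<noteq> {}"
    and nomax: "\<And>x. x \<in> A \<Longrightarrow> \<exists>y\<in>A. prec x y"
  shows "\<exists>(\<kappa> :: 'b rel) f. Cinfinite \<kappa> \<and> regularCard \<kappa> \<and> \<kappa> \<le>o |A| \<and> f ` Field \<kappa> \<subseteq> A \<and>
     (\<forall>i j. (i, j) \<in> \<kappa> \<and> i \<noteq> j \<longrightarrow> prec (f i) (f j)) \<and>
     (\<forall>x\<in>A. \<exists>i\<in>Field \<kappa>. x = f i \<or> prec x (f i))"
proof -
  define cof where "cof K \<longleftrightarrow> K \<subseteq> A \<and> (\<forall>x\<in>A. \<exists>y\<in>K. x = y \<or> prec x y)" for K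
  have "\<exists>r\<in>{|K| | K. cof K}. \<forall>r'\<in>{|K| | K. cof K}. r \<le>o r'"
    by (rule exists_minim_Card_order) (auto simp: cof_def card_of_Card_order intro!: exI[of _ A])
  then obtain K where K: "cof K" and Kmin: "\<And>K'. cof K' \<Longrightarrow> |K| \<le>o |K'|" by blast
  have KA: "K \<subseteq> A" and Kcof: "\<And>x. x \<in> A \<Longrightarrow> \<exists>y\<in>K. x = y \<or> prec x y" using K by (auto simp: cof_def)
  have above: "\<exists>x\<in>A. \<forall>y\<in>K'. prec y x" if K': "K' \<subseteq> A" "|K'| <o |K|" for K'
  proof (rule ccontr)
    assume neg: "\<not> ?thesis"
    have "cof K'" unfolding cof_def
    proof (intro conjI ballI K')
      fix x assume x: "x \<in> A"
      with neg obtain y where "y \<in> K'" "\<not> prec y x" by blast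
      then show "\<exists>y\<in>K'. x = y \<or> prec x y" using tot[of x y] x K' by blast
    qed
    then have "|K| \<le>o |K'|" by (rule Kmin)
    then show False using K'(2) not_ordLess_ordLeq by blast
  qed
  have Kne: "K \<noteq> {}" using ne Kcof by blast
  have inf: "infinite K"
  proof
    assume "finite K"
    then have "\<exists>m\<in>K. \<forall>y\<in>K. y = m \<or> prec y m"
    proof (rule finite_strict_order_has_greatest[OF _ Kne])
      show "prec x z" if "x \<in> K" "y \<in> K" "z \<in> K" "prec x y" "prec y z" for x y z
        by (rule tr[OF _ _ _ that(4,5)]) (use that KA in auto)
      show "prec x y \<or> prec y x" if "x \<in> K" "y \<in> K" "x \<noteq> y" for x y
        by (rule tot) (use that KA in auto)
    qed
    then obtain m where m: "m \<in> K" "\<forall>y\<in>K. y = m \<or> prec y m" by blast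
    obtain x where x: "x \<in> A" "prec m x" using nomax m KA by blast
    obtain y where "y \<in> K" "x = y \<or> prec x y" using Kcof x by blast
    then have "y \<in> K" "prec m y" using x m(1) KA tr[of m x y] by auto
    then show False using m KA tr[of m y m] ir[of m] by (metis subsetD)
  qed
  define \<kappa> where "\<kappa> = |K|"
  have F: "Field \<kappa> = K" by (simp add: \<kappa>_def Field_card_of)
  have C: "Card_order \<kappa>" by (simp add: \<kappa>_def card_of_Card_order)
  have W: "Well_order \<kappa>" by (simp add: \<kappa>_def card_of_Well_order)
  have wf: "wf (\<kappa> - Id)" using W by (simp add: well_order_on_def)
  \<comment> \<open>Besides exceeding the earlier values, the value at \<open>i\<close> has to reach
    \<open>i\<close>, an element of \<open>K\<close>; this makes the sequence cofinal.\<close>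
  define P where "P f i x \<longleftrightarrow> (i \<in> K \<longrightarrow> x \<in> A \<and> (\<forall>j. (j, i) \<in> \<kappa> - Id \<longrightarrow> prec (f j) x) \<and> (i = x \<or> prec i x))"
    for f i x
  have "\<exists>f. \<forall>i. P f i (f i)"
  proof (rule dependent_wf_choice[OF wf])
    show "P f i x = P g i x" if "\<And>j. (j, i) \<in> \<kappa> - Id \<Longrightarrow> f j = g j" for f g i x
      using that unfolding P_def by auto
  next
    fix i f assume IH: "\<And>j. (j, i) \<in> \<kappa> - Id \<Longrightarrow> P f j (f j)"
    show "\<exists>x. P f i x"
    proof (cases "i \<in> K")
      case True
      have sub: "f ` underS \<kappa> i \<subseteq> A"
      proof (rule image_subsetI)
        fix j assume "j \<in> underS \<kappa> i"
        then have "(j, i) \<in> \<kappa> - Id" "j \<in> K" using F by (auto simp: underS_def Field_def)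
        then show "f j \<in> A" using IH[of j] by (simp add: P_def)
      qed
      have "|f ` underS \<kappa> i| \<le>o |underS \<kappa> i|" by (rule card_of_image)
      also have "|underS \<kappa> i| <o \<kappa>" using card_of_underS[OF C] True F by simp
      finally obtain x where x: "x \<in> A" "\<forall>y\<in>f ` underS \<kappa> i. prec y x"
        using above[OF sub] by (auto simp: \<kappa>_def)
      have iA: "i \<in> A" using True KA by blast
      define z where "z = (if prec x i then i else x)"
      have "P f i z" unfolding P_def
      proof (intro impI conjI allI)
        show "z \<in> A" using x iA by (simp add: z_def)
        show "i = z \<or> prec i z" using tot[of x i] x(1) iA by (auto simp: z_def)
        fix j assume "(j, i) \<in> \<kappa> - Id"
        then have "j \<in> underS \<kappa> i" by (auto simp: underS_def)
        then have "f j \<in> A" "prec (f j) x" using x sub by auto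
        then show "prec (f j) z" using tr[of "f j" x i] x(1) iA by (auto simp: z_def)
      qed
      then show ?thesis ..
    qed (simp add: P_def)
  qed
  then obtain f where f: "\<And>i. P f i (f i)" by blast
  have fA: "f i \<in> A" "i = f i \<or> prec i (f i)" if "i \<in> K" for i using f[of i] that by (auto simp: P_def)
  have fmono: "prec (f i) (f j)" if "(i, j) \<in> \<kappa>" "i \<noteq> j" for i j
    using f[of j] that F by (auto simp: P_def Field_def)
  have fcof: "\<exists>i\<in>K. x = f i \<or> prec x (f i)" if x: "x \<in> A" for x
  proof -
    obtain i where i: "i \<in> K" "x = i \<or> prec x i" using Kcof x by blast
    then have "x = f i \<or> prec x (f i)" using fA[of i] tr[of x i "f i"] x KA by (metis subsetD)
    with i show ?thesis by blast
  qed
  have "regularCard \<kappa>" unfolding regularCard_def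
  proof (intro allI impI, elim conjE)
    fix K' assume K': "K' \<subseteq> Field \<kappa>" "cofinal K' \<kappa>"
    have "cof (f ` K')" unfolding cof_def
    proof (intro conjI ballI)
      show "f ` K' \<subseteq> A" using K' F fA by auto
      fix x assume x: "x \<in> A"
      then obtain i where i: "i \<in> K" "x = f i \<or> prec x (f i)" using fcof by blast
      then obtain j where j: "j \<in> K'" "i \<noteq> j" "(i, j) \<in> \<kappa>" using K' F by (auto simp: cofinal_def)
      have "f i \<in> A" "f j \<in> A" using fA i j K' F by auto
      then have "prec x (f j)" using i(2) fmono[OF j(3,2)] tr[of x "f i" "f j"] x by auto
      then show "\<exists>y\<in>f ` K'. x = y \<or> prec x y" using j by blast
    qed
    then have "|K| \<le>o |f ` K'|" by (rule Kmin)
    also have "|f ` K'| \<le>o |K'|" by (rule card_of_image)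
    finally have "\<kappa> \<le>o |K'|" by (simp add: \<kappa>_def)
    moreover have "|K'| \<le>o \<kappa>" using K' F card_of_mono1[of K' K] by (simp add: \<kappa>_def)
    ultimately show "|K'| =o \<kappa>" by (simp add: ordIso_iff_ordLeq)
  qed
  moreover have "Cinfinite \<kappa>" using inf C F by (simp add: cinfinite_def)
  moreover have "\<kappa> \<le>o |A|" using card_of_mono1[OF KA] by (simp add: \<kappa>_def)
  ultimately show ?thesis using fA fmono fcof F by (intro exI[of _ \<kappa>] exI[of _ f]) auto
qed

text \<open>Otherwise the order induced on \<open>W\<close> is longer than \<open>\<kappa>\<close>
  and has a proper initial segment isomorphic to \<open>\<kappa>\<close>, which is too
  large.\<close>

lemma card_of_ordLeq_if_initial_segments_small:
  assumes "Well_order r" "W \<subseteq> Field r" "Card_order \<kappa>"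
    and small: "\<And>i. i \<in> W \<Longrightarrow> |W \<inter> underS r i| <o \<kappa>"
  shows "|W| \<le>o \<kappa>"
proof (rule ccontr)
  assume "\<not> ?thesis"
  then have "\<kappa> <o |W|" 
    using not_ordLeq_iff_ordLess[OF card_order_on_well_order_on[OF assms(3)] card_of_Well_order] by blast
  define r' where "r' = Restr r W"
  have wo: "Well_order r'" using assms(1) by (simp add: r'_def Well_order_Restr)
  have F: "Field r' = W" unfolding r'_def
    using assms(1,2) by (simp add: well_order_on_def linear_order_on_def partial_order_on_def
        preorder_on_def Refl_Field_Restr2)
  then have "|W| \<le>o r'" using wo card_of_least[of W r'] by simp
  with \<open>\<kappa> <o |W|\<close> have "\<kappa> <o r'" by (rule ordLess_ordLeq_trans)
  then obtain i where i: "i \<in> W" "\<kappa> =o Restr r' (underS r' i)"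
    using ordLess_iff_ordIso_Restr[OF wo card_order_on_well_order_on[OF assms(3)]] F by blast
  have "Field (Restr r' (underS r' i)) \<subseteq> underS r' i" by (auto simp: Field_def)
  also have "\<dots> \<subseteq> W \<inter> underS r i" by (auto simp: underS_def r'_def)
  finally have sub: "Field (Restr r' (underS r' i)) \<subseteq> W \<inter> underS r i" .
  have "\<kappa> =o |Field \<kappa>|" using assms(3) card_of_Field_ordIso ordIso_symmetric by blast
  also have "|Field \<kappa>| =o |Field (Restr r' (underS r' i))|"
    using i(2) by (rule card_of_cong)
  also have "|Field (Restr r' (underS r' i))| \<le>o |W \<inter> underS r i|" using sub by (rule card_of_mono1)
  finally have "\<kappa> \<le>o |W \<inter> underS r i|" .
  then show False using small[OF i(1)] not_ordLess_ordLeq by blast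
qed

text \<open>A union of \<open>\<kappa>\<close> many fibres of size at most \<open>\<kappa>\<close>
  has size at most \<open>\<kappa>\<close>.\<close>

lemma infinite_pigeonhole_card:
  assumes "Cinfinite \<kappa>" "\<not> |I| \<le>o \<kappa>" "f ` I \<subseteq> Field \<kappa>"
  shows "\<exists>k\<in>Field \<kappa>. \<not> |{i \<in> I. f i = k}| \<le>o \<kappa>"
proof (rule ccontr)
  assume "\<not> ?thesis"
  then have *: "\<forall>k\<in>Field \<kappa>. |{i \<in> I. f i = k}| \<le>o \<kappa>" by blast
  have "|\<Union>k\<in>Field \<kappa>. {i \<in> I. f i = k}| \<le>o \<kappa>"
    using assms(1) * by (intro card_of_UNION_ordLeq_infinite_Field) (auto simp: cinfinite_def card_of_Field_ordIso intro: ordIso_imp_ordLeq)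
  moreover have "(\<Union>k\<in>Field \<kappa>. {i \<in> I. f i = k}) = I" using assms(3) by auto
  ultimately show False using assms(2) by simp
qed

lemma Cinfinite_no_last:
  assumes "Cinfinite \<kappa>" "i \<in> Field \<kappa>"
  shows "\<exists>j. (i, j) \<in> \<kappa> \<and> i \<noteq> j"
proof (rule ccontr)
  assume *: "\<not> ?thesis"
  have lin: "Linear_order \<kappa>"
    using assms(1) by (simp add: card_order_on_def well_order_on_def)
  have "Field \<kappa> \<subseteq> {i} \<union> underS \<kappa> i"
    using * lin assms(2) by (auto simp: underS_def linear_order_on_def total_on_def)
  then have "|Field \<kappa>| \<le>o |{i} \<union> underS \<kappa> i|" by (rule card_of_mono1)
  then have "\<kappa> \<le>o |{i} \<union> underS \<kappa> i|"
    using assms(1) card_of_Field_ordIso[of \<kappa>] ordIso_ordLeq_trans[OF ordIso_symmetric] by simp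
  moreover have "|{i} \<union> underS \<kappa> i| <o \<kappa>"
  proof (rule card_of_Un_ordLess_infinite_Field)
    show "infinite (Field \<kappa>)" "Card_order \<kappa>" using assms(1) by (auto simp: cinfinite_def)
    show "|underS \<kappa> i| <o \<kappa>" using assms card_of_underS[of \<kappa> i] by simp
    show "|{i}| <o \<kappa>"
      using assms(1) finite_ordLess_infinite[OF card_of_Well_order, of \<kappa> "{i}"]
      by (simp add: cinfinite_def Field_card_of card_order_on_well_order_on)
  qed
  ultimately show False
    using not_ordLess_ordLeq by blast
qed

section \<open>Orders and trees of a cofinality spectrum problem\<close>

lemma fm_in_mono:
  assumes "sub_vocabulary L L'" "fm_in L \<phi>"
  shows "fm_in L' \<phi>"
proof -
  have tm: "tm_in L t \<Longrightarrow> tm_in L' t" for t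
    using assms(1) by (induction t) (auto simp: sub_vocabulary_def)
  show ?thesis using assms(2)
    by (induction \<phi>) (use assms(1) tm in \<open>auto simp: sub_vocabulary_def\<close>)
qed

lemma holds_expands:
  assumes "is_structure L M" "expands L M' M" "fm_places L n \<phi>" "as \<in> tuples M n"
  shows "holds M' \<phi> as = holds M \<phi> as"
proof -
  obtain d where d: "d \<in> dom_of M" using assms(1) by (auto simp: is_structure_def)
  \<comment> \<open>Beyond the length of \<open>as\<close> the value \<open>as ! i\<close> is
    unspecified, whereas \<open>sat_expands\<close> needs an assignment into the domain.\<close>
  define e where "e i = (if i < n then as ! i else d)" for i
  have "range e \<subseteq> dom_of M" using d assms(4) by (auto simp: e_def tuples_def)
  then have "sat M' e \<phi> = sat M e \<phi>"
    using assms(1-3) by (intro sat_expands) (auto simp: fm_places_def)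
  moreover have "sat N e \<phi> = sat N ((!) as) \<phi>" for N :: "('a, 'b, 'c) fo_structure"
    using assms(3) by (intro sat_cong) (auto simp: e_def fm_places_def)
  ultimately show ?thesis by (simp add: holds_def)
qed

lemma (in defs_in) DP_ex_in:
  assumes "D \<subseteq> tuples M k" "\<And>t. TM k t \<Longrightarrow> DP (\<lambda>e. t e \<in> D)"
    "DP (\<lambda>e. P (shift k e) (front k e))"
  shows "DP (\<lambda>e. \<exists>x\<in>D. P e x)"
proof -
  have "DP (\<lambda>e. \<exists>x\<in>tuples M k. x \<in> D \<and> P e x)"
    by (rule DP_ex, rule DP_conj, rule assms(2), rule TM_front, rule assms(3))
  moreover have "(\<exists>x\<in>tuples M k. x \<in> D \<and> P e x) = (\<exists>x\<in>D. P e x)" for e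
    using assms(1) by blast
  ultimately show ?thesis by simp
qed

lemma (in defs_in) DP_all_in:
  assumes "D \<subseteq> tuples M k" "\<And>t. TM k t \<Longrightarrow> DP (\<lambda>e. t e \<in> D)"
    "DP (\<lambda>e. P (shift k e) (front k e))"
  shows "DP (\<lambda>e. \<forall>x\<in>D. P e x)"
proof -
  have "DP (\<lambda>e. \<not> (\<exists>x\<in>D. \<not> P e x))"
    by (rule DP_not, rule DP_ex_in[OF assms(1,2)], assumption, rule DP_not, rule assms(3))
  then show ?thesis by simp
qed

section \<open>Definability of the orders and trees\<close>

locale spectrum =
  fixes s :: "('f, 'r, 'a) csp"
  assumes csp: "cofinality_spectrum_problem s"
begin

lemma structure_M1: "is_structure (voc s) (M1 s)"
  and expands_M1: "expands (voc s) (M1p s) (M1 s)"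
  and structure_M1p: "is_structure (vocp s) (M1p s)"
  and sub_voc: "sub_vocabulary (voc s) (vocp s)"
  and orders: "orders_ok s"
  and products: "has_products s"
  using csp by (auto simp: cofinality_spectrum_problem_def elementary_sub_def)

lemma dom_M1p: "dom_of (M1p s) = dom_of (M1 s)"
  using expands_M1 by (simp add: expands_def)

lemma tuples_M1p: "tuples (M1p s) k = tuples (M1 s) k"
  by (simp add: tuples_def dom_M1p)

sublocale defs_in "vocp s" "M1p s"
  using structure_M1p by unfold_locales (simp add: is_structure_def)

abbreviation Or :: "('f, 'r, 'a) ord_inst set" where "Or \<equiv> nontrivial_orders s"
abbreviation ar :: "('f, 'r, 'a) ord_inst \<Rightarrow> nat" where "ar a \<equiv> xlen (ofm a)"
abbreviation tar :: "('f, 'r, 'a) ord_inst \<Rightarrow> nat" where "tar a \<equiv> tlen (tree_of s (ofm a))"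
abbreviation X :: "('f, 'r, 'a) ord_inst \<Rightarrow> 'a list set" where "X a \<equiv> X_of s a"
abbreviation T :: "('f, 'r, 'a) ord_inst \<Rightarrow> 'a list set" where "T a \<equiv> tree_set s a"

lemma OrD:
  assumes "a \<in> Or"
  shows "ofm a \<in> Delta s" "par a \<in> tuples (M1 s) (zlen (ofm a))" "bnd a \<in> X a"
    "infinite {d. lt s a d (bnd a)}"
  using assms by (auto simp: nontrivial_orders_def all_orders_def)

lemma Or_fm: "a \<in> Or \<Longrightarrow> fm_places (voc s) (ar a + ar a + zlen (ofm a)) (matrix (ofm a))"
  using csp OrD(1)[of a] by (auto simp: cofinality_spectrum_problem_def)

lemma X_tuples: "X a \<subseteq> tuples (M1p s) (ar a)"
  by (auto simp: X_of_def X_set_def tuples_M1p)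

lemma bnd_tuples: "a \<in> Or \<Longrightarrow> bnd a \<in> tuples (M1p s) (ar a)"
  using OrD(3) X_tuples by blast

lemma par_tuples: "a \<in> Or \<Longrightarrow> par a \<in> tuples (M1p s) (zlen (ofm a))"
  using OrD(2) by (simp add: tuples_M1p)

text \<open>The orders are evaluated in \<open>M1 s\<close> while definability refers to
  \<open>M1p s\<close>; both evaluations agree because \<open>M1p s\<close> expands
  \<open>M1 s\<close>.\<close>

lemma DP_matrix:
  assumes "a \<in> Or" "TM (ar a) t" "TM (ar a) u"
  shows "DP (\<lambda>e. holds (M1 s) (matrix (ofm a)) (t e @ u e @ par a))"
proof -
  have *: "TM (ar a + ar a + zlen (ofm a)) (\<lambda>e. t e @ u e @ par a)"
    using TM_append[OF TM_append[OF assms(2,3)] TM_const[OF par_tuples[OF assms(1)]]] by simp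
  have "fm_places (vocp s) (ar a + ar a + zlen (ofm a)) (matrix (ofm a))"
    using Or_fm[OF assms(1)] fm_in_mono[OF sub_voc] by (auto simp: fm_places_def)
  from DP_holds[OF this *] show ?thesis
  proof (rule DP_cong[THEN iffD1, rotated])
    fix e assume "env e"
    then show "holds (M1p s) (matrix (ofm a)) (t e @ u e @ par a) =
      holds (M1 s) (matrix (ofm a)) (t e @ u e @ par a)"
      using holds_expands[OF structure_M1 expands_M1 Or_fm[OF assms(1)]] TM_tuples[OF *]
      by (simp add: tuples_M1p)
  qed
qed

lemma DP_X:
  assumes "a \<in> Or" "TM (ar a) t"
  shows "DP (\<lambda>e. t e \<in> X a)"
  using DP_matrix[OF assms assms(2)]
  by (rule DP_cong[THEN iffD1, rotated])
    (use TM_tuples[OF assms(2)] in \<open>auto simp: X_of_def X_set_def tuples_M1p\<close>)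

lemma DP_le:
  assumes "a \<in> Or" "TM (ar a) t" "TM (ar a) u"
  shows "DP (\<lambda>e. le s a (t e) (u e))"
proof -
  have "DP (\<lambda>e. t e \<in> X a \<and> u e \<in> X a \<and> holds (M1 s) (matrix (ofm a)) (t e @ u e @ par a))"
    by (intro DP_conj DP_X DP_matrix assms)
  then show ?thesis by (simp add: le_def ord_of_def X_rel_def X_of_def)
qed

lemma DP_lt:
  assumes "a \<in> Or" "TM (ar a) t" "TM (ar a) u"
  shows "DP (\<lambda>e. lt s a (t e) (u e))"
  unfolding lt_def by (intro DP_conj DP_not DP_le[OF assms] DP_eq[OF assms(2,3)])

lemma DP_ex_X:
  assumes "a \<in> Or" "DP (\<lambda>e. P (shift (ar a) e) (front (ar a) e))"
  shows "DP (\<lambda>e. \<exists>x\<in>X a. P e x)"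
  by (rule DP_ex_in[OF X_tuples DP_X[OF assms(1)] assms(2)])

lemma DP_all_X:
  assumes "a \<in> Or" "DP (\<lambda>e. P (shift (ar a) e) (front (ar a) e))"
  shows "DP (\<lambda>e. \<forall>x\<in>X a. P e x)"
  by (rule DP_all_in[OF X_tuples DP_X[OF assms(1)] assms(2)])

lemma tree_fms:
  assumes "a \<in> Or"
  shows "fm_places (vocp s) (tar a + (zlen (ofm a) + ar a)) (mem_fm (tree_of s (ofm a)))"
    "fm_places (vocp s) (tar a + ar a + (zlen (ofm a) + ar a)) (lg_fm (tree_of s (ofm a)))"
    "fm_places (vocp s) (tar a + ar a + ar a + (zlen (ofm a) + ar a)) (val_fm (tree_of s (ofm a)))"
  using csp OrD(1)[OF assms]
  by (auto simp: cofinality_spectrum_problem_def tree_formulas_ok_def Let_def)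

lemma TM_par_bnd: "a \<in> Or \<Longrightarrow> TM (zlen (ofm a) + ar a) (\<lambda>e. par a @ bnd a)"
  by (intro TM_append TM_const par_tuples bnd_tuples)

lemma T_tuples: "T a \<subseteq> tuples (M1p s) (tar a)"
  by (auto simp: tree_set_def)

lemma DP_T:
  assumes "a \<in> Or" "TM (tar a) t"
  shows "DP (\<lambda>e. t e \<in> T a)"
  using DP_holds[OF tree_fms(1)[OF assms(1)] TM_append[OF assms(2) TM_par_bnd[OF assms(1)]]]
  by (rule DP_cong[THEN iffD1, rotated]) (use TM_tuples[OF assms(2)] in \<open>auto simp: tree_set_def\<close>)

lemma DP_ex_T:
  assumes "a \<in> Or" "DP (\<lambda>e. P (shift (tar a) e) (front (tar a) e))"
  shows "DP (\<lambda>e. \<exists>x\<in>T a. P e x)"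
  by (rule DP_ex_in[OF T_tuples DP_T[OF assms(1)] assms(2)])

lemma DP_all_T:
  assumes "a \<in> Or" "DP (\<lambda>e. P (shift (tar a) e) (front (tar a) e))"
  shows "DP (\<lambda>e. \<forall>x\<in>T a. P e x)"
  by (rule DP_all_in[OF T_tuples DP_T[OF assms(1)] assms(2)])

lemma DP_is_lg:
  assumes "a \<in> Or" "TM (tar a) t" "TM (ar a) u"
  shows "DP (\<lambda>e. is_lg s a (t e) (u e))"
proof -
  have "TM (tar a + ar a + (zlen (ofm a) + ar a)) (\<lambda>e. t e @ u e @ par a @ bnd a)"
    using TM_append[OF TM_append[OF assms(2,3)] TM_par_bnd[OF assms(1)]] by simp
  from DP_conj[OF DP_X[OF assms(1,3)] DP_holds[OF tree_fms(2)[OF assms(1)] this]]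
  show ?thesis by (simp add: is_lg_def)
qed

lemma DP_is_val:
  assumes "a \<in> Or" "TM (tar a) t" "TM (ar a) u" "TM (ar a) v"
  shows "DP (\<lambda>e. is_val s a (t e) (u e) (v e))"
proof -
  have "TM (tar a + ar a + ar a + (zlen (ofm a) + ar a)) (\<lambda>e. t e @ u e @ v e @ par a @ bnd a)"
    using TM_append[OF TM_append[OF TM_append[OF assms(2,3)] assms(4)] TM_par_bnd[OF assms(1)]]
    by simp
  from DP_conj[OF DP_X[OF assms(1,4)] DP_holds[OF tree_fms(3)[OF assms(1)] this]]
  show ?thesis by (simp add: is_val_def)
qed

text \<open>The graph of the value function below the length. Using \<open>is_lg\<close> and
  \<open>is_val\<close> in place of the description operators \<open>lg\<close> and
  \<open>val\<close> keeps it definable by composition.\<close>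

definition ent :: "('f, 'r, 'a) ord_inst \<Rightarrow> 'a list \<Rightarrow> 'a list \<Rightarrow> 'a list \<Rightarrow> bool" where
  "ent a b k v \<longleftrightarrow> (\<exists>l\<in>X a. is_lg s a b l \<and> lt s a k l \<and> is_val s a b k v)"

lemma DP_ent:
  assumes "a \<in> Or" "TM (tar a) t" "TM (ar a) u" "TM (ar a) v"
  shows "DP (\<lambda>e. ent a (t e) (u e) (v e))"
  unfolding ent_def
  by (rule DP_ex_X[OF assms(1)], intro DP_conj DP_is_lg DP_lt DP_is_val assms(1);
      intro TM_front TM_shift[OF assms(2)] TM_shift[OF assms(3)] TM_shift[OF assms(4)])

section \<open>The discrete linear orders and internal induction\<close>

lemma lin: "a \<in> Or \<Longrightarrow> linear_order_on (X a) (ord_of s a)"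
  using orders OrD(1,2)[of a] by (auto simp: orders_ok_def discrete_linear_order_on_def X_of_def ord_of_def)

lemma le_X: "le s a x y \<Longrightarrow> x \<in> X a" "le s a x y \<Longrightarrow> y \<in> X a"
  by (auto simp: le_def ord_of_def X_rel_def X_of_def)

lemma lt_X: "lt s a x y \<Longrightarrow> x \<in> X a" "lt s a x y \<Longrightarrow> y \<in> X a"
  using le_X by (auto simp: lt_def)

lemma le_refl: "a \<in> Or \<Longrightarrow> x \<in> X a \<Longrightarrow> le s a x x"
  using lin[of a] by (auto simp: le_def linear_order_on_def partial_order_on_def preorder_on_def refl_on_def)

lemma le_trans: "a \<in> Or \<Longrightarrow> le s a x y \<Longrightarrow> le s a y z \<Longrightarrow> le s a x z"
  using lin[of a] by (auto simp: le_def linear_order_on_def partial_order_on_def preorder_on_def elim: transE)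

lemma le_antisym: "a \<in> Or \<Longrightarrow> le s a x y \<Longrightarrow> le s a y x \<Longrightarrow> x = y"
  using lin[of a] by (auto simp: le_def linear_order_on_def partial_order_on_def elim: antisymD)

lemma le_total: "a \<in> Or \<Longrightarrow> x \<in> X a \<Longrightarrow> y \<in> X a \<Longrightarrow> le s a x y \<or> le s a y x"
  using lin[of a] le_refl[of a x] by (auto simp: le_def linear_order_on_def total_on_def)

lemma lt_irrefl: "\<not> lt s a x x"
  by (simp add: lt_def)

lemma lt_imp_le: "lt s a x y \<Longrightarrow> le s a x y"
  by (simp add: lt_def)

lemma not_le: "a \<in> Or \<Longrightarrow> x \<in> X a \<Longrightarrow> y \<in> X a \<Longrightarrow> \<not> le s a x y \<longleftrightarrow> lt s a y x"
  using le_total[of a x y] le_antisym[of a x y] le_refl[of a x] by (auto simp: lt_def)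

lemma not_lt: "a \<in> Or \<Longrightarrow> x \<in> X a \<Longrightarrow> y \<in> X a \<Longrightarrow> \<not> lt s a x y \<longleftrightarrow> le s a y x"
  using not_le[of a y x] by blast

lemma le_lt_trans: "a \<in> Or \<Longrightarrow> le s a x y \<Longrightarrow> lt s a y z \<Longrightarrow> lt s a x z"
  using le_trans[of a x y z] le_antisym[of a y z] by (auto simp: lt_def)

lemma lt_le_trans: "a \<in> Or \<Longrightarrow> lt s a x y \<Longrightarrow> le s a y z \<Longrightarrow> lt s a x z"
  using le_trans[of a x y z] le_antisym[of a x y] by (auto simp: lt_def)

lemma lt_trans: "a \<in> Or \<Longrightarrow> lt s a x y \<Longrightarrow> lt s a y z \<Longrightarrow> lt s a x z"
  using le_lt_trans lt_imp_le by blast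

lemma lt_asym: "a \<in> Or \<Longrightarrow> lt s a x y \<Longrightarrow> le s a y x \<Longrightarrow> False"
  using le_antisym[of a x y] by (auto simp: lt_def)

lemma lt_total: "a \<in> Or \<Longrightarrow> x \<in> X a \<Longrightarrow> y \<in> X a \<Longrightarrow> x \<noteq> y \<Longrightarrow> lt s a x y \<or> lt s a y x"
  using not_le[of a x y] by (auto simp: lt_def)

lemma imm_succ_iff:
  assumes "a \<in> Or"
  shows "imm_succ (ord_of s a) x y \<longleftrightarrow> lt s a x y \<and> (\<forall>z. lt s a x z \<longrightarrow> le s a y z)"
proof
  assume *: "imm_succ (ord_of s a) x y"
  then have "lt s a x y" by (auto simp: imm_succ_def lt_def le_def)
  moreover have "le s a y z" if "lt s a x z" for z
  proof (rule ccontr)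
    assume "\<not> le s a y z"
    then have "lt s a z y" using not_le[OF assms] lt_X that \<open>lt s a x y\<close> by blast
    then show False using * that by (auto simp: imm_succ_def lt_def le_def)
  qed
  ultimately show "lt s a x y \<and> (\<forall>z. lt s a x z \<longrightarrow> le s a y z)" by blast
next
  assume *: "lt s a x y \<and> (\<forall>z. lt s a x z \<longrightarrow> le s a y z)"
  then have "z = x \<or> z = y" if "le s a x z" "le s a z y" for z
    using that le_antisym[OF assms, of z y] by (auto simp: lt_def)
  then show "imm_succ (ord_of s a) x y" using * by (auto simp: imm_succ_def lt_def le_def)
qed

lemma ex_pred:
  assumes "a \<in> Or" "lt s a x y"
  shows "\<exists>z. lt s a z y \<and> (\<forall>w. lt s a w y \<longrightarrow> le s a w z)"
proof -
  have "\<forall>y. (\<exists>x. (x, y) \<in> ord_of s a \<and> x \<noteq> y) \<longrightarrow> (\<exists>x. imm_succ (ord_of s a) x y)"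
    using orders OrD(1,2)[OF assms(1)]
    by (auto simp: orders_ok_def discrete_linear_order_on_def X_of_def ord_of_def)
  then obtain z where z: "imm_succ (ord_of s a) z y" using assms(2) by (auto simp: lt_def le_def)
  then have zy: "lt s a z y" "\<And>w. lt s a z w \<Longrightarrow> le s a y w"
    using imm_succ_iff[OF assms(1)] by auto
  have "le s a w z" if "lt s a w y" for w
    using zy(2)[of w] that lt_asym[OF assms(1) that] not_le[OF assms(1), of w z] lt_X zy(1) by blast
  then show ?thesis using zy(1) by blast
qed

text \<open>The clause on first and last elements of definable sets enters only here; all arguments
  by internal induction and overspill go through this lemma.\<close>

lemma ex_greatest:
  assumes "a \<in> Or" "x0 \<in> X a" "P x0" "DP (\<lambda>e. P (front (ar a) e))"
  shows "\<exists>x\<in>X a. P x \<and> (\<forall>y\<in>X a. P y \<longrightarrow> le s a y x)"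
    and "\<exists>x\<in>X a. P x \<and> (\<forall>y\<in>X a. P y \<longrightarrow> le s a x y)"
proof -
  let ?D = "{x \<in> tuples (M1p s) (ar a). x \<in> X a \<and> P x}"
  have "definable (vocp s) (M1p s) (ar a) ?D"
    by (rule definable_Collect) (intro DP_conj DP_X[OF assms(1)] TM_front assms(4))
  moreover have "?D \<subseteq> X a" "?D \<noteq> {}" using assms(2,3) X_tuples by auto
  ultimately have "(\<exists>x\<in>?D. \<forall>y\<in>?D. (x, y) \<in> ord_of s a) \<and> (\<exists>x\<in>?D. \<forall>y\<in>?D. (y, x) \<in> ord_of s a)"
    using orders OrD(1,2)[OF assms(1)] unfolding orders_ok_def X_of_def ord_of_def by blast
  then show "\<exists>x\<in>X a. P x \<and> (\<forall>y\<in>X a. P y \<longrightarrow> le s a y x)"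
    "\<exists>x\<in>X a. P x \<and> (\<forall>y\<in>X a. P y \<longrightarrow> le s a x y)"
    using X_tuples[of a] unfolding le_def by blast+
qed

section \<open>Members of a tree as internal sequences\<close>

lemma tree:
  assumes "a \<in> Or"
  shows "tree_ok s a"
  using csp assms by (auto simp: cofinality_spectrum_problem_def)

lemma treeD:
  assumes "a \<in> Or"
  shows "\<forall>b\<in>T a. \<forall>u. lt s a u (lg s a b) \<longrightarrow> (\<exists>!v. is_val s a b u v)"
    and "\<forall>c\<in>T a. \<forall>x\<in>X a. lt s a (lg s a c) (bnd a) \<longrightarrow>
        (\<exists>c'\<in>T a. imm_succ (ord_of s a) (lg s a c) (lg s a c') \<and>
           (\<forall>u. lt s a u (lg s a c) \<longrightarrow> val s a c' u = val s a c u) \<and>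
           val s a c' (lg s a c) = x)"
    and "\<forall>b1\<in>T a. \<forall>b2\<in>T a. tle s a b1 b2 \<longleftrightarrow>
          le s a (lg s a b1) (lg s a b2) \<and> (\<forall>u. lt s a u (lg s a b1) \<longrightarrow> val s a b2 u = val s a b1 u)"
    and "\<forall>b\<in>T a. \<forall>u. le s a u (lg s a b) \<longrightarrow> (\<exists>b'\<in>T a. lg s a b' = u \<and> tle s a b' b)"
  using tree[OF assms] unfolding tree_ok_def by - (elim conjE, assumption)+

lemma is_lg_iff:
  assumes "a \<in> Or" "b \<in> T a"
  shows "is_lg s a b l \<longleftrightarrow> l = lg s a b"
proof -
  have "\<exists>!u. is_lg s a b u" using tree[OF assms(1)] assms(2) by (simp add: tree_ok_def)
  then show ?thesis unfolding lg_def by (metis theI)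
qed

lemma lg_X: "a \<in> Or \<Longrightarrow> b \<in> T a \<Longrightarrow> lg s a b \<in> X a"
  using is_lg_iff[of a b "lg s a b"] by (simp add: is_lg_def)

lemma ent_iff:
  assumes "a \<in> Or" "b \<in> T a"
  shows "ent a b k v \<longleftrightarrow> lt s a k (lg s a b) \<and> v = val s a b k"
proof -
  have "is_val s a b k v \<longleftrightarrow> v = val s a b k" if "lt s a k (lg s a b)"
  proof -
    have "\<exists>!u. is_val s a b k u"
      using treeD(1)[OF assms(1)] assms(2) that by blast
    then show ?thesis unfolding val_def by (metis theI)
  qed
  then show ?thesis using lg_X[OF assms] by (auto simp: ent_def is_lg_iff[OF assms])
qed

lemma ent_X:
  assumes "ent a b k v"
  shows "k \<in> X a" "v \<in> X a"
  using assms lt_X by (auto simp: ent_def is_val_def)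

lemma tle_iff:
  assumes "a \<in> Or" "b \<in> T a" "c \<in> T a"
  shows "tle s a b c \<longleftrightarrow> le s a (lg s a b) (lg s a c) \<and> (\<forall>k v. ent a b k v \<longrightarrow> ent a c k v)"
proof -
  have "tle s a b c \<longleftrightarrow> le s a (lg s a b) (lg s a c) \<and>
      (\<forall>u. lt s a u (lg s a b) \<longrightarrow> val s a c u = val s a b u)"
    using tree[OF assms(1)] assms(2,3) by (simp add: tree_ok_def)
  then show ?thesis
    using ent_iff[OF assms(1,2)] ent_iff[OF assms(1,3)] lt_le_trans[OF assms(1)] by auto
qed

lemma tle_order:
  assumes "a \<in> Or"
  shows "b \<in> T a \<Longrightarrow> tle s a b b"
    "tle s a b c \<Longrightarrow> tle s a c d \<Longrightarrow> tle s a b d"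
    "tle s a b c \<Longrightarrow> tle s a c b \<Longrightarrow> b = c"
proof -
  have "partial_order_on (T a) {(b1, b2). tle s a b1 b2}"
    using tree[OF assms] by (simp add: tree_ok_def)
  then have "refl_on (T a) {(b1, b2). tle s a b1 b2}" "trans {(b1, b2). tle s a b1 b2}"
    "antisym {(b1, b2). tle s a b1 b2}"
    by (auto simp: partial_order_on_def preorder_on_def)
  then show "b \<in> T a \<Longrightarrow> tle s a b b"
    "tle s a b c \<Longrightarrow> tle s a c d \<Longrightarrow> tle s a b d"
    "tle s a b c \<Longrightarrow> tle s a c b \<Longrightarrow> b = c"
    by (auto simp: refl_on_def elim: transE dest: antisymD)
qed

lemma restrict_tree:
  assumes "a \<in> Or" "b \<in> T a" "le s a u (lg s a b)"
  shows "\<exists>c\<in>T a. lg s a c = u \<and> (\<forall>k v. ent a c k v \<longleftrightarrow> ent a b k v \<and> lt s a k u)"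
proof -
  obtain c where c: "c \<in> T a" "lg s a c = u" "tle s a c b"
    using treeD(4)[OF assms(1)] assms(2,3) by blast
  then have "val s a b k = val s a c k" if "lt s a k u" for k
    using treeD(3)[OF assms(1)] assms(2) that by blast
  then have "ent a c k v \<longleftrightarrow> ent a b k v \<and> lt s a k u" for k v
    using ent_iff[OF assms(1,2)] ent_iff[OF assms(1) c(1)] c(2) lt_le_trans[OF assms(1) _ assms(3)] by auto
  then show ?thesis using c by blast
qed

lemma append_tree:
  assumes "a \<in> Or" "b \<in> T a" "x \<in> X a" "lt s a (lg s a b) (bnd a)"
  shows "\<exists>c\<in>T a. lt s a (lg s a b) (lg s a c) \<and> (\<forall>z. lt s a (lg s a b) z \<longrightarrow> le s a (lg s a c) z) \<and>
     (\<forall>k v. ent a c k v \<longleftrightarrow> ent a b k v \<or> k = lg s a b \<and> v = x)"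
proof -
  obtain c where c: "c \<in> T a" "imm_succ (ord_of s a) (lg s a b) (lg s a c)"
      "\<And>u. lt s a u (lg s a b) \<Longrightarrow> val s a c u = val s a b u" "val s a c (lg s a b) = x"
    using treeD(2)[OF assms(1), rule_format, OF assms(2,3,4)] by blast
  then have lt: "lt s a (lg s a b) (lg s a c)" and *: "\<And>z. lt s a (lg s a b) z \<Longrightarrow> le s a (lg s a c) z"
    using imm_succ_iff[OF assms(1)] by auto
  have "lt s a k (lg s a c) \<longleftrightarrow> lt s a k (lg s a b) \<or> k = lg s a b" for k
  proof
    assume k: "lt s a k (lg s a c)"
    show "lt s a k (lg s a b) \<or> k = lg s a b"
      using lt_total[OF assms(1) lt_X(1)[OF k] lg_X[OF assms(1,2)]] *[of k] lt_asym[OF assms(1) k] by blast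
  next
    assume "lt s a k (lg s a b) \<or> k = lg s a b"
    then show "lt s a k (lg s a c)" using lt lt_trans[OF assms(1) _ lt] by blast
  qed
  then have "ent a c k v \<longleftrightarrow> ent a b k v \<or> k = lg s a b \<and> v = x" for k v
    using ent_iff[OF assms(1,2)] ent_iff[OF assms(1) c(1)] c(3)[of k] c(4) lt_irrefl[of a k] by auto
  then show ?thesis using c(1) lt * by blast
qed

lemma ex_first:
  assumes "a \<in> Or"
  shows "\<exists>x\<in>X a. \<forall>y\<in>X a. le s a x y" and "\<exists>x\<in>X a. \<forall>y\<in>X a. le s a y x"
  using ex_greatest[OF assms OrD(3)[OF assms], of "\<lambda>_. True"] DP_True by auto

text \<open>Any member of the tree, cut off at the first element of the order, loses all its
  entries.\<close>

lemma ex_empty_sequence: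
  assumes "a \<in> Or"
  shows "\<exists>b\<in>T a. (\<forall>y\<in>X a. le s a (lg s a b) y) \<and> (\<forall>k v. \<not> ent a b k v)"
proof -
  obtain b where b: "b \<in> T a" using tree[OF assms] by (auto simp: tree_ok_def)
  obtain x where x: "x \<in> X a" "\<forall>y\<in>X a. le s a x y" using ex_first[OF assms] by blast
  obtain c where c: "c \<in> T a" "lg s a c = x" "\<And>k v. ent a c k v \<Longrightarrow> lt s a k x"
    using restrict_tree[OF assms b, of x] x lg_X[OF assms b] by blast
  have "\<not> ent a c k v" for k v
    using c(3)[of k v] x(2) lt_X(1)[of a k x] lt_asym[OF assms, of k x] by blast
  then show ?thesis using c x by blast
qed

lemma ent_unique: "a \<in> Or \<Longrightarrow> b \<in> T a \<Longrightarrow> ent a b p x \<Longrightarrow> ent a b p y \<Longrightarrow> x = y"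
  by (simp add: ent_iff)

lemma ent_ex: "a \<in> Or \<Longrightarrow> b \<in> T a \<Longrightarrow> lt s a p (lg s a b) \<Longrightarrow> \<exists>x. ent a b p x"
  by (simp add: ent_iff)

lemma ent_lt: "a \<in> Or \<Longrightarrow> b \<in> T a \<Longrightarrow> ent a b p x \<Longrightarrow> lt s a p (lg s a b)"
  by (simp add: ent_iff)

lemma tle_ent: "a \<in> Or \<Longrightarrow> tle s a b c \<Longrightarrow> ent a b p x \<Longrightarrow> ent a c p x"
  using tle_iff[of a b c] by (auto simp: tle_def)

lemma tle_lg: "a \<in> Or \<Longrightarrow> tle s a b c \<Longrightarrow> le s a (lg s a b) (lg s a c)"
  using tle_iff[of a b c] by (auto simp: tle_def)

section \<open>Infinite and finite distance to a position\<close>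

definition seg :: "('f, 'r, 'a) ord_inst \<Rightarrow> 'a list \<Rightarrow> 'a list \<Rightarrow> 'a list set" where
  "seg a x y = {z. le s a x z \<and> le s a z y}"

lemma infinite_seg_imp_lt:
  assumes "a \<in> Or" "x \<in> X a" "N \<in> X a" "infinite (seg a x N)"
  shows "lt s a x N"
proof (rule ccontr)
  assume "\<not> lt s a x N"
  then have "le s a N x" using not_lt[OF assms(1-3)] by blast
  then have "z = N" if "z \<in> seg a x N" for z
    using that le_trans[OF assms(1), of N x z] le_antisym[OF assms(1), of z N] by (auto simp: seg_def)
  then have "seg a x N \<subseteq> {N}" by blast
  then show False using assms(4) finite_subset by blast
qed

lemma infinite_seg_anti:
  assumes "a \<in> Or" "le s a x y" "infinite (seg a y N)"
  shows "infinite (seg a x N)"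
proof -
  have "seg a y N \<subseteq> seg a x N" using le_trans[OF assms(1,2)] by (auto simp: seg_def)
  then show ?thesis using assms(3) finite_subset by blast
qed

lemma infinite_seg_succ:
  assumes "a \<in> Or" "\<And>z. lt s a x z \<Longrightarrow> le s a y z" "infinite (seg a x N)"
  shows "infinite (seg a y N)"
proof -
  have "seg a x N \<subseteq> insert x (seg a y N)" using assms(2) by (auto simp: seg_def lt_def)
  then show ?thesis using assms(3) finite_subset[of _ "insert x (seg a y N)"] by blast
qed

lemma infinite_seg_first:
  assumes "infinite {x. lt s a x N}" "\<And>y. y \<in> X a \<Longrightarrow> le s a x y"
  shows "infinite (seg a x N)"
proof -
  have "{x. lt s a x N} \<subseteq> seg a x N" using assms(2) lt_X by (auto simp: seg_def lt_imp_le)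
  then show ?thesis using assms(1) finite_subset by blast
qed

text \<open>A sequence whose length is below all of \<open>near a N\<close> can be extended infinitely often within \<open>N\<close>.\<close>

definition near :: "('f, 'r, 'a) ord_inst \<Rightarrow> 'a list \<Rightarrow> 'a list set" where
  "near a N = {x \<in> X a. le s a x N \<and> finite (seg a x N)}"

text \<open>The smaller of two points has the larger segment up to \<open>N\<close>, so the finite
  sizes of these segments distinguish the points.\<close>

lemma card_of_near: "a \<in> Or \<Longrightarrow> |near a N| \<le>o |UNIV :: nat set|"
proof (rule card_of_ordLeqI[of "\<lambda>x. card (seg a x N)"])
  assume a: "a \<in> Or"
  have *: "card (seg a y N) < card (seg a x N)" if "x \<in> near a N" "lt s a x y" for x y
  proof (rule psubset_card_mono)
    show "finite (seg a x N)" using that by (simp add: near_def)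
    have "seg a y N \<subseteq> seg a x N"
      using le_trans[OF a lt_imp_le[OF that(2)]] by (auto simp: seg_def)
    moreover have "x \<in> seg a x N" using that le_refl[OF a] by (auto simp: near_def seg_def)
    moreover have "x \<notin> seg a y N" using lt_asym[OF a that(2)] by (auto simp: seg_def)
    ultimately show "seg a y N \<subset> seg a x N" by blast
  qed
  show "inj_on (\<lambda>x. card (seg a x N)) (near a N)"
  proof (rule inj_onI, rule ccontr)
    fix x y assume xy: "x \<in> near a N" "y \<in> near a N" "card (seg a x N) = card (seg a y N)" "x \<noteq> y"
    then have "lt s a x y \<or> lt s a y x" using lt_total[OF a] by (simp add: near_def)
    then show False using *[of x y] *[of y x] xy by auto
  qed
qed simp

text \<open>If the segment from \<open>z\<close> were finite, a predecessor of \<open>z\<close>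
  would still lie in \<open>near a N\<close>, although \<open>z\<close> is below that set. If
  \<open>z\<close> has no predecessor, its segment contains everything below
  \<open>N\<close>.\<close>

lemma infinite_seg_if_below_near:
  assumes "a \<in> Or" "N \<in> X a" "infinite {x. lt s a x N}" "z \<in> X a" "\<And>x. x \<in> near a N \<Longrightarrow> le s a z x"
  shows "infinite (seg a z N)"
proof
  assume fin: "finite (seg a z N)"
  have "seg a N N = {N}"
    using le_antisym[OF assms(1)] le_refl[OF assms(1,2)] by (auto simp: seg_def)
  then have "N \<in> near a N" using assms(2) le_refl[OF assms(1,2)] by (simp add: near_def)
  then have zN: "le s a z N" by (rule assms(5))
  show False
  proof (cases "\<exists>w. lt s a w z")
    case True
    then obtain w where w: "lt s a w z" "\<And>u. lt s a u z \<Longrightarrow> le s a u w"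
      using ex_pred[OF assms(1)] by blast
    have "seg a w N \<subseteq> insert w (seg a z N)"
    proof
      fix u assume u: "u \<in> seg a w N"
      show "u \<in> insert w (seg a z N)"
      proof (cases "lt s a u z")
        case True
        then show ?thesis using w(2)[OF True] u le_antisym[OF assms(1), of u w] by (auto simp: seg_def)
      next
        case False
        then show ?thesis using not_lt[OF assms(1), of u z] u assms(4) le_X by (auto simp: seg_def)
      qed
    qed
    then have "finite (seg a w N)" using fin finite_subset by blast
    then have "w \<in> near a N"
      using lt_X(1)[OF w(1)] le_trans[OF assms(1) lt_imp_le[OF w(1)] zN] by (simp add: near_def)
    then show False using assms(5) lt_asym[OF assms(1) w(1)] by blast
  next
    case False
    then have "le s a z y" if "y \<in> X a" for y using not_lt[OF assms(1) that assms(4)] by blast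
    then show False using infinite_seg_first[OF assms(3)] fin by blast
  qed
qed

end

section \<open>Consequences of minimality: bounds of chains and interpolation\<close>

text \<open>The role of \<open>lam\<close> is that of the longer side of a cut for which \<open>\<kappa>1 + \<kappa>2\<close> is minimal.\<close>

locale minimal_cut = spectrum s for s :: "('f, 'r, 'a) csp" +
  fixes lam :: "'a list rel"
  assumes lam: "Cinfinite lam"
    and no_smaller_cut: "(\<kappa>1, \<kappa>2) \<in> cut_spectrum s \<Longrightarrow> \<kappa>1 <o lam \<Longrightarrow> \<kappa>2 <o lam \<Longrightarrow> False"
    and towers_bounded: "a \<in> nontrivial_orders s \<Longrightarrow> Cinfinite \<kappa> \<Longrightarrow> \<kappa> \<le>o lam \<Longrightarrow> \<not> unbounded_tower s a \<kappa> b"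
begin

lemma card_of_Un_less:
  "|A| <o lam \<Longrightarrow> |B| <o lam \<Longrightarrow> |A \<union> B| <o lam"
  using lam by (intro card_of_Un_ordLess_infinite_Field) (auto simp: cinfinite_def)

lemma card_of_finite_less: "finite A \<Longrightarrow> |A| <o lam"
  using lam finite_ordLess_infinite[OF card_of_Well_order, of lam A]
  by (simp add: cinfinite_def Field_card_of card_order_on_well_order_on)

text \<open>The assumption on towers concerns sequences indexed by infinite cardinals. A chain
  without greatest element is replaced by a cofinal sequence of that kind.\<close>

lemma chain_bounded:
  assumes a: "a \<in> Or" and C: "C \<subseteq> T a" "|C| \<le>o lam"
    and chain: "\<And>x y. x \<in> C \<Longrightarrow> y \<in> C \<Longrightarrow> tle s a x y \<or> tle s a y x"
  shows "\<exists>c\<in>T a. \<forall>b\<in>C. tle s a b c"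
proof (cases "\<exists>m\<in>C. \<forall>b\<in>C. tle s a b m")
  case True
  then show ?thesis using C(1) by blast
next
  case nomax: False
  show ?thesis
  proof (cases "C = {}")
    case True
    then show ?thesis using tree[OF a] by (auto simp: tree_ok_def)
  next
    case False
    define prec where "prec x y \<longleftrightarrow> tle s a x y \<and> x \<noteq> y" for x y
    have "\<exists>(\<kappa> :: 'a list rel) f. Cinfinite \<kappa> \<and> regularCard \<kappa> \<and> \<kappa> \<le>o |C| \<and> f ` Field \<kappa> \<subseteq> C \<and>
      (\<forall>i j. (i, j) \<in> \<kappa> \<and> i \<noteq> j \<longrightarrow> prec (f i) (f j)) \<and>
      (\<forall>x\<in>C. \<exists>i\<in>Field \<kappa>. x = f i \<or> prec x (f i))"
    proof (rule exists_cofinal_sequence)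
      show "prec x y \<or> prec y x" if "x \<in> C" "y \<in> C" "x \<noteq> y" for x y
        using chain[OF that(1,2)] that(3) by (auto simp: prec_def)
      show "prec x z" if "prec x y" "prec y z" for x y z
        using that tle_order(2)[OF a, of x y z] tle_order(3)[OF a, of x y] unfolding prec_def by metis
      show "\<exists>y\<in>C. prec x y" if x: "x \<in> C" for x
      proof -
        obtain y where y: "y \<in> C" "\<not> tle s a y x" using nomax x by blast
        then have "tle s a x y" "x \<noteq> y"
          using chain[OF x, of y] tle_order(1)[OF a, of x] x C(1) by auto
        then show ?thesis using y(1) unfolding prec_def by blast
      qed
    qed (use False in \<open>auto simp: prec_def\<close>)
    then obtain \<kappa> :: "'a list rel" and f where f: "Cinfinite \<kappa>" "\<kappa> \<le>o |C|" "f ` Field \<kappa> \<subseteq> C"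
      "\<And>i j. (i, j) \<in> \<kappa> \<and> i \<noteq> j \<Longrightarrow> prec (f i) (f j)"
      "\<And>x. x \<in> C \<Longrightarrow> \<exists>i\<in>Field \<kappa>. x = f i \<or> prec x (f i)" by metis
    have "\<kappa> \<le>o lam" using f(2) C(2) by (rule ordLeq_transitive)
    then have "\<not> unbounded_tower s a \<kappa> f" by (rule towers_bounded[OF a f(1)])
    moreover have "f ` Field \<kappa> \<subseteq> T a" using f(3) C(1) by (rule subset_trans)
    ultimately obtain c where c: "c \<in> T a" "\<And>i. i \<in> Field \<kappa> \<Longrightarrow> tle s a (f i) c"
      using f(4) unfolding unbounded_tower_def prec_def by blast
    have "tle s a b c" if b: "b \<in> C" for b
    proof -
      obtain i where i: "i \<in> Field \<kappa>" "b = f i \<or> prec b (f i)" using f(5)[OF b] by blast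
      show ?thesis using i(2) c(2)[OF i(1)] tle_order(2)[OF a, of b "f i" c] by (auto simp: prec_def)
    qed
    then show ?thesis using c(1) by blast
  qed
qed

text \<open>If nothing lies between, \<open>A\<close> has no greatest and \<open>B\<close> no least
  element. The downward closure of \<open>A\<close> and the upward closure of \<open>B\<close> then
  form a cut whose lengths are bounded by \<open>|A|\<close> and \<open>|B|\<close>, against
  minimality.\<close>

lemma interpolate:
  assumes a: "a \<in> Or" and A: "A \<subseteq> X a" "|A| <o lam" and B: "B \<subseteq> X a" "|B| <o lam"
    and AB: "\<And>x y. x \<in> A \<Longrightarrow> y \<in> B \<Longrightarrow> le s a x y"
  shows "\<exists>z\<in>X a. (\<forall>x\<in>A. le s a x z) \<and> (\<forall>y\<in>B. le s a z y)"
proof (rule ccontr)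
  assume no: "\<not> ?thesis"
  \<comment> \<open>If \<open>A\<close> were empty, the first element of the order would
    interpolate; if \<open>B\<close> were empty, the last one would.\<close>
  have Ane: "A \<noteq> {}" using no ex_first(1)[OF a] B(1) by blast
  have Bne: "B \<noteq> {}" using no ex_first(2)[OF a] A(1) by blast
  have nomax: "\<exists>y\<in>A. lt s a x y" if x: "x \<in> A" for x
  proof (rule ccontr)
    assume "\<not> ?thesis"
    then have "\<forall>y\<in>A. le s a y x" using not_lt[OF a] A(1) x by blast
    then show False using no x A(1) AB[OF x] by blast
  qed
  have nomin: "\<exists>y\<in>B. lt s a y x" if x: "x \<in> B" for x
  proof (rule ccontr)
    assume "\<not> ?thesis"
    then have "\<forall>y\<in>B. le s a x y" using not_lt[OF a] B(1) x by blast
    then show False using no x B(1) AB[OF _ x] by blast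
  qed
  have "\<exists>(\<kappa> :: 'a list rel) f. Cinfinite \<kappa> \<and> regularCard \<kappa> \<and> \<kappa> \<le>o |A| \<and> f ` Field \<kappa> \<subseteq> A \<and>
      (\<forall>i j. (i, j) \<in> \<kappa> \<and> i \<noteq> j \<longrightarrow> lt s a (f i) (f j)) \<and>
      (\<forall>x\<in>A. \<exists>i\<in>Field \<kappa>. x = f i \<or> lt s a x (f i))"
  proof (rule exists_cofinal_sequence)
    show "lt s a x z" if "lt s a x y" "lt s a y z" for x y z using that by (rule lt_trans[OF a])
    show "lt s a x y \<or> lt s a y x" if "x \<in> A" "y \<in> A" "x \<noteq> y" for x y
      using that A(1) lt_total[OF a, of x y] by auto
  qed (use nomax Ane lt_irrefl in auto)
  then obtain \<kappa>1 :: "'a list rel" and f where f: "Cinfinite \<kappa>1" "regularCard \<kappa>1" "\<kappa>1 \<le>o |A|"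
    "f ` Field \<kappa>1 \<subseteq> A" "\<And>i j. (i, j) \<in> \<kappa>1 \<and> i \<noteq> j \<Longrightarrow> lt s a (f i) (f j)"
    "\<And>x. x \<in> A \<Longrightarrow> \<exists>i\<in>Field \<kappa>1. x = f i \<or> lt s a x (f i)" by metis
  have "\<exists>(\<kappa> :: 'a list rel) f. Cinfinite \<kappa> \<and> regularCard \<kappa> \<and> \<kappa> \<le>o |B| \<and> f ` Field \<kappa> \<subseteq> B \<and>
      (\<forall>i j. (i, j) \<in> \<kappa> \<and> i \<noteq> j \<longrightarrow> lt s a (f j) (f i)) \<and>
      (\<forall>x\<in>B. \<exists>i\<in>Field \<kappa>. x = f i \<or> lt s a (f i) x)"
  proof (rule exists_cofinal_sequence)
    show "lt s a z x" if "lt s a y x" "lt s a z y" for x y z using that(2,1) by (rule lt_trans[OF a])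
    show "lt s a y x \<or> lt s a x y" if "x \<in> B" "y \<in> B" "x \<noteq> y" for x y
      using that B(1) lt_total[OF a, of x y] by auto
  qed (use nomin Bne lt_irrefl in auto)
  then obtain \<kappa>2 :: "'a list rel" and g where g: "Cinfinite \<kappa>2" "regularCard \<kappa>2" "\<kappa>2 \<le>o |B|"
    "g ` Field \<kappa>2 \<subseteq> B" "\<And>i j. (i, j) \<in> \<kappa>2 \<and> i \<noteq> j \<Longrightarrow> lt s a (g j) (g i)"
    "\<And>x. x \<in> B \<Longrightarrow> \<exists>i\<in>Field \<kappa>2. x = g i \<or> lt s a (g i) x" by metis
  define C1 where "C1 = {x. \<exists>y\<in>A. le s a x y}"
  define C2 where "C2 = {x. \<exists>y\<in>B. le s a y x}"
  have AC1: "A \<subseteq> C1" using le_refl[OF a] A(1) by (auto simp: C1_def)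
  have BC2: "B \<subseteq> C2" using le_refl[OF a] B(1) by (auto simp: C2_def)
  have C12: "lt s a x y" if xy: "x \<in> C1" "y \<in> C2" for x y
  proof -
    obtain u v where uv: "u \<in> A" "le s a x u" "v \<in> B" "le s a v y" using xy by (auto simp: C1_def C2_def)
    obtain w where "w \<in> A" "lt s a u w" using nomax uv(1) by blast
    then have "lt s a x w" "le s a w v" using le_lt_trans[OF a uv(2)] AB uv(3) by auto
    then show ?thesis using lt_le_trans[OF a] uv(4) by blast
  qed
  have "is_cut s a \<kappa>1 \<kappa>2 C1 C2" unfolding is_cut_def
  proof (intro conjI)
    show "C1 \<union> C2 = X a"
    proof (intro equalityI subsetI)
      fix x assume "x \<in> C1 \<union> C2" then show "x \<in> X a" using le_X by (auto simp: C1_def C2_def)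
    next
      fix x assume x: "x \<in> X a"
      show "x \<in> C1 \<union> C2"
      proof (rule ccontr)
        assume "x \<notin> C1 \<union> C2"
        then have "y \<in> A \<Longrightarrow> \<not> le s a x y" "y \<in> B \<Longrightarrow> \<not> le s a y x" for y
          by (auto simp: C1_def C2_def)
        then have "\<forall>y\<in>A. le s a y x" "\<forall>y\<in>B. le s a x y"
          using le_total[OF a x] A(1) B(1) by (metis subsetD)+
        then show False using no x by blast
      qed
    qed
    show "C1 \<inter> C2 = {}" using C12 lt_irrefl by blast
    show "\<forall>x\<in>C1. \<forall>y. le s a y x \<longrightarrow> y \<in> C1"
      using le_trans[OF a] unfolding C1_def by blast
    show "\<forall>x\<in>C2. \<forall>y. le s a x y \<longrightarrow> y \<in> C2"
      using le_trans[OF a] unfolding C2_def by blast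
    show "\<forall>x\<in>C1. \<forall>y\<in>C2. lt s a x y" using C12 by blast
    show "\<exists>f. f ` Field \<kappa>1 \<subseteq> C1 \<and> (\<forall>i j. (i, j) \<in> \<kappa>1 \<and> i \<noteq> j \<longrightarrow> lt s a (f i) (f j)) \<and>
          (\<forall>x\<in>C1. \<exists>i\<in>Field \<kappa>1. le s a x (f i))"
    proof (intro exI[of _ f] conjI ballI)
      show "f ` Field \<kappa>1 \<subseteq> C1" using f(4) AC1 by (rule subset_trans)
      fix x assume "x \<in> C1"
      then obtain y where y: "y \<in> A" "le s a x y" by (auto simp: C1_def)
      obtain i where i: "i \<in> Field \<kappa>1" "y = f i \<or> lt s a y (f i)" using f(6)[OF y(1)] by blast
      then have "le s a x (f i)" using y(2) le_trans[OF a y(2)] by (auto simp: lt_imp_le)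
      then show "\<exists>i\<in>Field \<kappa>1. le s a x (f i)" using i(1) by blast
    qed (use f(5) in auto)
    show "\<exists>g. g ` Field \<kappa>2 \<subseteq> C2 \<and> (\<forall>i j. (i, j) \<in> \<kappa>2 \<and> i \<noteq> j \<longrightarrow> lt s a (g j) (g i)) \<and>
          (\<forall>x\<in>C2. \<exists>i\<in>Field \<kappa>2. le s a (g i) x)"
    proof (intro exI[of _ g] conjI ballI)
      show "g ` Field \<kappa>2 \<subseteq> C2" using g(4) BC2 by (rule subset_trans)
      fix x assume "x \<in> C2"
      then obtain y where y: "y \<in> B" "le s a y x" by (auto simp: C2_def)
      obtain i where i: "i \<in> Field \<kappa>2" "y = g i \<or> lt s a (g i) y" using g(6)[OF y(1)] by blast
      then have "le s a (g i) x" using y(2) le_trans[OF a _ y(2)] by (auto simp: lt_imp_le)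
      then show "\<exists>i\<in>Field \<kappa>2. le s a (g i) x" using i(1) by blast
    qed (use g(5) in auto)
  qed
  then have "(\<kappa>1, \<kappa>2) \<in> cut_spectrum s" using f(1,2) g(1,2) a unfolding cut_spectrum_def by blast
  moreover have "\<kappa>1 <o lam" using f(3) A(2) by (rule ordLeq_ordLess_trans)
  moreover have "\<kappa>2 <o lam" using g(3) B(2) by (rule ordLeq_ordLess_trans)
  ultimately show False by (rule no_smaller_cut)
qed

end

section \<open>Towers with prescribed entries and coverings of small sets\<close>

context spectrum
begin

text \<open>\<open>DP\<close> speaks of predicates on assignments. Quantifying over all terms lets a
  definable set, and likewise a relation in \<open>drel\<close>, appear with arbitrary arguments
  inside larger definable predicates.\<close>

definition dset :: "('f, 'r, 'a) ord_inst \<Rightarrow> 'a list set \<Rightarrow> bool" where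
  "dset c E \<longleftrightarrow> (\<forall>t. TM (ar c) t \<longrightarrow> DP (\<lambda>e. t e \<in> E))"

definition drel :: "('f, 'r, 'a) ord_inst \<Rightarrow> ('a list \<Rightarrow> 'a list \<Rightarrow> bool) \<Rightarrow> bool" where
  "drel c R \<longleftrightarrow> (\<forall>t u. TM (ar c) t \<longrightarrow> TM (ar c) u \<longrightarrow> DP (\<lambda>e. R (t e) (u e)))"

lemma DP_dset: "dset c E \<Longrightarrow> TM (ar c) t \<Longrightarrow> DP (\<lambda>e. t e \<in> E)"
  by (simp add: dset_def)

lemma DP_drel: "drel c R \<Longrightarrow> TM (ar c) t \<Longrightarrow> TM (ar c) u \<Longrightarrow> DP (\<lambda>e. R (t e) (u e))"
  by (simp add: drel_def)

lemma X_TM: "x \<in> X a \<Longrightarrow> TM (ar a) (\<lambda>e. x)"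
  using X_tuples TM_const by blast

lemma T_TM: "b \<in> T a \<Longrightarrow> TM (tar a) (\<lambda>e. b)"
  using T_tuples TM_const by blast

lemmas DP_intros = DP_conj DP_disj DP_imp DP_iff DP_not DP_ex_X DP_all_X DP_ex_T DP_all_T
  DP_ent DP_le DP_lt DP_X DP_T

text \<open>The bound \<open>n\<close> is independent of the length of \<open>b\<close>: it is the
  variable over which a last element is taken. The same holds for \<open>entries\<close>.\<close>

definition pairwise :: "('f, 'r, 'a) ord_inst \<Rightarrow> ('a list \<Rightarrow> 'a list \<Rightarrow> bool) \<Rightarrow> 'a list \<Rightarrow> 'a list \<Rightarrow> bool" where
  "pairwise c R b n \<longleftrightarrow> (\<forall>p\<in>X c. \<forall>q\<in>X c. \<forall>x\<in>X c. \<forall>y\<in>X c.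
     ent c b p x \<and> ent c b q y \<and> lt s c p q \<and> lt s c q n \<longrightarrow> R x y)"

definition entries :: "('f, 'r, 'a) ord_inst \<Rightarrow> 'a list set \<Rightarrow> 'a list \<Rightarrow> 'a list \<Rightarrow> bool" where
  "entries c E b n \<longleftrightarrow> (\<forall>p\<in>X c. \<forall>x\<in>X c. ent c b p x \<and> lt s c p n \<longrightarrow> x \<in> E)"

lemma ex_greatest_entries:
  assumes "c \<in> Or" "b \<in> T c" "dset c E" "le s c n0 (lg s c b)" "entries c E b n0"
  shows "\<exists>n\<in>X c. (le s c n (lg s c b) \<and> entries c E b n) \<and>
    (\<forall>m\<in>X c. le s c m (lg s c b) \<and> entries c E b m \<longrightarrow> le s c m n)"
  unfolding entries_def
proof (rule ex_greatest(1)[OF assms(1) le_X(1)[OF assms(4)]])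
  show "le s c n0 (lg s c b) \<and> (\<forall>p\<in>X c. \<forall>x\<in>X c. ent c b p x \<and> lt s c p n0 \<longrightarrow> x \<in> E)"
    using assms(4,5) by (simp add: entries_def)
qed (intro DP_intros DP_dset[OF assms(3)] assms(1) X_TM lg_X[OF assms(1,2)] T_TM assms(2) TM_front TM_shift)

lemma ex_greatest_pairwise:
  assumes "c \<in> Or" "b \<in> T c" "drel c R" "N \<in> X c" "le s c n0 (lg s c b)" "lt s c n0 N" "pairwise c R b n0"
  shows "\<exists>n\<in>X c. (le s c n (lg s c b) \<and> lt s c n N \<and> pairwise c R b n) \<and>
    (\<forall>m\<in>X c. le s c m (lg s c b) \<and> lt s c m N \<and> pairwise c R b m \<longrightarrow> le s c m n)"
  unfolding pairwise_def
proof (rule ex_greatest(1)[OF assms(1) le_X(1)[OF assms(5)]])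
  show "le s c n0 (lg s c b) \<and> lt s c n0 N \<and> (\<forall>p\<in>X c. \<forall>q\<in>X c. \<forall>x\<in>X c. \<forall>y\<in>X c.
     ent c b p x \<and> ent c b q y \<and> lt s c p q \<and> lt s c q n0 \<longrightarrow> R x y)"
    using assms(5-7) by (simp add: pairwise_def)
qed (intro DP_intros DP_drel[OF assms(3)] assms(1) X_TM assms(4) lg_X[OF assms(1,2)] T_TM assms(2) TM_front TM_shift)

end

context minimal_cut
begin

text \<open>
  At limit stages an upper bound of the tower is cut off at a position below which all constraints
  in \<open>EE i\<close> hold. There are fewer than \<open>lam\<close> of them, each holds up to a definable position above the
  whole tower, and so interpolation yields one position for all of them.
\<close>

lemma tower:
  assumes c: "c \<in> Or" and N: "N \<in> X c" "le s c N (bnd c)" "infinite {x. lt s c x N}"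
    and mu: "Well_order mu" "\<And>i. i \<in> Field mu \<Longrightarrow> |underS mu i| <o lam" "|Field mu| \<le>o lam"
    and v: "\<And>i. i \<in> Field mu \<Longrightarrow> v i \<in> X c"
    and EE: "\<And>i. i \<in> Field mu \<Longrightarrow> |EE i| <o lam"
    and dE: "\<And>i E. i \<in> Field mu \<Longrightarrow> E \<in> EE i \<Longrightarrow> dset c E"
    and dR: "drel c R"
    and h1: "\<And>i j E. (i, j) \<in> mu \<Longrightarrow> i \<noteq> j \<Longrightarrow> E \<in> EE j \<Longrightarrow> v i \<in> E"
    and h2: "\<And>i j x E. (i, j) \<in> mu \<Longrightarrow> i \<noteq> j \<Longrightarrow> x \<in> X c \<Longrightarrow> (\<And>E. E \<in> EE i \<Longrightarrow> x \<in> E) \<Longrightarrow> E \<in> EE j \<Longrightarrow> x \<in> E"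
    and h3: "\<And>i x. i \<in> Field mu \<Longrightarrow> x \<in> X c \<Longrightarrow> (\<And>E. E \<in> EE i \<Longrightarrow> x \<in> E) \<Longrightarrow> R x (v i)"
  shows "\<exists>e k. e \<in> T c \<and> lt s c (lg s c e) N \<and> (\<forall>i\<in>Field mu. ent c e (k i) (v i)) \<and>
     (\<forall>i j. (i, j) \<in> mu \<and> i \<noteq> j \<longrightarrow> lt s c (k i) (k j)) \<and>
     (\<forall>p q x y. ent c e p x \<and> ent c e q y \<and> lt s c p q \<longrightarrow> R x y) \<and>
     (\<forall>i j p x E. (i, j) \<in> mu \<and> i \<noteq> j \<and> ent c e p x \<and> le s c p (k i) \<and> E \<in> EE j \<longrightarrow> x \<in> E)"
proof -
  have lin: "Linear_order mu" and wf: "wf (mu - Id)" using mu(1) by (auto simp: well_order_on_def)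
  have muF: "i \<in> Field mu" "j \<in> Field mu" if "(i, j) \<in> mu" for i j using that by (auto simp: Field_def)
  have mutot: "(i, j) \<in> mu \<or> (j, i) \<in> mu" if "i \<in> Field mu" "j \<in> Field mu" for i j
    using lin that by (cases "i = j") (auto simp: linear_order_on_def total_on_def partial_order_on_def
        preorder_on_def refl_on_def)
  \<comment> \<open>The infinite segment is the room that keeps every further step possible. The
    last clause concerns all later \<open>j\<close>, so each later stage finds its own constraints
    already satisfied by the entries of this one.\<close>
  define good where "good i d \<longleftrightarrow> d \<in> T c \<and> infinite (seg c (lg s c d) N) \<and> pairwise c R d (lg s c d) \<and>
    (\<forall>j p x E. (i, j) \<in> mu \<and> i \<noteq> j \<and> ent c d p x \<and> E \<in> EE j \<longrightarrow> x \<in> E)" for i d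
  \<comment> \<open>Placing \<open>v i\<close> at or above the lengths of all earlier stages makes
    the positions increase with \<open>i\<close>.\<close>
  define P where "P f i d \<longleftrightarrow> (i \<in> Field mu \<longrightarrow> good i d \<and> (\<exists>k. ent c d k (v i) \<and>
     (\<forall>j. (j, i) \<in> mu \<and> j \<noteq> i \<longrightarrow> tle s c (f j) d \<and> le s c (lg s c (f j)) k)))" for f i d
  have "\<exists>f. \<forall>i. P f i (f i)"
  proof (rule dependent_wf_choice[OF wf])
    show "P f i x = P g i x" if fg: "\<And>j. (j, i) \<in> mu - Id \<Longrightarrow> f j = g j" for f g i x
    proof -
      have "f j = g j" if "(j, i) \<in> mu \<and> j \<noteq> i" for j using fg[of j] that by auto
      then show ?thesis unfolding P_def by (metis (no_types, lifting))
    qed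
  next
    fix i f assume "\<And>j. (j, i) \<in> mu - Id \<Longrightarrow> P f j (f j)"
    then have IH: "P f j (f j)" if "(j, i) \<in> mu" "j \<noteq> i" for j using that by auto
    show "\<exists>d. P f i d"
    proof (cases "i \<in> Field mu")
      case False
      then show ?thesis by (simp add: P_def)
    next
      case i: True
      have g: "good j (f j)" if "j \<in> underS mu i" for j
        using IH[of j] that muF(1)[of j i] by (auto simp: underS_def P_def)
      have gT: "f j \<in> T c" if "j \<in> underS mu i" for j using g[OF that] by (simp add: good_def)
      have gE: "x \<in> E" if "j \<in> underS mu i" "ent c (f j) p x" "E \<in> EE i" for j p x E
        using g[OF that(1)] that by (auto simp: good_def underS_def)
      have ch: "tle s c (f j) (f j')" if "j' \<in> underS mu i" "(j, j') \<in> mu" for j j'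
      proof (cases "j = j'")
        case True
        then show ?thesis using tle_order(1)[OF c gT[OF that(1)]] by simp
      next
        case False
        have "P f j' (f j')" using IH[of j'] that by (auto simp: underS_def)
        then show ?thesis using False that muF(2)[OF that(2)] by (auto simp: P_def)
      qed
      have "\<exists>d\<in>T c. (\<forall>j\<in>underS mu i. tle s c (f j) d) \<and> infinite (seg c (lg s c d) N) \<and>
          pairwise c R d (lg s c d) \<and> (\<forall>p x E. ent c d p x \<and> E \<in> EE i \<longrightarrow> x \<in> E)"
      \<comment> \<open>Stages with an immediate predecessor, the initial stage and limit stages;
        only limits need a bound of the tower.\<close>
      proof (cases "\<exists>m\<in>underS mu i. \<forall>j\<in>underS mu i. (j, m) \<in> mu")
        case True
        then obtain m where m: "m \<in> underS mu i" "\<forall>j\<in>underS mu i. (j, m) \<in> mu" by blast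
        then show ?thesis using ch[OF m(1)] g[OF m(1)] gE[OF m(1)]
          by (intro bexI[of _ "f m"]) (auto simp: good_def)
      next
        case nomax: False
        show ?thesis
        proof (cases "underS mu i = {}")
          case True
          obtain b where b: "b \<in> T c" "\<And>y. y \<in> X c \<Longrightarrow> le s c (lg s c b) y" "\<And>k v. \<not> ent c b k v"
            using ex_empty_sequence[OF c] by blast
          have "infinite (seg c (lg s c b) N)" using infinite_seg_first[OF N(3) b(2)] by simp
          then show ?thesis using True b by (intro bexI[of _ b]) (auto simp: pairwise_def)
        next
          case ne: False
          have inf: "infinite (underS mu i)"
          proof
            assume "finite (underS mu i)"
            then have "\<exists>m\<in>underS mu i. \<forall>y\<in>underS mu i. y = m \<or> (y, m) \<in> mu"
            proof (rule finite_strict_order_has_greatest[OF _ ne])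
              show "(x, z) \<in> mu" if "(x, y) \<in> mu" "(y, z) \<in> mu" for x y z
                using lin that by (auto simp: linear_order_on_def partial_order_on_def preorder_on_def elim: transE)
              show "(x, y) \<in> mu \<or> (y, x) \<in> mu" if "x \<in> underS mu i" "y \<in> underS mu i" for x y
                using that mutot[of x y] muF by (auto simp: underS_def)
            qed
            then obtain m where m: "m \<in> underS mu i" "\<forall>y\<in>underS mu i. y = m \<or> (y, m) \<in> mu" by blast
            moreover have "(m, m) \<in> mu" using mutot[of m m] muF m(1) by (auto simp: underS_def)
            ultimately have "\<forall>y\<in>underS mu i. (y, m) \<in> mu" by auto
            then show False using nomax m(1) by auto
          qed
          have small: "|f ` underS mu i| <o lam"
            using card_of_image mu(2)[OF i] by (rule ordLeq_ordLess_trans)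
          have "\<exists>b\<in>T c. \<forall>d\<in>f ` underS mu i. tle s c d b"
          proof (rule chain_bounded[OF c _ ordLess_imp_ordLeq[OF small]])
            show "f ` underS mu i \<subseteq> T c" using gT by auto
            fix x y assume "x \<in> f ` underS mu i" "y \<in> f ` underS mu i"
            then obtain j j' where jj: "x = f j" "y = f j'" "j \<in> underS mu i" "j' \<in> underS mu i" by auto
            then have "(j, j') \<in> mu \<or> (j', j) \<in> mu" using mutot[of j j'] muF by (auto simp: underS_def)
            then show "tle s c x y \<or> tle s c y x" using ch[of j' j] ch[of j j'] jj by auto
          qed
          then obtain b where b: "b \<in> T c" and fb: "\<And>j. j \<in> underS mu i \<Longrightarrow> tle s c (f j) b" by blast
          \<comment> \<open>Below the length of an earlier stage, the bound has exactly the entries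
            of that stage.\<close>
          have fent: "ent c (f j) p x" if "j \<in> underS mu i" "ent c b p x" "lt s c p (lg s c (f j))" for j p x
            using ent_ex[OF c gT[OF that(1)] that(3)] tle_ent[OF c fb[OF that(1)]] ent_unique[OF c b that(2)]
            by metis
          have fE: "entries c E b (lg s c (f j))" if "j \<in> underS mu i" "E \<in> EE i" for j E
            unfolding entries_def using fent[OF that(1)] gE[OF that(1) _ that(2)] by blast
          have fR: "pairwise c R b (lg s c (f j))" if j: "j \<in> underS mu i" for j
            unfolding pairwise_def
          proof (intro ballI impI, elim conjE)
            fix p q x y assume pq: "p \<in> X c" "q \<in> X c" "x \<in> X c" "y \<in> X c" "ent c b p x" "ent c b q y"
              "lt s c p q" "lt s c q (lg s c (f j))"
            have "ent c (f j) p x" "ent c (f j) q y"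
              using fent[OF j pq(5)] fent[OF j pq(6)] pq(8) lt_trans[OF c pq(7,8)] by auto
            then show "R x y" using g[OF j] pq unfolding good_def pairwise_def by auto
          qed
          obtain j0 where j0: "j0 \<in> underS mu i" using ne by auto
          have lgN: "lt s c (lg s c (f j)) N" if "j \<in> underS mu i" for j
            using infinite_seg_imp_lt[OF c lg_X[OF c gT[OF that]] N(1)] g[OF that] by (simp add: good_def)
          \<comment> \<open>The positions up to which the entries of \<open>b\<close> satisfy
            \<open>E\<close> include all lengths of the tower, and therefore so does the range below
            the last such position.\<close>
          have "\<forall>E\<in>EE i. \<exists>n. n \<in> X c \<and> entries c E b n \<and> (\<forall>j\<in>underS mu i. le s c (lg s c (f j)) n)"
          proof
            fix E assume E: "E \<in> EE i"
            obtain n where n: "n \<in> X c" "entries c E b n"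
              "\<And>m. m \<in> X c \<Longrightarrow> le s c m (lg s c b) \<and> entries c E b m \<Longrightarrow> le s c m n"
              using ex_greatest_entries[OF c b dE[OF i E] tle_lg[OF c fb[OF j0]] fE[OF j0 E]] by blast
            have "le s c (lg s c (f j)) n" if j: "j \<in> underS mu i" for j
              using n(3)[OF lg_X[OF c gT[OF j]]] tle_lg[OF c fb[OF j]] fE[OF j E] by blast
            then show "\<exists>n. n \<in> X c \<and> entries c E b n \<and> (\<forall>j\<in>underS mu i. le s c (lg s c (f j)) n)"
              using n(1,2) by blast
          qed
          then obtain nE where nE: "\<And>E. E \<in> EE i \<Longrightarrow> nE E \<in> X c" "\<And>E. E \<in> EE i \<Longrightarrow> entries c E b (nE E)"
            "\<And>E j. E \<in> EE i \<Longrightarrow> j \<in> underS mu i \<Longrightarrow> le s c (lg s c (f j)) (nE E)"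
            by metis
          obtain nR where nR: "nR \<in> X c" "le s c nR (lg s c b)" "pairwise c R b nR"
              "\<And>m. m \<in> X c \<Longrightarrow> le s c m (lg s c b) \<and> lt s c m N \<and> pairwise c R b m \<Longrightarrow> le s c m nR"
            using ex_greatest_pairwise[OF c b dR N(1) tle_lg[OF c fb[OF j0]] lgN[OF j0] fR[OF j0]] by blast
          have nRf: "le s c (lg s c (f j)) nR" if j: "j \<in> underS mu i" for j
            using nR(4)[OF lg_X[OF c gT[OF j]]] tle_lg[OF c fb[OF j]] fR[OF j] lgN[OF j] by blast
          have nearf: "le s c (lg s c (f j)) x" if j: "j \<in> underS mu i" and x: "x \<in> near c N" for j x
          proof (rule ccontr)
            assume "\<not> ?thesis"
            then have "lt s c x (lg s c (f j))"
              using not_le[OF c lg_X[OF c gT[OF j]], of x] x by (simp add: near_def)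
            then have "infinite (seg c x N)"
              using infinite_seg_anti[OF c lt_imp_le, of x "lg s c (f j)" N] g[OF j] by (simp add: good_def)
            then show False using x by (simp add: near_def)
          qed
          define A where "A = (\<lambda>j. lg s c (f j)) ` underS mu i"
          \<comment> \<open>The upper limits: one position for each constraint, one for the pairwise
            condition, and all positions at finite distance from \<open>N\<close>. The latter are
            countably many, hence at most as many as the infinitely many earlier stages.\<close>
          define B where "B = nE ` EE i \<union> ({nR} \<union> near c N)"
          have "\<exists>z\<in>X c. (\<forall>x\<in>A. le s c x z) \<and> (\<forall>y\<in>B. le s c z y)"
          proof (rule interpolate[OF c])
            show "A \<subseteq> X c" using lg_X[OF c] gT by (auto simp: A_def)
            show "B \<subseteq> X c" using nE(1) nR(1) by (auto simp: B_def near_def)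
            show "|A| <o lam" unfolding A_def using card_of_image mu(2)[OF i] by (rule ordLeq_ordLess_trans)
            have "|near c N| \<le>o |underS mu i|"
              using card_of_near[OF c] inf infinite_iff_card_of_nat ordLeq_transitive by blast
            then have "|near c N| <o lam" using mu(2)[OF i] by (rule ordLeq_ordLess_trans)
            moreover have "|nE ` EE i| <o lam" using card_of_image EE[OF i] by (rule ordLeq_ordLess_trans)
            ultimately show "|B| <o lam" unfolding B_def by (intro card_of_Un_less card_of_finite_less[of "{nR}"]) auto
            show "le s c x y" if "x \<in> A" "y \<in> B" for x y
              using that nE(3) nRf nearf unfolding A_def B_def by (elim UnE imageE singletonE) auto
          qed
          then obtain z where z0: "z \<in> X c" "\<forall>x\<in>A. le s c x z" "\<forall>y\<in>B. le s c z y" by blast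
          then have z: "z \<in> X c" "\<And>j. j \<in> underS mu i \<Longrightarrow> le s c (lg s c (f j)) z"
            "\<And>E. E \<in> EE i \<Longrightarrow> le s c z (nE E)" "le s c z nR" "\<And>x. x \<in> near c N \<Longrightarrow> le s c z x"
            by (simp_all add: A_def B_def)
          obtain d where d: "d \<in> T c" "lg s c d = z" "\<And>k v. ent c d k v \<longleftrightarrow> ent c b k v \<and> lt s c k z"
            using restrict_tree[OF c b le_trans[OF c z(4) nR(2)]] by blast
          show ?thesis
          proof (intro bexI[of _ d] conjI ballI allI impI)
            fix j assume j: "j \<in> underS mu i"
            show "tle s c (f j) d" unfolding tle_iff[OF c gT[OF j] d(1)]
              using z(2)[OF j] d(2,3) tle_ent[OF c fb[OF j]] ent_lt[OF c gT[OF j]] lt_le_trans[OF c _ z(2)[OF j]]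
              by auto
          next
            show "infinite (seg c (lg s c d) N)"
              unfolding d(2) by (rule infinite_seg_if_below_near[OF c N(1,3) z(1,5)])
            show "pairwise c R d (lg s c d)"
              using nR(3) d(2,3) lt_le_trans[OF c _ z(4)] unfolding pairwise_def by auto
            fix p x E assume "ent c d p x \<and> E \<in> EE i"
            then show "x \<in> E"
              using nE(2)[of E] d(3)[of p x] lt_le_trans[OF c _ z(3)[of E], of p] ent_X[of c b p x]
              unfolding entries_def by auto
          qed (rule d)
        qed
      qed
      then obtain b where b: "b \<in> T c" "\<And>j. j \<in> underS mu i \<Longrightarrow> tle s c (f j) b"
          "infinite (seg c (lg s c b) N)" "pairwise c R b (lg s c b)"
          "\<And>p x E. ent c b p x \<Longrightarrow> E \<in> EE i \<Longrightarrow> x \<in> E" by blast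
      have "lt s c (lg s c b) (bnd c)"
        using lt_le_trans[OF c infinite_seg_imp_lt[OF c lg_X[OF c b(1)] N(1) b(3)] N(2)] .
      then obtain d where d: "d \<in> T c" "lt s c (lg s c b) (lg s c d)" "\<And>z. lt s c (lg s c b) z \<Longrightarrow> le s c (lg s c d) z"
          "\<And>k w. ent c d k w \<longleftrightarrow> ent c b k w \<or> k = lg s c b \<and> w = v i"
        using append_tree[OF c b(1) v[OF i]] by blast
      have bd: "tle s c b d" unfolding tle_iff[OF c b(1) d(1)] using d(2,4) lt_imp_le by auto
      have "P f i d" unfolding P_def
      proof (intro impI conjI exI[of _ "lg s c b"] allI)
        show "good i d" unfolding good_def
        proof (intro conjI allI impI d(1))
          show "infinite (seg c (lg s c d) N)" by (rule infinite_seg_succ[OF c d(3) b(3)])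
          show "pairwise c R d (lg s c d)" unfolding pairwise_def
          proof (intro ballI impI, elim conjE)
            fix p q x y assume pq: "x \<in> X c" "y \<in> X c" "ent c d p x" "ent c d q y"
              "lt s c p q" "lt s c q (lg s c d)"
            have q: "le s c q (lg s c b)"
              using d(3)[of q] lt_asym[OF c pq(6)] not_le[OF c, of q "lg s c b"] lt_X[OF pq(6)] lg_X[OF c b(1)]
              by blast
            then have plt: "lt s c p (lg s c b)" by (rule lt_le_trans[OF c pq(5)])
            then have p: "ent c b p x" using pq(3) d(4) lt_irrefl by metis
            show "R x y"
            proof (cases "q = lg s c b")
              case True
              then have "y = v i"
                using pq(4) d(4) ent_lt[OF c b(1)] lt_irrefl by metis
              moreover have "R x (v i)" using h3[OF i pq(1)] b(5)[OF p] by blast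
              ultimately show ?thesis by simp
            next
              case False
              then have "ent c b q y" using pq(4) d(4) by auto
              then show ?thesis using b(4) p pq ent_X[OF p] ent_X[of c b q y] ent_lt[OF c b(1), of q y]
                unfolding pairwise_def by blast
            qed
          qed
          fix j p x E assume *: "(i, j) \<in> mu \<and> i \<noteq> j \<and> ent c d p x \<and> E \<in> EE j"
          then consider "ent c b p x" | "x = v i" using d(4) by auto
          then show "x \<in> E"
          proof cases
            case 1
            show ?thesis by (rule h2[of i j]) (use * b(5)[OF 1] ent_X[OF 1] in auto)
          next
            case 2
            then show ?thesis using h1[of i j E] * by auto
          qed
        qed
        show "ent c d (lg s c b) (v i)" using d(4) by blast
        fix j assume "(j, i) \<in> mu \<and> j \<noteq> i"
        then have j: "j \<in> underS mu i" by (auto simp: underS_def)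
        show "tle s c (f j) d" using tle_order(2)[OF c b(2)[OF j] bd] .
        show "le s c (lg s c (f j)) (lg s c b)" using tle_lg[OF c b(2)[OF j]] .
      qed
      then show ?thesis ..
    qed
  qed
  then obtain f where f: "\<And>i. P f i (f i)" by blast
  then have g: "good i (f i)" if "i \<in> Field mu" for i using that by (auto simp: P_def)
  have gT: "f i \<in> T c" if "i \<in> Field mu" for i using g[OF that] by (simp add: good_def)
  have "\<forall>i\<in>Field mu. \<exists>k. ent c (f i) k (v i) \<and>
     (\<forall>j. (j, i) \<in> mu \<and> j \<noteq> i \<longrightarrow> tle s c (f j) (f i) \<and> le s c (lg s c (f j)) k)"
    using f by (auto simp: P_def)
  then obtain k where k: "\<And>i. i \<in> Field mu \<Longrightarrow> ent c (f i) (k i) (v i)"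
     "\<And>i j. i \<in> Field mu \<Longrightarrow> (j, i) \<in> mu \<and> j \<noteq> i \<Longrightarrow> tle s c (f j) (f i)"
     "\<And>i j. i \<in> Field mu \<Longrightarrow> (j, i) \<in> mu \<and> j \<noteq> i \<Longrightarrow> le s c (lg s c (f j)) (k i)"
    by metis
  have "\<exists>b\<in>T c. \<forall>d\<in>f ` Field mu. tle s c d b"
  proof (rule chain_bounded[OF c])
    show "|f ` Field mu| \<le>o lam" using card_of_image mu(3) by (rule ordLeq_transitive)
    show "f ` Field mu \<subseteq> T c" using gT by auto
    fix x y assume "x \<in> f ` Field mu" "y \<in> f ` Field mu"
    then obtain i j where ij: "x = f i" "y = f j" "i \<in> Field mu" "j \<in> Field mu" by auto
    show "tle s c x y \<or> tle s c y x"
    proof (cases "i = j")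
      case True
      then show ?thesis using ij tle_order(1)[OF c gT] by auto
    next
      case False
      then show ?thesis using mutot[OF ij(3,4)] k(2)[OF ij(3), of j] k(2)[OF ij(4), of i] ij(1,2) by auto
    qed
  qed
  then obtain b where b: "b \<in> T c" and fb: "\<And>i. i \<in> Field mu \<Longrightarrow> tle s c (f i) b" by blast
  have fent: "ent c (f j) p x" if "j \<in> Field mu" "ent c b p x" "lt s c p (lg s c (f j))" for j p x
    using ent_ex[OF c gT[OF that(1)] that(3)] tle_ent[OF c fb[OF that(1)]] ent_unique[OF c b that(2)]
    by metis
  obtain x0 where x0: "x0 \<in> X c" "\<And>y. y \<in> X c \<Longrightarrow> le s c x0 y" using ex_first(1)[OF c] by blast
  have x0p: "pairwise c R b x0" unfolding pairwise_def using x0(2) lt_asym[OF c] by blast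
  have x0N: "lt s c x0 N"
    by (rule infinite_seg_imp_lt[OF c x0(1) N(1) infinite_seg_first[OF N(3) x0(2)]])
  \<comment> \<open>The tower may have \<open>lam\<close> many stages here, which is too many for
    interpolation. Only one definable condition is left, however: staying below \<open>N\<close>
    with entries pairwise in \<open>R\<close>. Its last position suffices.\<close>
  obtain n where n: "n \<in> X c" "le s c n (lg s c b)" "lt s c n N" "pairwise c R b n"
      "\<And>m. m \<in> X c \<Longrightarrow> le s c m (lg s c b) \<and> lt s c m N \<and> pairwise c R b m \<Longrightarrow> le s c m n"
    using ex_greatest_pairwise[OF c b dR N(1) x0(2)[OF lg_X[OF c b]] x0N x0p] by blast
  have nf: "le s c (lg s c (f j)) n" if j: "j \<in> Field mu" for j
  proof (rule n(5)[OF lg_X[OF c gT[OF j]]], intro conjI)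
    show "le s c (lg s c (f j)) (lg s c b)" by (rule tle_lg[OF c fb[OF j]])
    show "lt s c (lg s c (f j)) N"
      using infinite_seg_imp_lt[OF c lg_X[OF c gT[OF j]] N(1)] g[OF j] by (simp add: good_def)
    show "pairwise c R b (lg s c (f j))" unfolding pairwise_def
    proof (intro ballI impI, elim conjE)
      fix p q x y assume pq: "p \<in> X c" "q \<in> X c" "x \<in> X c" "y \<in> X c" "ent c b p x" "ent c b q y"
        "lt s c p q" "lt s c q (lg s c (f j))"
      have "ent c (f j) p x" "ent c (f j) q y"
        using fent[OF j pq(5)] fent[OF j pq(6)] pq(8) lt_trans[OF c pq(7,8)] by auto
      then show "R x y" using g[OF j] pq unfolding good_def pairwise_def by auto
    qed
  qed
  obtain e where e: "e \<in> T c" "lg s c e = n" "\<And>k v. ent c e k v \<longleftrightarrow> ent c b k v \<and> lt s c k n"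
    using restrict_tree[OF c b n(2)] by blast
  show ?thesis
  proof (intro exI[of _ e] exI[of _ k] conjI ballI allI impI)
    show "e \<in> T c" "lt s c (lg s c e) N" using e n(3) by auto
    show "ent c e (k i) (v i)" if i: "i \<in> Field mu" for i
      using e(3) tle_ent[OF c fb[OF i] k(1)[OF i]] lt_le_trans[OF c ent_lt[OF c gT[OF i] k(1)[OF i]] nf[OF i]]
      by auto
    show "lt s c (k i) (k j)" if ij: "(i, j) \<in> mu \<and> i \<noteq> j" for i j
    proof -
      have F: "i \<in> Field mu" "j \<in> Field mu" using ij muF by auto
      show ?thesis using lt_le_trans[OF c ent_lt[OF c gT[OF F(1)] k(1)[OF F(1)]] k(3)[OF F(2) ij]] .
    qed
    show "R x y" if "ent c e p x \<and> ent c e q y \<and> lt s c p q" for p q x y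
      using that n(4) e(3) ent_X[of c b p x] ent_X[of c b q y] unfolding pairwise_def by auto
    show "x \<in> E" if *: "(i, j) \<in> mu \<and> i \<noteq> j \<and> ent c e p x \<and> le s c p (k i) \<and> E \<in> EE j" for i j p x E
    proof -
      have i: "i \<in> Field mu" using * muF by auto
      have "lt s c p (lg s c (f i))"
        using * le_lt_trans[OF c _ ent_lt[OF c gT[OF i] k(1)[OF i]]] by auto
      then have "ent c (f i) p x" using fent[OF i] * e(3) by auto
      then show ?thesis using g[OF i] * unfolding good_def by blast
    qed
  qed
qed

text \<open>This makes small external sets part of internal ones. \<open>tower\<close> lists
  \<open>A\<close> along the well-order \<open>|A|\<close>, with the same constraints at every
  stage, namely \<open>R x y\<close> for all \<open>y \<in> A\<close>. Symmetry and reflexivity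
  extend \<open>R\<close> from increasing pairs of positions to all pairs.\<close>

lemma cover:
  assumes c: "c \<in> Or" and A: "A \<subseteq> X c" "|A| <o lam" and dR: "drel c R"
    and sym: "\<And>x y. R x y \<Longrightarrow> R y x" and refl: "\<And>x. R x x"
    and AR: "\<And>x y. x \<in> A \<Longrightarrow> y \<in> A \<Longrightarrow> R x y"
  shows "\<exists>e\<in>T c. (\<forall>x\<in>A. \<exists>p. ent c e p x) \<and> (\<forall>p q x y. ent c e p x \<longrightarrow> ent c e q y \<longrightarrow> R x y)"
proof -
  define mu where "mu = |A|"
  have F: "Field mu = A" by (simp add: mu_def Field_card_of)
  define EE where "EE i = (\<lambda>y. {x. R x y}) ` A" for i :: "'a list"
  have "\<exists>e k. e \<in> T c \<and> lt s c (lg s c e) (bnd c) \<and> (\<forall>i\<in>Field mu. ent c e (k i) i) \<and>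
     (\<forall>i j. (i, j) \<in> mu \<and> i \<noteq> j \<longrightarrow> lt s c (k i) (k j)) \<and>
     (\<forall>p q x y. ent c e p x \<and> ent c e q y \<and> lt s c p q \<longrightarrow> R x y) \<and>
     (\<forall>i j p x E. (i, j) \<in> mu \<and> i \<noteq> j \<and> ent c e p x \<and> le s c p (k i) \<and> E \<in> EE j \<longrightarrow> x \<in> E)"
  proof (rule tower[OF c OrD(3)[OF c] le_refl[OF c OrD(3)[OF c]] OrD(4)[OF c] _ _ _ _ _ _ dR])
    show "Well_order mu" unfolding mu_def by (rule card_of_Well_order)
    show "|Field mu| \<le>o lam" unfolding F by (rule ordLess_imp_ordLeq[OF A(2)])
    show "|underS mu i| <o lam" for i
    proof -
      have "underS mu i \<subseteq> A" using F by (auto simp: underS_def Field_def)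
      then show ?thesis using ordLeq_ordLess_trans[OF card_of_mono1 A(2)] by auto
    qed
    show "|EE i| <o lam" for i unfolding EE_def using card_of_image A(2) by (rule ordLeq_ordLess_trans)
    show "dset c E" if E: "E \<in> EE i" for i E
    proof -
      obtain y where y: "y \<in> X c" "E = {x. R x y}" using E A(1) by (auto simp: EE_def)
      show ?thesis unfolding dset_def y(2) mem_Collect_eq
        by (intro allI impI DP_drel[OF dR] X_TM[OF y(1)])
    qed
    show "i \<in> X c" if "i \<in> Field mu" for i using that F A(1) by auto
    show "i \<in> E" if "(i, j) \<in> mu" "E \<in> EE j" for i j E
    proof -
      have "i \<in> A" using that(1) F by (auto simp: Field_def)
      then show ?thesis using that(2) AR by (auto simp: EE_def)
    qed
    show "x \<in> E" if "\<And>E. E \<in> EE i \<Longrightarrow> x \<in> E" "E \<in> EE j" for i j x E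
      using that by (simp add: EE_def)
    show "R x i" if "i \<in> Field mu" "\<And>E. E \<in> EE i \<Longrightarrow> x \<in> E" for i x
      using that(2)[of "{x. R x i}"] that(1) F by (auto simp: EE_def)
  qed
  then obtain e k where e: "e \<in> T c" "\<And>i. i \<in> Field mu \<Longrightarrow> ent c e (k i) i"
    "\<And>p q x y. ent c e p x \<and> ent c e q y \<and> lt s c p q \<Longrightarrow> R x y" by metis
  have "R x y" if xy: "ent c e p x" "ent c e q y" for p q x y
  proof -
    consider "p = q" | "lt s c p q" | "lt s c q p"
      using lt_total[OF c ent_X(1)[OF xy(1)] ent_X(1)[OF xy(2)]] by blast
    then show ?thesis
    proof cases
      case 1
      then have "x = y" using ent_unique[OF c e(1) xy(1)] xy(2) by simp
      then show ?thesis using refl by simp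
    next
      case 2
      then show ?thesis using e(3) xy by blast
    next
      case 3
      then show ?thesis using e(3) xy sym by blast
    qed
  qed
  moreover have "\<exists>p. ent c e p x" if "x \<in> A" for x using e(2)[of x] that F by auto
  ultimately show ?thesis using e(1) by blast
qed

end

section \<open>Coding internal sets by elements of an order\<close>

context spectrum
begin

text \<open>Appending never fails: a length with finitely many predecessors lies below
  \<open>bnd c\<close>, which has infinitely many.\<close>

lemma ex_sequence_of_finite_set:
  assumes c: "c \<in> Or" and "finite F" "F \<subseteq> X c"
  shows "\<exists>b\<in>T c. finite {y. lt s c y (lg s c b)} \<and> (\<forall>x. (\<exists>p. ent c b p x) \<longleftrightarrow> x \<in> F)"
  using assms(2,3)
proof (induction F rule: finite_induct)
  case empty
  obtain b where b: "b \<in> T c" "\<And>y. y \<in> X c \<Longrightarrow> le s c (lg s c b) y" "\<And>k v. \<not> ent c b k v"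
    using ex_empty_sequence[OF c] by blast
  have "{y. lt s c y (lg s c b)} = {}" using b(2) lt_X lt_asym[OF c] by blast
  then show ?case using b by (intro bexI[of _ b]) auto
next
  case (insert x F)
  then obtain b where b: "b \<in> T c" "finite {y. lt s c y (lg s c b)}" "\<And>x. (\<exists>p. ent c b p x) \<longleftrightarrow> x \<in> F"
    by auto
  have "lt s c (lg s c b) (bnd c)"
  proof (rule ccontr)
    assume "\<not> ?thesis"
    then have "le s c (bnd c) (lg s c b)" using not_lt[OF c lg_X[OF c b(1)] OrD(3)[OF c]] by blast
    then have "{y. lt s c y (bnd c)} \<subseteq> {y. lt s c y (lg s c b)}" using lt_le_trans[OF c] by blast
    then show False using OrD(4)[OF c] b(2) finite_subset by blast
  qed
  then obtain d where d: "d \<in> T c" "lt s c (lg s c b) (lg s c d)" "\<And>z. lt s c (lg s c b) z \<Longrightarrow> le s c (lg s c d) z"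
      "\<And>k w. ent c d k w \<longleftrightarrow> ent c b k w \<or> k = lg s c b \<and> w = x"
    using append_tree[OF c b(1), of x] insert.prems by blast
  have "{y. lt s c y (lg s c d)} \<subseteq> insert (lg s c b) {y. lt s c y (lg s c b)}"
  proof
    fix y assume y: "y \<in> {y. lt s c y (lg s c d)}"
    then have "\<not> lt s c (lg s c b) y" using d(3)[of y] lt_asym[OF c] by blast
    then show "y \<in> insert (lg s c b) {y. lt s c y (lg s c b)}"
      using y lt_total[OF c _ lg_X[OF c b(1)], of y] lt_X(1)[of c y] by auto
  qed
  then have "finite {y. lt s c y (lg s c d)}" using b(2) finite_subset by blast
  moreover have "(\<exists>p. ent c d p z) \<longleftrightarrow> z \<in> insert x F" for z using b(3)[of z] d(4) by blast
  ultimately show ?case using d(1) by blast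
qed

text \<open>A graph is used because the terms of definable predicates consist of variables and
  parameters only.\<close>

definition isPr :: "('f, 'r, 'a) ord_inst \<Rightarrow> ('f, 'r, 'a) ord_inst \<Rightarrow> ('a list \<Rightarrow> 'a list \<Rightarrow> 'a list) \<Rightarrow>
    'a list \<Rightarrow> 'a list \<Rightarrow> 'a list \<Rightarrow> bool" where
  "isPr a b Pr x y z \<longleftrightarrow> x \<in> X a \<and> y \<in> X b \<and> z = Pr x y"

lemma DP_isPr:
  assumes p: "is_pairing s a b c Pr" and t: "TM (ar a) t" and u: "TM (ar b) u" and w: "TM (ar c) w"
  shows "DP (\<lambda>e. isPr a b Pr (t e) (u e) (w e))"
proof -
  have "definable (vocp s) (M1p s) (ar a + ar b + ar c) {x @ y @ Pr x y | x y. x \<in> X a \<and> y \<in> X b}"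
    using p by (simp add: is_pairing_def)
  moreover have "TM (ar a + ar b + ar c) (\<lambda>e. t e @ u e @ w e)"
    using TM_append[OF TM_append[OF t u] w] by simp
  ultimately have "DP (\<lambda>e. t e @ u e @ w e \<in> {x @ y @ Pr x y | x y. x \<in> X a \<and> y \<in> X b})"
    by (rule DP_in_definable)
  then show ?thesis
  proof (rule DP_cong[THEN iffD1, rotated])
    fix e assume e: "env e"
    have len: "length (t e) = ar a" "length (u e) = ar b"
      using TM_tuples[OF t e] TM_tuples[OF u e] by (auto simp: tuples_def)
    have "length x = ar a" if "x \<in> X a" for x using that X_tuples by (auto simp: tuples_def)
    moreover have "length x = ar b" if "x \<in> X b" for x using that X_tuples by (auto simp: tuples_def)
    ultimately show "(t e @ u e @ w e \<in> {x @ y @ Pr x y | x y. x \<in> X a \<and> y \<in> X b}) =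
        isPr a b Pr (t e) (u e) (w e)"
      using len unfolding isPr_def mem_Collect_eq
      by (intro iffI; elim exE conjE) (simp, metis)
  qed
qed

lemma isPr_inj:
  assumes "is_pairing s a b c Pr" "isPr a b Pr x y z" "isPr a b Pr x' y' z"
  shows "x = x'" "y = y'"
proof -
  have "inj_on (\<lambda>(x, y). Pr x y) (X a \<times> X b)" using assms(1) by (simp add: is_pairing_def)
  then have "(x, y) = (x', y')" by (rule inj_onD) (use assms(2,3) in \<open>auto simp: isPr_def\<close>)
  then show "x = x'" "y = y'" by auto
qed

lemma Pr_X: "is_pairing s a b c Pr \<Longrightarrow> x \<in> X a \<Longrightarrow> y \<in> X b \<Longrightarrow> Pr x y \<in> X c"
  by (auto simp: is_pairing_def)

lemma isPr_ex: "is_pairing s a b c Pr \<Longrightarrow> z \<in> X c \<Longrightarrow> \<exists>x y. isPr a b Pr x y z"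
  by (auto simp: is_pairing_def isPr_def)

lemma isPr_X: "is_pairing s a b c Pr \<Longrightarrow> isPr a b Pr x y z \<Longrightarrow> x \<in> X a \<and> y \<in> X b \<and> z \<in> X c"
  using Pr_X by (auto simp: isPr_def)

end

section \<open>Families of binary relations and their indices\<close>

locale coding = spectrum s for s :: "('f, 'r, 'a) csp" +
  fixes a c c3 :: "('f, 'r, 'a) ord_inst" and Pr Pr3 :: "'a list \<Rightarrow> 'a list \<Rightarrow> 'a list"
  assumes a: "a \<in> nontrivial_orders s" and c: "c \<in> nontrivial_orders s" and c3: "c3 \<in> nontrivial_orders s"
    and pc: "is_pairing s a a c Pr" and pc3: "is_pairing s a c c3 Pr3"
begin

text \<open>A sequence \<open>b\<close> of triples \<open>(i, (x, y))\<close> is read as a family of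
  binary relations on \<open>X a\<close>, indexed by \<open>i\<close>.\<close>

definition mem :: "'a list \<Rightarrow> 'a list \<Rightarrow> 'a list \<Rightarrow> 'a list \<Rightarrow> bool" where
  "mem b i x y \<longleftrightarrow> (\<exists>w\<in>X c. \<exists>w3\<in>X c3. isPr a a Pr x y w \<and> isPr a c Pr3 i w w3 \<and> (\<exists>k\<in>X c3. ent c3 b k w3))"

definition rng :: "'a list \<Rightarrow> 'a list \<Rightarrow> 'a list \<Rightarrow> bool" where
  "rng e x y \<longleftrightarrow> (\<exists>w\<in>X c. isPr a a Pr x y w \<and> (\<exists>k\<in>X c. ent c e k w))"

text \<open>Up to \<open>n\<close>, every relation listed by some sequence of pairs has an index
  that is at most \<open>N\<close>. This is a definable counterpart of a power set indexed by
  elements of the order.\<close>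

definition codes :: "'a list \<Rightarrow> 'a list \<Rightarrow> 'a list \<Rightarrow> bool" where
  "codes b N n \<longleftrightarrow> (\<forall>e\<in>T c. \<exists>i\<in>X a. le s a i N \<and>
     (\<forall>x\<in>X a. \<forall>y\<in>X a. le s a x n \<and> le s a y n \<longrightarrow> (mem b i x y \<longleftrightarrow> rng e x y)))"

lemma DP_mem:
  assumes "TM (tar c3) b" "TM (ar a) i" "TM (ar a) t" "TM (ar a) u"
  shows "DP (\<lambda>e. mem (b e) (i e) (t e) (u e))"
  unfolding mem_def
  by (intro DP_intros DP_isPr[OF pc] DP_isPr[OF pc3] a c c3 TM_front TM_shift assms)

lemma DP_rng:
  assumes "TM (tar c) b" "TM (ar a) t" "TM (ar a) u"
  shows "DP (\<lambda>e. rng (b e) (t e) (u e))"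
  unfolding rng_def
  by (intro DP_intros DP_isPr[OF pc] a c TM_front TM_shift assms)

lemma DP_codes:
  assumes "TM (tar c3) b" "TM (ar a) t" "TM (ar a) u"
  shows "DP (\<lambda>e. codes (b e) (t e) (u e))"
  unfolding codes_def
  by (intro DP_intros DP_mem DP_rng a c TM_front TM_shift assms)

text \<open>Only finitely many pairs matter. Their subsets receive distinct indices below
  \<open>N\<close>, and the finite set of all triples formed from an index and a pair in its subset
  is listed by a member of the tree.\<close>

lemma ex_codes_finite:
  assumes N: "N \<in> X a" "infinite {x. lt s a x N}" and n: "n \<in> X a" "finite {x. lt s a x n}"
  shows "\<exists>b\<in>T c3. codes b N n"
proof -
  define F where "F = {x. le s a x n}"
  have "F \<subseteq> insert n {x. lt s a x n}" by (auto simp: F_def lt_def)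
  then have "finite F" using n(2) finite_subset by blast
  have FX: "F \<subseteq> X a" using le_X by (auto simp: F_def)
  define P where "P = (\<lambda>(x, y). Pr x y) ` (F \<times> F)"
  have "finite P" using \<open>finite F\<close> by (simp add: P_def)
  obtain B where B: "B \<subseteq> {x. lt s a x N}" "finite B" "card B = card (Pow P)"
    using infinite_arbitrarily_large[OF N(2)] by blast
  obtain j where "bij_betw j (Pow P) B"
    using finite_same_card_bij[of "Pow P" B] B(2,3) \<open>finite P\<close> by auto
  then have j: "j ` Pow P \<subseteq> {x. lt s a x N}" "inj_on j (Pow P)" using B(1) by (auto simp: bij_betw_def)
  have PX: "P \<subseteq> X c" using Pr_X[OF pc] FX by (auto simp: P_def)
  have jlt: "lt s a (j S) N" if "S \<subseteq> P" for S using j(1) that by auto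
  have jX: "j S \<in> X a" "le s a (j S) N" if "S \<subseteq> P" for S
    using lt_X(1)[OF jlt[OF that]] lt_imp_le[OF jlt[OF that]] by auto
  define G where "G = {Pr3 (j S) w | S w. S \<subseteq> P \<and> w \<in> S}"
  have "G \<subseteq> (\<lambda>(S, w). Pr3 (j S) w) ` (Pow P \<times> P)" by (auto simp: G_def)
  then have "finite G" using \<open>finite P\<close> finite_subset by blast
  moreover have "G \<subseteq> X c3"
  proof
    fix z assume "z \<in> G"
    then obtain S w where Sw: "z = Pr3 (j S) w" "S \<subseteq> P" "w \<in> S" by (auto simp: G_def)
    then show "z \<in> X c3" using Pr_X[OF pc3 jX(1)[OF Sw(2)], of w] PX by auto
  qed
  ultimately obtain b where b: "b \<in> T c3" "\<And>x. (\<exists>p. ent c3 b p x) \<longleftrightarrow> x \<in> G"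
    using ex_sequence_of_finite_set[OF c3, of G] by blast
  have "codes b N n" unfolding codes_def
  proof
    fix e assume e: "e \<in> T c"
    define S where "S = {w \<in> P. \<exists>k. ent c e k w}"
    have S: "S \<subseteq> P" by (auto simp: S_def)
    show "\<exists>i\<in>X a. le s a i N \<and>
     (\<forall>x\<in>X a. \<forall>y\<in>X a. le s a x n \<and> le s a y n \<longrightarrow> (mem b i x y \<longleftrightarrow> rng e x y))"
    proof (intro bexI[of _ "j S"] conjI ballI impI jX S)
      fix x y assume xy: "x \<in> X a" "y \<in> X a" "le s a x n \<and> le s a y n"
      define w where "w = Pr x y"
      have w: "w \<in> P" "w \<in> X c" using xy Pr_X[OF pc] by (auto simp: w_def F_def P_def)
      have w3: "Pr3 (j S) w \<in> X c3" using Pr_X[OF pc3 jX(1)[OF S] w(2)] .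
      have "mem b (j S) x y \<longleftrightarrow> (\<exists>k. ent c3 b k (Pr3 (j S) w))"
        unfolding mem_def isPr_def using w(2) w3 xy jX(1)[OF S] ent_X(1) by (auto simp: w_def)
      also have "\<dots> \<longleftrightarrow> Pr3 (j S) w \<in> G" by (rule b(2))
      also have "\<dots> \<longleftrightarrow> w \<in> S"
      proof
        assume "Pr3 (j S) w \<in> G"
        then obtain S' w' where *: "Pr3 (j S) w = Pr3 (j S') w'" "S' \<subseteq> P" "w' \<in> S'" by (auto simp: G_def)
        have "isPr a c Pr3 (j S) w (Pr3 (j S) w)" using jX(1)[OF S] w(2) by (simp add: isPr_def)
        moreover have "isPr a c Pr3 (j S') w' (Pr3 (j S) w)"
          using jX(1)[OF *(2)] * PX by (auto simp: isPr_def)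
        ultimately have "j S = j S'" "w = w'" using isPr_inj[OF pc3] by blast+
        then have "S = S'" using j(2) S *(2) by (auto dest: inj_onD)
        then show "w \<in> S" using * \<open>w = w'\<close> by simp
      next
        assume "w \<in> S"
        then show "Pr3 (j S) w \<in> G" using S unfolding G_def by blast
      qed
      also have "\<dots> \<longleftrightarrow> rng e x y"
        unfolding rng_def isPr_def S_def using w xy ent_X(1) by (auto simp: w_def)
      finally show "mem b (j S) x y \<longleftrightarrow> rng e x y" .
    qed
  qed
  then show ?thesis using b(1) by blast
qed

text \<open>Overspill: the set of \<open>n\<close> admitting a coding is definable and contains all \<open>n\<close> with finitely
  many predecessors.\<close>

lemma ex_codes:
  assumes N: "N \<in> X a" "infinite {x. lt s a x N}"
  shows "\<exists>n\<in>X a. le s a n N \<and> infinite {x. lt s a x n} \<and> (\<exists>b\<in>T c3. codes b N n)"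
proof (cases "\<exists>b\<in>T c3. codes b N N")
  case True
  then show ?thesis using N le_refl[OF a N(1)] by blast
next
  case False
  have "\<exists>n\<in>X a. (\<not> (\<exists>b\<in>T c3. codes b N n)) \<and>
      (\<forall>m\<in>X a. (\<not> (\<exists>b\<in>T c3. codes b N m)) \<longrightarrow> le s a n m)"
  proof (rule ex_greatest(2)[OF a N(1)])
    show "\<not> (\<exists>b\<in>T c3. codes b N N)" by (rule False)
  qed (intro DP_intros DP_codes c3 X_TM N TM_front TM_shift)
  then obtain n where n: "n \<in> X a" "\<not> (\<exists>b\<in>T c3. codes b N n)"
    "\<And>m. m \<in> X a \<Longrightarrow> \<not> (\<exists>b\<in>T c3. codes b N m) \<Longrightarrow> le s a n m" by blast
  have inf: "infinite {x. lt s a x n}" using ex_codes_finite[OF N n(1)] n(2) by blast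
  \<comment> \<open>The least failing position has infinitely many predecessors. One step back this
    is still so, and a coding exists there.\<close>
  then obtain x where "lt s a x n" using infinite_imp_nonempty by blast
  then obtain m where m: "lt s a m n" "\<And>w. lt s a w n \<Longrightarrow> le s a w m" using ex_pred[OF a] by blast
  have "{x. lt s a x n} \<subseteq> insert m {x. lt s a x m}" using m(2) by (auto simp: lt_def)
  then have "infinite {x. lt s a x m}" using inf finite_subset[of _ "insert m {x. lt s a x m}"] by blast
  moreover have "\<exists>b\<in>T c3. codes b N m" using n(3)[OF lt_X(1)[OF m(1)]] lt_asym[OF a m(1)] by blast
  moreover have "le s a m N"
    using le_trans[OF a lt_imp_le[OF m(1)] n(3)[OF N(1) False]] .
  ultimately show ?thesis using lt_X(1)[OF m(1)] by blast
qed

end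

section \<open>Gaps\<close>

context spectrum
begin

text \<open>The abstract \<open>prec\<close> covers an order and its reverse, so that the side of
  length \<open>lam\<close> can always be \<open>v\<close>. Only weak monotonicity is asked of
  \<open>w\<close> because the positions constructed in \<open>gap_of_positions\<close> may
  coincide.\<close>

definition gap :: "('f, 'r, 'a) ord_inst \<Rightarrow> ('a list \<Rightarrow> 'a list \<Rightarrow> bool) \<Rightarrow>
    'a list rel \<Rightarrow> ('a list \<Rightarrow> 'a list) \<Rightarrow> 'a list rel \<Rightarrow> ('a list \<Rightarrow> 'a list) \<Rightarrow> bool" where
  "gap a prec \<kappa>1 v \<kappa>2 w \<longleftrightarrow>
     (\<forall>i\<in>Field \<kappa>1. v i \<in> X a) \<and> (\<forall>j\<in>Field \<kappa>2. w j \<in> X a) \<and>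
     (\<forall>i i'. (i, i') \<in> \<kappa>1 \<and> i \<noteq> i' \<longrightarrow> prec (v i) (v i')) \<and>
     (\<forall>j j'. (j, j') \<in> \<kappa>2 \<longrightarrow> w j' = w j \<or> prec (w j') (w j)) \<and>
     (\<forall>i\<in>Field \<kappa>1. \<forall>j\<in>Field \<kappa>2. prec (v i) (w j)) \<and>
     (\<forall>x\<in>X a. (\<forall>i\<in>Field \<kappa>1. prec (v i) x) \<longrightarrow> (\<exists>j\<in>Field \<kappa>2. w j = x \<or> prec (w j) x))"

lemma gapD:
  assumes "gap a prec \<kappa>1 v \<kappa>2 w"
  shows "\<And>i. i \<in> Field \<kappa>1 \<Longrightarrow> v i \<in> X a" "\<And>j. j \<in> Field \<kappa>2 \<Longrightarrow> w j \<in> X a"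
    "\<And>i i'. (i, i') \<in> \<kappa>1 \<Longrightarrow> i \<noteq> i' \<Longrightarrow> prec (v i) (v i')"
    "\<And>j j'. (j, j') \<in> \<kappa>2 \<Longrightarrow> w j' = w j \<or> prec (w j') (w j)"
    "\<And>i j. i \<in> Field \<kappa>1 \<Longrightarrow> j \<in> Field \<kappa>2 \<Longrightarrow> prec (v i) (w j)"
    "\<And>x. x \<in> X a \<Longrightarrow> (\<And>i. i \<in> Field \<kappa>1 \<Longrightarrow> prec (v i) x) \<Longrightarrow> \<exists>j\<in>Field \<kappa>2. w j = x \<or> prec (w j) x"
  using assms unfolding gap_def by (elim conjE, simp)+

end

context minimal_cut
begin

lemma lam_wo: "Well_order lam" and lam_Card: "Card_order lam" and lam_infinite: "infinite (Field lam)"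
  using lam by (auto simp: cinfinite_def card_order_on_well_order_on)

lemma lam_underS: "i \<in> Field lam \<Longrightarrow> |underS lam i| <o lam"
  by (rule card_of_underS[OF lam_Card])

lemma lam_Field: "|Field lam| \<le>o lam"
  using card_of_Field_ordIso[OF lam_Card] by (rule ordIso_imp_ordLeq)

lemma lam_next: "i \<in> Field lam \<Longrightarrow> \<exists>j\<in>Field lam. (i, j) \<in> lam \<and> i \<noteq> j"
  using Cinfinite_no_last[OF lam, of i] FieldI2 by fast

lemma lam_total: "i \<in> Field lam \<Longrightarrow> j \<in> Field lam \<Longrightarrow> i \<noteq> j \<Longrightarrow> (i, j) \<in> lam \<or> (j, i) \<in> lam"
  using lam_wo by (auto simp: well_order_on_def linear_order_on_def total_on_def)

text \<open>The new gap consists of the positions in a tower listing \<open>v\<close>, and on the other side of the last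
  positions whose entry does not pass \<open>w j\<close>.\<close>

lemma gap_of_positions:
  assumes a: "a \<in> Or" and N: "N \<in> X a" "le s a N (bnd a)" "infinite {x. lt s a x N}"
    and dp: "drel a prec" and tp: "transp prec" and ir: "\<And>x. \<not> prec x x"
    and gap: "gap a prec lam v \<kappa> w" and ne: "Field \<kappa> \<noteq> {}"
  shows "\<exists>B A. gap a (lt s a) lam B \<kappa> A \<and> (\<forall>i\<in>Field lam. lt s a (B i) N) \<and> (\<forall>j\<in>Field \<kappa>. lt s a (A j) N)"
proof -
  note g = gapD[OF gap] and tr = transpD[OF tp]
  define EE where "EE i = {{x. prec x (v i)}}" for i
  have "\<exists>e k. e \<in> T a \<and> lt s a (lg s a e) N \<and> (\<forall>i\<in>Field lam. ent a e (k i) (v i)) \<and>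
     (\<forall>i j. (i, j) \<in> lam \<and> i \<noteq> j \<longrightarrow> lt s a (k i) (k j)) \<and>
     (\<forall>p q x y. ent a e p x \<and> ent a e q y \<and> lt s a p q \<longrightarrow> prec x y) \<and>
     (\<forall>i j p x E. (i, j) \<in> lam \<and> i \<noteq> j \<and> ent a e p x \<and> le s a p (k i) \<and> E \<in> EE j \<longrightarrow> x \<in> E)"
  proof (rule tower[OF a N lam_wo lam_underS lam_Field g(1) _ _ dp])
    show "|EE i| <o lam" for i by (rule card_of_finite_less) (simp add: EE_def)
    show "dset a E" if "i \<in> Field lam" "E \<in> EE i" for i E
      using that g(1) DP_drel[OF dp _ X_TM] by (auto simp: EE_def dset_def)
    show "v i \<in> E" if "(i, j) \<in> lam" "i \<noteq> j" "E \<in> EE j" for i j E using that g(3) by (simp add: EE_def)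
    show "x \<in> E" if "(i, j) \<in> lam" "i \<noteq> j" "\<And>E. E \<in> EE i \<Longrightarrow> x \<in> E" "E \<in> EE j" for i j x E
      using that(3,4) g(3)[OF that(1,2)] tr[of x "v i" "v j"] by (simp add: EE_def)
    show "prec x (v i)" if "\<And>E. E \<in> EE i \<Longrightarrow> x \<in> E" for i x using that by (simp add: EE_def)
  qed
  then obtain e k where e: "e \<in> T a" "lt s a (lg s a e) N" "\<And>i. i \<in> Field lam \<Longrightarrow> ent a e (k i) (v i)"
     "\<And>i j. (i, j) \<in> lam \<Longrightarrow> i \<noteq> j \<Longrightarrow> lt s a (k i) (k j)"
     "\<And>p q x y. ent a e p x \<Longrightarrow> ent a e q y \<Longrightarrow> lt s a p q \<Longrightarrow> prec x y" by metis
  have kX: "k i \<in> X a" if "i \<in> Field lam" for i using ent_X(1)[OF e(3)[OF that]] .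
  obtain i0 where i0: "i0 \<in> Field lam" using lam_infinite infinite_imp_nonempty by blast
  define Q where "Q j p \<longleftrightarrow> (\<exists>x\<in>X a. ent a e p x \<and> (x = w j \<or> prec x (w j)))" for j p
  have Qk: "Q j (k i)" if "i \<in> Field lam" "j \<in> Field \<kappa>" for i j
    unfolding Q_def using g(5)[OF that] e(3)[OF that(1)] g(1)[OF that(1)] by blast
  have "\<exists>p\<in>X a. Q j p \<and> (\<forall>q\<in>X a. Q j q \<longrightarrow> le s a q p)" if j: "j \<in> Field \<kappa>" for j
  proof (rule ex_greatest(1)[OF a kX[OF i0]])
    show "Q j (k i0)" by (rule Qk[OF i0 j])
    show "DP (\<lambda>e. Q j (front (ar a) e))" unfolding Q_def
      by (intro DP_intros DP_drel[OF dp] DP_eq[where k = "ar a"] a X_TM g(2)[OF j] T_TM e(1) TM_front TM_shift)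
  qed
  then obtain A where A: "\<And>j. j \<in> Field \<kappa> \<Longrightarrow> A j \<in> X a" "\<And>j. j \<in> Field \<kappa> \<Longrightarrow> Q j (A j)"
     "\<And>j q. j \<in> Field \<kappa> \<Longrightarrow> q \<in> X a \<Longrightarrow> Q j q \<Longrightarrow> le s a q (A j)" by metis
  have Alg: "lt s a (A j) (lg s a e)" if "j \<in> Field \<kappa>" for j
    using A(2)[OF that] ent_lt[OF a e(1)] by (auto simp: Q_def)
  have "gap a (lt s a) lam k \<kappa> A" unfolding gap_def
  proof (intro conjI ballI allI impI)
    fix i assume i: "i \<in> Field lam"
    show "k i \<in> X a" by (rule kX[OF i])
    fix j assume j: "j \<in> Field \<kappa>"
    obtain i' where i': "i' \<in> Field lam" "(i, i') \<in> lam" "i \<noteq> i'" using lam_next[OF i] by blast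
    show "lt s a (k i) (A j)"
      using lt_le_trans[OF a e(4)[OF i'(2,3)] A(3)[OF j kX[OF i'(1)] Qk[OF i'(1) j]]] .
  next
    fix j assume "j \<in> Field \<kappa>" then show "A j \<in> X a" by (rule A(1))
  next
    fix i i' assume "(i, i') \<in> lam \<and> i \<noteq> i'" then show "lt s a (k i) (k i')" using e(4) by blast
  next
    fix j j' assume jj: "(j, j') \<in> \<kappa>"
    then have F: "j \<in> Field \<kappa>" "j' \<in> Field \<kappa>" by (auto simp: Field_def)
    obtain x where x: "x \<in> X a" "ent a e (A j') x" "x = w j' \<or> prec x (w j')"
      using A(2)[OF F(2)] by (auto simp: Q_def)
    have "x = w j \<or> prec x (w j)" using x(3) g(4)[OF jj] tr[of x "w j'" "w j"] by auto
    then have "Q j (A j')" unfolding Q_def using x by blast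
    then have "le s a (A j') (A j)" using A(3)[OF F(1) A(1)[OF F(2)]] by blast
    then show "A j' = A j \<or> lt s a (A j') (A j)" by (auto simp: lt_def)
  next
    fix x assume x: "x \<in> X a" "\<forall>i\<in>Field lam. lt s a (k i) x"
    show "\<exists>j\<in>Field \<kappa>. A j = x \<or> lt s a (A j) x"
    proof (cases "lt s a x (lg s a e)")
      case False
      then have "le s a (lg s a e) x" using not_lt[OF a x(1) lg_X[OF a e(1)]] by blast
      moreover obtain j where j: "j \<in> Field \<kappa>" using ne by blast
      ultimately have "lt s a (A j) x" using lt_le_trans[OF a Alg] by blast
      then show ?thesis using j by blast
    next
      case True
      \<comment> \<open>The entry \<open>y'\<close> at the predecessor of \<open>x\<close> still
        comes after every \<open>v i\<close>, so some \<open>w j\<close> is at most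
        \<open>y'\<close> and thus strictly before the entry \<open>y\<close> at \<open>x\<close>.
        This strictness puts \<open>A j\<close> before \<open>x\<close>.\<close>
      obtain x' where x': "lt s a x' x" "\<And>u. lt s a u x \<Longrightarrow> le s a u x'"
        using ex_pred[OF a] x(2) i0 by blast
      have kx': "lt s a (k i) x'" if i: "i \<in> Field lam" for i
      proof -
        obtain i' where i': "i' \<in> Field lam" "(i, i') \<in> lam" "i \<noteq> i'" using lam_next[OF i] by blast
        show ?thesis using lt_le_trans[OF a e(4)[OF i'(2,3)] x'(2)] x(2) i'(1) by blast
      qed
      obtain y where y: "ent a e x y" using ent_ex[OF a e(1) True] by blast
      obtain y' where y': "ent a e x' y'" using ent_ex[OF a e(1) lt_trans[OF a x'(1) True]] by blast
      have "prec y' y" by (rule e(5)[OF y' y x'(1)])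
      have "prec (v i) y'" if "i \<in> Field lam" for i by (rule e(5)[OF e(3)[OF that] y' kx'[OF that]])
      then obtain j where j: "j \<in> Field \<kappa>" "w j = y' \<or> prec (w j) y'" using g(6)[OF ent_X(2)[OF y']] by blast
      then have wy: "prec (w j) y" using tr[of "w j" y' y] \<open>prec y' y\<close> by auto
      obtain z where z: "ent a e (A j) z" "z = w j \<or> prec z (w j)" using A(2)[OF j(1)] by (auto simp: Q_def)
      then have zy: "prec z y" using tr[of z "w j" y] wy by auto
      have "\<not> lt s a x (A j)"
      proof
        assume "lt s a x (A j)"
        then have "prec y z" by (rule e(5)[OF y z(1)])
        then show False using tr[OF zy] ir by blast
      qed
      moreover have "x \<noteq> A j"
        using ent_unique[OF a e(1) y] z(1) zy ir by auto
      ultimately have "lt s a (A j) x" using lt_total[OF a x(1) A(1)[OF j(1)]] by blast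
      then show ?thesis using j(1) by blast
    qed
  qed
  moreover have "lt s a (k i) N" if "i \<in> Field lam" for i
    using lt_trans[OF a ent_lt[OF a e(1) e(3)[OF that]] e(2)] .
  moreover have "lt s a (A j) N" if "j \<in> Field \<kappa>" for j using lt_trans[OF a Alg[OF that] e(2)] .
  ultimately show ?thesis by blast
qed

section \<open>Gaps with two sides of length \<open>lam\<close>\<close>

lemma no_symmetric_gap:
  assumes a: "a \<in> Or"
    and dp: "drel a prec" and tp: "transp prec" and ir: "\<And>x. \<not> prec x x"
    and gap: "gap a prec lam v lam w"
  shows False
proof -
  note g = gapD[OF gap] and tr = transpD[OF tp]
  obtain c Pr where c: "c \<in> Or" and pc: "is_pairing s a a c Pr"
    using products a unfolding has_products_def by blast
  define pq where "pq = isPr a a Pr"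
  define weak where "weak x y \<longleftrightarrow> x = y \<or> prec x y" for x y
  have dw: "DP (\<lambda>e. weak (t e) (u e))" if "TM (ar a) t" "TM (ar a) u" for t u
    unfolding weak_def by (intro DP_intros DP_eq[where k = "ar a"] that DP_drel[OF dp])
  \<comment> \<open>These are the pairs that may come before the pair of stage \<open>i\<close>. The
    condition weakens as \<open>i\<close> grows, which is what \<open>tower\<close> asks of its
    constraints.\<close>
  define E where "E i = {z. \<exists>x\<in>X a. \<exists>y\<in>X a. pq x y z \<and> prec x (v i) \<and> weak (w i) y \<and> prec x y}" for i
  define EE where "EE i = {E i}" for i
  define V where "V i = Pr (v i) (w i)" for i
  \<comment> \<open>The clause \<open>prec x' y'\<close> on the later pair ensures that the
    components of the last entry are in the right order.\<close>
  define R where "R z z' \<longleftrightarrow> (\<exists>x\<in>X a. \<exists>y\<in>X a. \<exists>x'\<in>X a. \<exists>y'\<in>X a. pq x y z \<and> pq x' y' z' \<and>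
      prec x x' \<and> weak y' y \<and> prec x' y')" for z z'
  have V: "pq (v i) (w i) (V i)" if "i \<in> Field lam" for i
    using g(1,2)[OF that] by (simp add: pq_def isPr_def V_def)
  have dR: "drel c R" unfolding drel_def R_def pq_def
    by (intro allI impI DP_intros DP_isPr[OF pc] dw DP_drel[OF dp] a TM_front TM_shift)
  have F: "i \<in> Field lam" "j \<in> Field lam" if "(i, j) \<in> lam" for i j using that by (auto simp: Field_def)
  have "\<exists>e k. e \<in> T c \<and> lt s c (lg s c e) (bnd c) \<and> (\<forall>i\<in>Field lam. ent c e (k i) (V i)) \<and>
     (\<forall>i j. (i, j) \<in> lam \<and> i \<noteq> j \<longrightarrow> lt s c (k i) (k j)) \<and>
     (\<forall>p q x y. ent c e p x \<and> ent c e q y \<and> lt s c p q \<longrightarrow> R x y) \<and>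
     (\<forall>i j p x E. (i, j) \<in> lam \<and> i \<noteq> j \<and> ent c e p x \<and> le s c p (k i) \<and> E \<in> EE j \<longrightarrow> x \<in> E)"
  proof (rule tower[OF c OrD(3)[OF c] le_refl[OF c OrD(3)[OF c]] OrD(4)[OF c] lam_wo lam_underS lam_Field _ _ _ dR])
    show "V i \<in> X c" if "i \<in> Field lam" for i using Pr_X[OF pc g(1)[OF that] g(2)[OF that]] by (simp add: V_def)
    show "|EE i| <o lam" for i by (rule card_of_finite_less) (simp add: EE_def)
    show "dset c G" if "i \<in> Field lam" "G \<in> EE i" for i G
    proof -
      have "dset c (E i)" unfolding dset_def E_def pq_def mem_Collect_eq
        by (intro allI impI DP_intros DP_isPr[OF pc] dw DP_drel[OF dp] a X_TM g(1,2) that(1) TM_front TM_shift)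
      then show ?thesis using that(2) by (simp add: EE_def)
    qed
    show "V i \<in> G" if ij: "(i, j) \<in> lam" "i \<noteq> j" "G \<in> EE j" for i j G
    proof -
      have "weak (w j) (w i)" using g(4)[OF ij(1)] by (auto simp: weak_def)
      then have "V i \<in> E j" unfolding E_def
        using V[OF F(1)[OF ij(1)]] g(3)[OF ij(1,2)] g(5)[OF F(1)[OF ij(1)] F(1)[OF ij(1)]] g(1,2)[OF F(1)[OF ij(1)]]
        by blast
      then show ?thesis using ij(3) by (simp add: EE_def)
    qed
    show "z \<in> G" if ij: "(i, j) \<in> lam" "i \<noteq> j" "\<And>E. E \<in> EE i \<Longrightarrow> z \<in> E" "G \<in> EE j" for i j z G
    proof -
      have "z \<in> E i" using ij(3) by (simp add: EE_def)
      then obtain x y where xy: "x \<in> X a" "y \<in> X a" "pq x y z" "prec x (v i)" "weak (w i) y" "prec x y"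
        by (auto simp: E_def)
      have "weak (w j) y" using xy(5) g(4)[OF ij(1)] tr[of "w j" "w i" y] by (auto simp: weak_def)
      then have "z \<in> E j" unfolding E_def using xy tr[OF xy(4) g(3)[OF ij(1,2)]] by blast
      then show ?thesis using ij(4) by (simp add: EE_def)
    qed
    show "R z (V i)" if i: "i \<in> Field lam" and "\<And>E. E \<in> EE i \<Longrightarrow> z \<in> E" for i z
    proof -
      have "z \<in> E i" using that(2) by (simp add: EE_def)
      then obtain x y where xy: "x \<in> X a" "y \<in> X a" "pq x y z" "prec x (v i)" "weak (w i) y" "prec x y"
        by (auto simp: E_def)
      then show ?thesis unfolding R_def using V[OF i] g(1,2)[OF i] g(5)[OF i i] by blast
    qed
  qed
  then obtain e k where e: "e \<in> T c" "\<And>i. i \<in> Field lam \<Longrightarrow> ent c e (k i) (V i)"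
     "\<And>i j. (i, j) \<in> lam \<Longrightarrow> i \<noteq> j \<Longrightarrow> lt s c (k i) (k j)"
     "\<And>p q x y. ent c e p x \<Longrightarrow> ent c e q y \<Longrightarrow> lt s c p q \<Longrightarrow> R x y" by metis
  obtain i0 where i0: "i0 \<in> Field lam" using lam_infinite infinite_imp_nonempty by blast
  \<comment> \<open>Since \<open>lam\<close> has no last index, the last position of
    \<open>e\<close> lies strictly beyond all \<open>k i\<close>.\<close>
  obtain n where n: "lt s c n (lg s c e)" "\<And>u. lt s c u (lg s c e) \<Longrightarrow> le s c u n"
    using ex_pred[OF c ent_lt[OF c e(1) e(2)[OF i0]]] by blast
  obtain z where z: "ent c e n z" using ent_ex[OF c e(1) n(1)] by blast
  have Rz: "R (V i) z" if i: "i \<in> Field lam" for i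
  proof -
    obtain i' where i': "i' \<in> Field lam" "(i, i') \<in> lam" "i \<noteq> i'" using lam_next[OF i] by blast
    have "lt s c (k i) n"
      using lt_le_trans[OF c e(3)[OF i'(2,3)] n(2)[OF ent_lt[OF c e(1) e(2)[OF i'(1)]]]] .
    then show ?thesis by (rule e(4)[OF e(2)[OF i] z])
  qed
  obtain x y where xy: "x \<in> X a" "y \<in> X a" "pq x y z" using Rz[OF i0] unfolding R_def by blast
  have xyi: "prec (v i) x" "weak y (w i)" "prec x y" if i: "i \<in> Field lam" for i
  proof -
    obtain x1 y1 x2 y2 where 1: "pq x1 y1 (V i)" "pq x2 y2 z" "prec x1 x2" "weak y2 y1" "prec x2 y2"
      using Rz[OF i] unfolding R_def by blast
    have "x1 = v i" "y1 = w i" "x2 = x" "y2 = y"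
      using isPr_inj[OF pc] 1(1,2) V[OF i] xy(3) unfolding pq_def by blast+
    then show "prec (v i) x" "weak y (w i)" "prec x y" using 1 by auto
  qed
  \<comment> \<open>A cycle arises: \<open>w j\<close> is at most \<open>x\<close>, which is before
    \<open>y\<close>, which is at most \<open>w j\<close>.\<close>
  obtain j where j: "j \<in> Field lam" "w j = x \<or> prec (w j) x" using g(6)[OF xy(1) xyi(1)] by blast
  then have "prec (w j) y" using xyi(3)[OF i0] tr[of "w j" x y] by auto
  then show False using xyi(2)[OF j(1)] tr[of y "w j" y] tr ir unfolding weak_def by blast
qed

end

section \<open>Gaps with a shorter second side\<close>

locale coded_cut = minimal_cut s lam + coding s a c c3 Pr Pr3
  for s :: "('f, 'r, 'a) csp" and lam a c c3 Pr Pr3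
begin

text \<open>Through \<open>b1\<close>, \<open>d\<close> is a set of pairs of an argument and a code;
  through \<open>b0\<close>, a code is a relation that plays the role of a function. For two pairs
  in \<open>d\<close>, the function belonging to the larger argument takes only values at least
  \<open>t\<close> at the smaller argument.\<close>

definition sep :: "'a list \<Rightarrow> 'a list \<Rightarrow> 'a list \<Rightarrow> 'a list \<Rightarrow> 'a list \<Rightarrow> 'a list \<Rightarrow> bool" where
  "sep b0 b1 N0 N1 d t \<longleftrightarrow>
     (\<forall>p\<in>X a. \<forall>q\<in>X a. \<forall>p'\<in>X a. \<forall>q'\<in>X a. \<forall>v\<in>X a.
        le s a p N1 \<and> le s a q N1 \<and> le s a p' N1 \<and> le s a q' N1 \<and> le s a v N0 \<and>
        mem b1 d p q \<and> mem b1 d p' q' \<and> lt s a p p' \<and> mem b0 q' p v \<longrightarrow> le s a t v)"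

lemma DP_sep:
  assumes "b0 \<in> T c3" "b1 \<in> T c3" "N0 \<in> X a" "N1 \<in> X a" "TM (ar a) d" "TM (ar a) t"
  shows "DP (\<lambda>e. sep b0 b1 N0 N1 (d e) (t e))"
  unfolding sep_def
  by (intro DP_intros DP_mem a T_TM[OF assms(1)] T_TM[OF assms(2)] X_TM[OF assms(3)] X_TM[OF assms(4)]
      TM_front TM_shift assms(5,6))

lemma codesD:
  assumes "codes b N n" "e \<in> T c"
  shows "\<exists>i\<in>X a. le s a i N \<and> (\<forall>x y. le s a x n \<and> le s a y n \<longrightarrow> (mem b i x y \<longleftrightarrow> rng e x y))"
proof -
  obtain i where i: "i \<in> X a" "le s a i N"
    "\<forall>x\<in>X a. \<forall>y\<in>X a. le s a x n \<and> le s a y n \<longrightarrow> (mem b i x y \<longleftrightarrow> rng e x y)"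
    using assms unfolding codes_def by blast
  have "mem b i x y \<longleftrightarrow> rng e x y" if "le s a x n \<and> le s a y n" for x y
    using i(3) that le_X(1)[of a x n] le_X(1)[of a y n] by auto
  then show ?thesis using i(1,2) by blast
qed

lemma rng_iff:
  assumes "e \<in> T c"
  shows "rng e x y \<longleftrightarrow> (\<exists>w p. isPr a a Pr x y w \<and> ent c e p w)"
proof
  assume "rng e x y"
  then show "\<exists>w p. isPr a a Pr x y w \<and> ent c e p w" unfolding rng_def by blast
next
  assume "\<exists>w p. isPr a a Pr x y w \<and> ent c e p w"
  then obtain w p where "isPr a a Pr x y w" "ent c e p w" by blast
  then show "rng e x y" unfolding rng_def using ent_X[of c e p w] by blast
qed

text \<open>If this initial segment had size at most \<open>\<kappa>\<close>, the first index
  outside it would have at most \<open>\<kappa>\<close> many indices up to itself and would belong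
  to the segment.\<close>

lemma ex_large_initial_segment:
  assumes "Cinfinite \<kappa>" "\<kappa> <o lam"
  shows "\<not> |{j \<in> Field lam. |under lam j| \<le>o \<kappa>}| \<le>o \<kappa>"
proof
  let ?I = "{j \<in> Field lam. |under lam j| \<le>o \<kappa>}"
  assume I: "|?I| \<le>o \<kappa>"
  have "Field lam - ?I \<noteq> {}"
  proof
    assume "Field lam - ?I = {}"
    then have "Field lam \<subseteq> ?I" by blast
    then have "|Field lam| \<le>o |?I|" by (rule card_of_mono1)
    then have "|Field lam| \<le>o \<kappa>" using I by (rule ordLeq_transitive)
    then have "lam \<le>o \<kappa>"
      by (rule ordIso_ordLeq_trans[OF ordIso_symmetric[OF card_of_Field_ordIso[OF lam_Card]]])
    then show False using not_ordLess_ordLeq[OF assms(2)] by simp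
  qed
  have "wf (lam - Id)" using lam_wo by (simp add: well_order_on_def)
  from wfE_min'[OF this \<open>Field lam - ?I \<noteq> {}\<close>]
  obtain j where j': "j \<in> Field lam - ?I" "\<And>i. (i, j) \<in> lam - Id \<Longrightarrow> i \<notin> Field lam - ?I"
    by blast
  then have j: "j \<in> Field lam" "j \<notin> ?I" by auto
  have "under lam j \<subseteq> {j} \<union> ?I"
  proof
    fix i assume "i \<in> under lam j"
    then have ij: "(i, j) \<in> lam" "i \<in> Field lam" by (auto simp: under_def Field_def)
    then show "i \<in> {j} \<union> ?I" using j'(2)[of i] by auto
  qed
  then have "|under lam j| \<le>o |{j} \<union> ?I|" by (rule card_of_mono1)
  moreover have "|{j} \<union> ?I| \<le>o \<kappa>"
  proof (rule card_of_Un_ordLeq_infinite_Field)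
    show "infinite (Field \<kappa>)" "Card_order \<kappa>" using assms(1) by (auto simp: cinfinite_def)
    show "|{j}| \<le>o \<kappa>"
      using assms(1) finite_ordLess_infinite[OF card_of_Well_order, of \<kappa> "{j}"]
      by (intro ordLess_imp_ordLeq) (simp add: cinfinite_def Field_card_of card_order_on_well_order_on)
    show "|?I| \<le>o \<kappa>" by (rule I)
  qed
  ultimately have "|under lam j| \<le>o \<kappa>" by (rule ordLeq_transitive)
  then show False using j(1,2) by simp
qed

lemma card_of_under_less: "i \<in> Field lam \<Longrightarrow> |under lam i| <o lam"
proof -
  assume i: "i \<in> Field lam"
  have "under lam i \<subseteq> {i} \<union> underS lam i" by (auto simp: under_def underS_def)
  then have "|under lam i| \<le>o |{i} \<union> underS lam i|" by (rule card_of_mono1)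
  also have "|{i} \<union> underS lam i| <o lam"
    by (rule card_of_Un_less[OF card_of_finite_less lam_underS[OF i]]) simp
  finally show ?thesis .
qed

text \<open>
  Write \<open>B\<close> and \<open>A\<close> for the two sides of the gap, of lengths \<open>lam\<close> and \<open>\<kappa> < lam\<close>. For \<open>\<beta>\<close> in an
  initial segment \<open>I\<close> of \<open>lam\<close> of cardinality greater than \<open>\<kappa>\<close> whose proper initial segments inject
  into \<open>\<kappa>\<close> by \<open>h \<beta>\<close>, the element \<open>q \<beta>\<close> codes a function sending \<open>B \<gamma>\<close> to \<open>A (h \<beta> \<gamma>)\<close> for
  \<open>\<gamma> \<le> \<beta>\<close>. A tower of length \<open>lam\<close> lists pairs \<open>(B i, D i)\<close> where \<open>D i\<close> codes a set that contains
  \<open>(B \<beta>, q \<beta>)\<close> for \<open>\<beta> \<le> i\<close> in \<open>I\<close> and on which the coded functions take values above \<open>B i\<close>. Past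
  the tower, the bound of a pair \<open>(t, D)\<close> exceeds some \<open>A \<epsilon>\<close>, yet by the pigeonhole principle \<open>D\<close>
  still contains more than \<open>\<kappa>\<close> many \<open>(B \<beta>, q \<beta>)\<close>, so that \<open>h \<beta>\<close> is bounded in \<open>\<kappa>\<close> on too large a
  set.
\<close>

lemma no_asymmetric_gap_aux:
  assumes \<kappa>: "Cinfinite \<kappa>" "\<kappa> <o lam"
    and N: "N0 \<in> X a" "N1 \<in> X a" "le s a N0 N1"
    and b0: "b0 \<in> T c3" "codes b0 N1 N0" and b1: "b1 \<in> T c3" "codes b1 (bnd a) N1"
    and gap: "gap a (lt s a) lam B \<kappa> A"
    and BN: "\<And>i. i \<in> Field lam \<Longrightarrow> le s a (B i) N0" and AN: "\<And>j. j \<in> Field \<kappa> \<Longrightarrow> le s a (A j) N0"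
  shows False
proof -
  note g = gapD[OF gap]
  note nl = lt_asym[OF a]
  have BN1: "le s a (B i) N1" if "i \<in> Field lam" for i using le_trans[OF a BN[OF that] N(3)] .
  have F: "i \<in> Field lam" "j \<in> Field lam" if "(i, j) \<in> lam" for i j using that by (auto simp: Field_def)
  have lamrefl: "(i, i) \<in> lam" if "i \<in> Field lam" for i
    using lam_wo that by (auto simp: well_order_on_def linear_order_on_def partial_order_on_def preorder_on_def refl_on_def)
  have Bmono: "le s a (B i) (B j)" if "(i, j) \<in> lam" for i j
    using g(3)[OF that] le_refl[OF a g(1)[OF F(1)[OF that]]] lt_imp_le by (cases "i = j") auto
  have Blt: "(i, j) \<in> lam" if "lt s a (B i) (B j)" "i \<in> Field lam" "j \<in> Field lam" for i j
    using lam_total[OF that(2,3)] Bmono[of j i] nl[OF that(1)] lamrefl[OF that(2)] by auto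
  have Ble: "(i, j) \<in> lam" if "le s a (B i) (B j)" "i \<in> Field lam" "j \<in> Field lam" for i j
    using lam_total[OF that(2,3)] g(3)[of j i] nl[OF _ that(1)] lamrefl[OF that(2)] by (cases "i = j") auto
  define I where "I = {j \<in> Field lam. |under lam j| \<le>o \<kappa>}"
  have IF: "i \<in> Field lam" if "i \<in> I" for i using that by (simp add: I_def)
  have Ibig: "\<not> |I| \<le>o \<kappa>" unfolding I_def by (rule ex_large_initial_segment[OF \<kappa>])
  have "\<forall>\<beta>\<in>I. \<exists>h. inj_on h (under lam \<beta>) \<and> h ` under lam \<beta> \<subseteq> Field \<kappa>"
  proof
    fix \<beta> assume "\<beta> \<in> I"
    then have "|under lam \<beta>| \<le>o \<kappa>" by (simp add: I_def)
    also have "\<kappa> =o |Field \<kappa>|" using \<kappa>(1) card_of_Field_ordIso ordIso_symmetric by auto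
    finally show "\<exists>h. inj_on h (under lam \<beta>) \<and> h ` under lam \<beta> \<subseteq> Field \<kappa>"
      by (simp add: card_of_ordLeq)
  qed
  from bchoice[OF this] obtain h where
    h0: "\<forall>\<beta>\<in>I. inj_on (h \<beta>) (under lam \<beta>) \<and> h \<beta> ` under lam \<beta> \<subseteq> Field \<kappa>" ..
  have h: "inj_on (h \<beta>) (under lam \<beta>)" if "\<beta> \<in> I" for \<beta> using h0 that by simp
  have hF: "h \<beta> \<gamma> \<in> Field \<kappa>" if "\<beta> \<in> I" "(\<gamma>, \<beta>) \<in> lam" for \<beta> \<gamma>
    using h0 that by (auto simp: under_def)
  have "\<forall>\<beta>\<in>I. \<exists>q\<in>X a. le s a q N1 \<and> (\<forall>\<gamma>. (\<gamma>, \<beta>) \<in> lam \<longrightarrow> mem b0 q (B \<gamma>) (A (h \<beta> \<gamma>)) \<and>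
      (\<forall>y. le s a y N0 \<and> mem b0 q (B \<gamma>) y \<longrightarrow> y = A (h \<beta> \<gamma>)))"
  proof
    fix \<beta> assume \<beta>: "\<beta> \<in> I"
    \<comment> \<open>Being single-valued is a symmetric and reflexive condition on pairs. The
      covering sequence is therefore the graph of a function that extends the prescribed
      one.\<close>
    define R where "R z z' \<longleftrightarrow> (\<forall>x\<in>X a. \<forall>y\<in>X a. \<forall>y'\<in>X a.
        isPr a a Pr x y z \<and> isPr a a Pr x y' z' \<longrightarrow> y = y')" for z z'
    have AX: "A (h \<beta> \<gamma>) \<in> X a" "le s a (A (h \<beta> \<gamma>)) N0" if "(\<gamma>, \<beta>) \<in> lam" for \<gamma>
      using g(2)[OF hF[OF \<beta> that]] AN[OF hF[OF \<beta> that]] by auto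
    define S where "S = (\<lambda>\<gamma>. Pr (B \<gamma>) (A (h \<beta> \<gamma>))) ` under lam \<beta>"
    have isS: "isPr a a Pr (B \<gamma>) (A (h \<beta> \<gamma>)) (Pr (B \<gamma>) (A (h \<beta> \<gamma>)))" if "(\<gamma>, \<beta>) \<in> lam" for \<gamma>
      using g(1)[OF F(1)[OF that]] AX[OF that] by (simp add: isPr_def)
    have "\<exists>e\<in>T c. (\<forall>x\<in>S. \<exists>p. ent c e p x) \<and> (\<forall>p q x y. ent c e p x \<longrightarrow> ent c e q y \<longrightarrow> R x y)"
    proof (rule cover[OF c])
      show "S \<subseteq> X c" using isS isPr_X[OF pc] by (auto simp: S_def under_def)
      show "|S| <o lam" unfolding S_def
        using card_of_image card_of_under_less[OF IF[OF \<beta>]] by (rule ordLeq_ordLess_trans)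
      show "drel c R" unfolding drel_def R_def
        by (intro allI impI DP_intros DP_isPr[OF pc] DP_eq[where k = "ar a"] a TM_front TM_shift)
      show "R y x" if "R x y" for x y using that unfolding R_def by metis
      show "R x x" for x unfolding R_def using isPr_inj(2)[OF pc] by blast
      show "R z z'" if "z \<in> S" "z' \<in> S" for z z'
        unfolding R_def
      proof (intro ballI impI, elim conjE)
        fix x y y' assume xy: "isPr a a Pr x y z" "isPr a a Pr x y' z'"
        obtain \<gamma> \<gamma>' where \<gamma>: "(\<gamma>, \<beta>) \<in> lam" "z = Pr (B \<gamma>) (A (h \<beta> \<gamma>))"
          "(\<gamma>', \<beta>) \<in> lam" "z' = Pr (B \<gamma>') (A (h \<beta> \<gamma>'))"
          using \<open>z \<in> S\<close> \<open>z' \<in> S\<close> by (auto simp: S_def under_def)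
        have eq: "x = B \<gamma>" "y = A (h \<beta> \<gamma>)" "x = B \<gamma>'" "y' = A (h \<beta> \<gamma>')"
          using isPr_inj[OF pc xy(1)[unfolded \<gamma>(2)] isS[OF \<gamma>(1)]]
            isPr_inj[OF pc xy(2)[unfolded \<gamma>(4)] isS[OF \<gamma>(3)]] by auto
        have "\<gamma> = \<gamma>'"
          using lam_total[OF F(1)[OF \<gamma>(1)] F(1)[OF \<gamma>(3)]] g(3)[of \<gamma> \<gamma>'] g(3)[of \<gamma>' \<gamma>] eq lt_irrefl by metis
        then show "y = y'" using eq by simp
      qed
    qed
    then obtain e where e: "e \<in> T c" "\<And>x. x \<in> S \<Longrightarrow> \<exists>p. ent c e p x"
      "\<And>p q x y. ent c e p x \<Longrightarrow> ent c e q y \<Longrightarrow> R x y" by blast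
    \<comment> \<open>The code agrees with the sequence only below \<open>N0\<close>; all arguments
      \<open>B \<gamma>\<close> and values \<open>A (h \<beta> \<gamma>)\<close> lie there.\<close>
    obtain q where q: "q \<in> X a" "le s a q N1"
      "\<And>x y. le s a x N0 \<Longrightarrow> le s a y N0 \<Longrightarrow> mem b0 q x y \<longleftrightarrow> rng e x y"
      using codesD[OF b0(2) e(1)] by blast
    show "\<exists>q\<in>X a. le s a q N1 \<and> (\<forall>\<gamma>. (\<gamma>, \<beta>) \<in> lam \<longrightarrow> mem b0 q (B \<gamma>) (A (h \<beta> \<gamma>)) \<and>
      (\<forall>y. le s a y N0 \<and> mem b0 q (B \<gamma>) y \<longrightarrow> y = A (h \<beta> \<gamma>)))"
    proof (intro bexI[of _ q] conjI allI impI q(1,2))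
      fix \<gamma> assume \<gamma>: "(\<gamma>, \<beta>) \<in> lam"
      note B\<gamma> = BN[OF F(1)[OF \<gamma>]]
      have "Pr (B \<gamma>) (A (h \<beta> \<gamma>)) \<in> S" using \<gamma> by (simp add: S_def under_def)
      then obtain p where p: "ent c e p (Pr (B \<gamma>) (A (h \<beta> \<gamma>)))" using e(2) by blast
      then have "rng e (B \<gamma>) (A (h \<beta> \<gamma>))" using isS[OF \<gamma>] rng_iff[OF e(1)] by blast
      then show "mem b0 q (B \<gamma>) (A (h \<beta> \<gamma>))" using q(3)[OF B\<gamma> AX(2)[OF \<gamma>]] by simp
      fix y assume y: "le s a y N0 \<and> mem b0 q (B \<gamma>) y"
      then have "rng e (B \<gamma>) y" using q(3)[OF B\<gamma>, of y] by simp
      then obtain w p' where w: "isPr a a Pr (B \<gamma>) y w" "ent c e p' w" using rng_iff[OF e(1)] by blast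
      have "R w (Pr (B \<gamma>) (A (h \<beta> \<gamma>)))" by (rule e(3)[OF w(2) p])
      then show "y = A (h \<beta> \<gamma>)"
        unfolding R_def using w(1) isS[OF \<gamma>] AX(1)[OF \<gamma>] isPr_X[OF pc w(1)] by blast
    qed
  qed
  then obtain q where q: "\<And>\<beta>. \<beta> \<in> I \<Longrightarrow> q \<beta> \<in> X a" "\<And>\<beta>. \<beta> \<in> I \<Longrightarrow> le s a (q \<beta>) N1"
    "\<And>\<beta> \<gamma>. \<beta> \<in> I \<Longrightarrow> (\<gamma>, \<beta>) \<in> lam \<Longrightarrow> mem b0 (q \<beta>) (B \<gamma>) (A (h \<beta> \<gamma>))"
    "\<And>\<beta> \<gamma> y. \<beta> \<in> I \<Longrightarrow> (\<gamma>, \<beta>) \<in> lam \<Longrightarrow> le s a y N0 \<Longrightarrow> mem b0 (q \<beta>) (B \<gamma>) y \<Longrightarrow> y = A (h \<beta> \<gamma>)"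
    by metis
  have "\<forall>i\<in>Field lam. \<exists>D\<in>X a. (\<forall>\<beta>\<in>I. (\<beta>, i) \<in> lam \<longrightarrow> mem b1 D (B \<beta>) (q \<beta>)) \<and> sep b0 b1 N0 N1 D (B i)"
  proof
    fix i assume i: "i \<in> Field lam"
    \<comment> \<open>The condition of \<open>sep\<close> with threshold \<open>B i\<close>,
      restricted to two given pairs. It holds for the pairs in \<open>S\<close> because the values
      concerned are of the form \<open>A (h \<beta>' \<beta>)\<close> and lie across the gap from
      \<open>B i\<close>. \<open>R\<close> is its symmetric form, as \<open>cover\<close>
      requires.\<close>
    define R0 where "R0 z z' \<longleftrightarrow> (\<forall>p\<in>X a. \<forall>q\<in>X a. \<forall>p'\<in>X a. \<forall>q'\<in>X a. \<forall>v\<in>X a.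
        isPr a a Pr p q z \<and> isPr a a Pr p' q' z' \<and> le s a v N0 \<and> lt s a p p' \<and> mem b0 q' p v \<longrightarrow> le s a (B i) v)"
      for z z'
    define R where "R z z' \<longleftrightarrow> R0 z z' \<and> R0 z' z" for z z'
    define S where "S = (\<lambda>\<beta>. Pr (B \<beta>) (q \<beta>)) ` (under lam i \<inter> I)"
    have isS: "isPr a a Pr (B \<beta>) (q \<beta>) (Pr (B \<beta>) (q \<beta>))" if "\<beta> \<in> I" for \<beta>
      using g(1)[OF IF[OF that]] q(1)[OF that] by (simp add: isPr_def)
    have "\<exists>e\<in>T c. (\<forall>x\<in>S. \<exists>p. ent c e p x) \<and> (\<forall>p q x y. ent c e p x \<longrightarrow> ent c e q y \<longrightarrow> R x y)"
    proof (rule cover[OF c])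
      show "S \<subseteq> X c" using isS isPr_X[OF pc] by (auto simp: S_def)
      have "|S| \<le>o |under lam i \<inter> I|" unfolding S_def by (rule card_of_image)
      also have "|under lam i \<inter> I| \<le>o |under lam i|" by (rule card_of_mono1) simp
      also have "|under lam i| <o lam" by (rule card_of_under_less[OF i])
      finally show "|S| <o lam" .
      show "drel c R" unfolding drel_def R_def R0_def
        by (intro allI impI DP_intros DP_isPr[OF pc] DP_mem a X_TM[OF N(1)] X_TM[OF g(1)[OF i]] T_TM[OF b0(1)]
            TM_front TM_shift)
      show "R y x" if "R x y" for x y using that unfolding R_def by simp
      show "R x x" for x
        unfolding R_def R0_def using isPr_inj(1)[OF pc] lt_irrefl by metis
      have "R0 z z'" if zS: "z \<in> S" "z' \<in> S" for z z'
        unfolding R0_def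
      proof (intro ballI impI, elim conjE)
        fix p r p' r' v assume *: "isPr a a Pr p r z" "isPr a a Pr p' r' z'" "le s a v N0" "lt s a p p'" "mem b0 r' p v"
        obtain \<beta> \<beta>' where \<beta>: "\<beta> \<in> I" "(\<beta>, i) \<in> lam" "z = Pr (B \<beta>) (q \<beta>)" "\<beta>' \<in> I" "z' = Pr (B \<beta>') (q \<beta>')"
          using zS by (auto simp: S_def under_def)
        have eq: "p = B \<beta>" "p' = B \<beta>'" "r' = q \<beta>'"
          using isPr_inj[OF pc *(1)[unfolded \<beta>(3)] isS[OF \<beta>(1)]]
            isPr_inj[OF pc *(2)[unfolded \<beta>(5)] isS[OF \<beta>(4)]] by auto
        then have "(\<beta>, \<beta>') \<in> lam" using Blt *(4) IF \<beta> by auto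
        then have "v = A (h \<beta>' \<beta>)" "h \<beta>' \<beta> \<in> Field \<kappa>" using q(4)[OF \<beta>(4)] hF[OF \<beta>(4)] * eq by auto
        then show "le s a (B i) v" using lt_imp_le[OF g(5)[OF i]] by auto
      qed
      then show "R z z'" if "z \<in> S" "z' \<in> S" for z z' using that by (simp add: R_def)
    qed
    then obtain e where e: "e \<in> T c" "\<And>x. x \<in> S \<Longrightarrow> \<exists>p. ent c e p x"
      "\<And>p q x y. ent c e p x \<Longrightarrow> ent c e q y \<Longrightarrow> R x y" by blast
    \<comment> \<open>The codes \<open>q \<beta>\<close> are only known to be at most
      \<open>N1\<close>, so sets of them need the second coding, whose indices range up to
      \<open>bnd a\<close>.\<close>
    obtain D where D: "D \<in> X a" "\<And>x y. le s a x N1 \<Longrightarrow> le s a y N1 \<Longrightarrow> mem b1 D x y \<longleftrightarrow> rng e x y"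
      using codesD[OF b1(2) e(1)] by blast
    have "mem b1 D (B \<beta>) (q \<beta>)" if \<beta>: "\<beta> \<in> I" "(\<beta>, i) \<in> lam" for \<beta>
    proof -
      have "Pr (B \<beta>) (q \<beta>) \<in> S" using \<beta> by (auto simp: S_def under_def)
      then have "rng e (B \<beta>) (q \<beta>)" using e(2) isS[OF \<beta>(1)] rng_iff[OF e(1)] by blast
      then show ?thesis using D(2)[OF BN1[OF IF[OF \<beta>(1)]] q(2)[OF \<beta>(1)]] by simp
    qed
    moreover have "sep b0 b1 N0 N1 D (B i)" unfolding sep_def
    proof (intro ballI impI, elim conjE)
      fix p r p' r' v assume X: "p \<in> X a" "r \<in> X a" "p' \<in> X a" "r' \<in> X a" "v \<in> X a"
        and le: "le s a p N1" "le s a r N1" "le s a p' N1" "le s a r' N1"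
        and *: "le s a v N0" "mem b1 D p r" "mem b1 D p' r'" "lt s a p p'" "mem b0 r' p v"
      have "rng e p r" "rng e p' r'" using D(2) le * by auto
      then obtain w k w' k' where w: "isPr a a Pr p r w" "ent c e k w" "isPr a a Pr p' r' w'" "ent c e k' w'"
        using rng_iff[OF e(1)] by metis
      have "R0 w w'" using e(3)[OF w(2,4)] by (simp add: R_def)
      then show "le s a (B i) v" unfolding R0_def using X w(1,3) *(1,4,5) by blast
    qed
    ultimately show "\<exists>D\<in>X a. (\<forall>\<beta>\<in>I. (\<beta>, i) \<in> lam \<longrightarrow> mem b1 D (B \<beta>) (q \<beta>)) \<and> sep b0 b1 N0 N1 D (B i)"
      using D(1) by blast
  qed
  then obtain D where D: "\<And>i. i \<in> Field lam \<Longrightarrow> D i \<in> X a"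
    "\<And>i \<beta>. i \<in> Field lam \<Longrightarrow> \<beta> \<in> I \<Longrightarrow> (\<beta>, i) \<in> lam \<Longrightarrow> mem b1 (D i) (B \<beta>) (q \<beta>)"
    "\<And>i. i \<in> Field lam \<Longrightarrow> sep b0 b1 N0 N1 (D i) (B i)"
    by metis
  define pq where "pq = isPr a a Pr"
  define V where "V i = Pr (B i) (D i)" for i
  have V: "pq (B i) (D i) (V i)" if "i \<in> Field lam" for i
    using g(1)[OF that] D(1)[OF that] by (simp add: pq_def isPr_def V_def)
  have pq_inj: "x = x'" "y = y'" if "pq x y z" "pq x' y' z" for x y x' y' z
    using isPr_inj[OF pc] that unfolding pq_def by blast+
  have pq_X: "x \<in> X a" "y \<in> X a" if "pq x y z" for x y z using isPr_X[OF pc] that unfolding pq_def by blast+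
  \<comment> \<open>Constraints on an entry \<open>(t, d)\<close>: by \<open>E0\<close>,
    \<open>d\<close> is separated at \<open>t\<close>; by \<open>E1 i\<close>, \<open>t\<close> is
    before \<open>B i\<close>; by \<open>E2 \<beta>\<close>, as soon as \<open>t\<close> reaches
    \<open>B \<beta>\<close>, the set \<open>d\<close> contains the pair belonging to
    \<open>\<beta>\<close>.\<close>
  define E0 where "E0 = {z. \<exists>t\<in>X a. \<exists>d\<in>X a. pq t d z \<and> sep b0 b1 N0 N1 d t}"
  define E1 where "E1 i = {z. \<exists>t\<in>X a. \<exists>d\<in>X a. pq t d z \<and> lt s a t (B i)}" for i
  define E2 where "E2 \<beta> = {z. \<forall>t\<in>X a. \<forall>d\<in>X a. pq t d z \<and> le s a (B \<beta>) t \<longrightarrow> mem b1 d (B \<beta>) (q \<beta>)}" for \<beta>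
  \<comment> \<open>Imposing \<open>E2 \<beta>\<close> only for \<open>\<beta>\<close> before
    \<open>i\<close> keeps \<open>EE i\<close> smaller than \<open>lam\<close>. For the remaining
    \<open>\<beta>\<close> it holds vacuously, since \<open>E1 i\<close> keeps \<open>t\<close>
    before \<open>B i\<close>.\<close>
  define EE where "EE i = {E0, E1 i} \<union> E2 ` (underS lam i \<inter> I)" for i
  define R where "R z z' \<longleftrightarrow> z \<in> E0 \<and> (\<exists>t\<in>X a. \<exists>d\<in>X a. \<exists>t'\<in>X a. \<exists>d'\<in>X a. pq t d z \<and> pq t' d' z' \<and> lt s a t t')"
    for z z'
  have dE0: "dset c E0" unfolding dset_def E0_def pq_def mem_Collect_eq
    by (intro allI impI DP_intros DP_isPr[OF pc] DP_sep[OF b0(1) b1(1) N(1,2)] a TM_front TM_shift)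
  have dE1: "dset c (E1 i)" if "i \<in> Field lam" for i unfolding dset_def E1_def pq_def mem_Collect_eq
    by (intro allI impI DP_intros DP_isPr[OF pc] X_TM[OF g(1)[OF that]] a TM_front TM_shift)
  have dE2: "dset c (E2 \<beta>)" if "\<beta> \<in> I" for \<beta> unfolding dset_def E2_def pq_def mem_Collect_eq
    by (intro allI impI DP_intros DP_isPr[OF pc] DP_mem X_TM[OF g(1)[OF IF[OF that]]] X_TM[OF q(1)[OF that]]
        T_TM[OF b1(1)] a TM_front TM_shift)
  have dR: "drel c R" unfolding drel_def R_def pq_def
    by (intro allI impI DP_intros DP_isPr[OF pc] DP_dset[OF dE0] a TM_front TM_shift)
  have "\<exists>e k. e \<in> T c \<and> lt s c (lg s c e) (bnd c) \<and> (\<forall>i\<in>Field lam. ent c e (k i) (V i)) \<and>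
     (\<forall>i j. (i, j) \<in> lam \<and> i \<noteq> j \<longrightarrow> lt s c (k i) (k j)) \<and>
     (\<forall>p q x y. ent c e p x \<and> ent c e q y \<and> lt s c p q \<longrightarrow> R x y) \<and>
     (\<forall>i j p x E. (i, j) \<in> lam \<and> i \<noteq> j \<and> ent c e p x \<and> le s c p (k i) \<and> E \<in> EE j \<longrightarrow> x \<in> E)"
  proof (rule tower[OF c OrD(3)[OF c] le_refl[OF c OrD(3)[OF c]] OrD(4)[OF c] lam_wo lam_underS lam_Field _ _ _ dR])
    show "V i \<in> X c" if "i \<in> Field lam" for i using Pr_X[OF pc g(1)[OF that] D(1)[OF that]] by (simp add: V_def)
    show "|EE i| <o lam" if i: "i \<in> Field lam" for i unfolding EE_def
    proof (rule card_of_Un_less)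
      show "|{E0, E1 i}| <o lam" by (rule card_of_finite_less) simp
      have "|E2 ` (underS lam i \<inter> I)| \<le>o |underS lam i \<inter> I|" by (rule card_of_image)
      also have "|underS lam i \<inter> I| \<le>o |underS lam i|" by (rule card_of_mono1) simp
      also have "|underS lam i| <o lam" by (rule lam_underS[OF i])
      finally show "|E2 ` (underS lam i \<inter> I)| <o lam" .
    qed
    show "dset c G" if "i \<in> Field lam" "G \<in> EE i" for i G
      using that(2) dE0 dE1[OF that(1)] dE2 by (auto simp: EE_def)
    show "V i \<in> G" if ij: "(i, j) \<in> lam" "i \<noteq> j" "G \<in> EE j" for i j G
    proof -
      note i = F(1)[OF ij(1)]
      have "V i \<in> E0" unfolding E0_def using V[OF i] D(1,3)[OF i] g(1)[OF i] by blast
      moreover have "V i \<in> E1 j" unfolding E1_def using V[OF i] D(1)[OF i] g(1)[OF i] g(3)[OF ij(1,2)] by blast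
      moreover have "V i \<in> E2 \<beta>" if \<beta>: "\<beta> \<in> I" for \<beta>
        unfolding E2_def mem_Collect_eq
      proof (intro ballI impI, elim conjE)
        fix t d assume td: "pq t d (V i)" "le s a (B \<beta>) t"
        have eq: "t = B i" "d = D i" using pq_inj[OF td(1) V[OF i]] by auto
        then have "(\<beta>, i) \<in> lam" using Ble td(2) IF[OF \<beta>] i by blast
        then show "mem b1 d (B \<beta>) (q \<beta>)" using D(2)[OF i \<beta>] eq by simp
      qed
      ultimately show ?thesis using ij(3) by (auto simp: EE_def)
    qed
    show "z \<in> G" if ij: "(i, j) \<in> lam" "i \<noteq> j" "\<And>E. E \<in> EE i \<Longrightarrow> z \<in> E" "G \<in> EE j" for i j z G
    proof -
      have z0: "z \<in> E0" and z1: "z \<in> E1 i" using ij(3) by (auto simp: EE_def)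
      obtain t d where td: "t \<in> X a" "d \<in> X a" "pq t d z" "lt s a t (B i)" using z1 by (auto simp: E1_def)
      have "z \<in> E1 j" unfolding E1_def using td lt_trans[OF a td(4) g(3)[OF ij(1,2)]] by blast
      moreover have "z \<in> E2 \<beta>" if \<beta>: "\<beta> \<in> I" for \<beta>
      proof (cases "le s a (B \<beta>) t")
        case True
        then have lt: "lt s a (B \<beta>) (B i)" using le_lt_trans[OF a _ td(4)] by blast
        then have "(\<beta>, i) \<in> lam" using Blt IF[OF \<beta>] F(1)[OF ij(1)] by blast
        moreover have "\<beta> \<noteq> i" using lt lt_irrefl by auto
        ultimately have "\<beta> \<in> underS lam i \<inter> I" using \<beta> by (simp add: underS_def)
        then show ?thesis using ij(3) by (auto simp: EE_def)
      next
        case False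
        then show ?thesis unfolding E2_def using pq_inj(1)[OF _ td(3)] by auto
      qed
      ultimately show ?thesis using ij(4) z0 by (auto simp: EE_def)
    qed
    show "R z (V i)" if i: "i \<in> Field lam" and "\<And>E. E \<in> EE i \<Longrightarrow> z \<in> E" for i z
    proof -
      have z0: "z \<in> E0" and z1: "z \<in> E1 i" using that(2) by (auto simp: EE_def)
      obtain t d where td: "t \<in> X a" "d \<in> X a" "pq t d z" "lt s a t (B i)" using z1 by (auto simp: E1_def)
      then show ?thesis unfolding R_def using z0 V[OF i] g(1)[OF i] D(1)[OF i] by blast
    qed
  qed
  then obtain e k where e0: "e \<in> T c" "\<forall>i\<in>Field lam. ent c e (k i) (V i)"
     "\<forall>i j. (i, j) \<in> lam \<and> i \<noteq> j \<longrightarrow> lt s c (k i) (k j)"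
     "\<forall>p q x y. ent c e p x \<and> ent c e q y \<and> lt s c p q \<longrightarrow> R x y"
     "\<forall>i j p x E. (i, j) \<in> lam \<and> i \<noteq> j \<and> ent c e p x \<and> le s c p (k i) \<and> E \<in> EE j \<longrightarrow> x \<in> E"
    by (elim exE conjE) (rule that)
  note e = e0(1) e0(2)[rule_format] e0(3)[rule_format, OF conjI] e0(4)[rule_format, OF conjI[OF _ conjI]]
    e0(5)[rule_format, OF conjI[OF _ conjI[OF _ conjI[OF _ conjI]]]]
  have kX: "k i \<in> X c" if "i \<in> Field lam" for i using ent_X(1)[OF e(2)[OF that]] .
  obtain i0 where i0: "i0 \<in> Field lam" using lam_infinite infinite_imp_nonempty by blast
  have Rlt: "lt s a t t'" if pp: "ent c e p x" "ent c e p' x'" "lt s c p p'" "pq t d x" "pq t' d' x'" for p x p' x' t d t' d'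
  proof -
    obtain u f u' f' where "pq u f x" "pq u' f' x'" "lt s a u u'" using e(4)[OF pp(1-3)] unfolding R_def by blast
    then show ?thesis using pq_inj(1) pp(4,5) by metis
  qed
  have ent_pq: "\<exists>t d. pq t d x" if "ent c e p x" for p x
    using isPr_ex[OF pc ent_X(2)[OF that]] by (simp add: pq_def)
  have above: "\<exists>j\<in>Field \<kappa>. A j = t \<or> lt s a (A j) t"
    if n: "\<And>i. i \<in> Field lam \<Longrightarrow> lt s c (k i) n" and nx: "ent c e n x" "pq t d x" for n x t d
    by (rule g(6)[OF pq_X(1)[OF nx(2)] Rlt[OF e(2) nx(1) n V nx(2)]])
  \<comment> \<open>Each single \<open>E2 \<beta>\<close> persists beyond the whole tower, up to an
    entry whose first component has passed the gap and so is at least some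
    \<open>A \<epsilon>\<close>. How far it persists depends on \<open>\<beta>\<close>; only
    \<open>\<epsilon>\<close> can be made uniform.\<close>
  have "\<forall>\<beta>\<in>I. \<exists>\<epsilon>\<in>Field \<kappa>. \<exists>n x t d. ent c e n x \<and> pq t d x \<and> (A \<epsilon> = t \<or> lt s a (A \<epsilon>) t) \<and> entries c (E2 \<beta>) e n"
  proof
    fix \<beta> assume \<beta>: "\<beta> \<in> I"
    have ents: "entries c (E2 \<beta>) e (k i)" if i: "i \<in> Field lam" for i unfolding entries_def
    proof (intro ballI impI, elim conjE)
      fix p x assume px: "p \<in> X c" "ent c e p x" "lt s c p (k i)"
      obtain m where m: "m \<in> Field lam" "(i, m) \<in> lam" "(\<beta>, m) \<in> lam"
      proof (cases "(i, \<beta>) \<in> lam")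
        case True
        then show ?thesis using that[of \<beta>] lamrefl IF[OF \<beta>] by blast
      next
        case False
        then have "(\<beta>, i) \<in> lam" using lam_total[OF i IF[OF \<beta>]] lamrefl[OF i] by auto
        then show ?thesis using that[of i] lamrefl i by blast
      qed
      obtain j where j: "j \<in> Field lam" "(m, j) \<in> lam" "m \<noteq> j" using lam_next[OF m(1)] by blast
      have lamtr: "trans lam" "antisym lam" using lam_wo
        by (auto simp: well_order_on_def linear_order_on_def partial_order_on_def preorder_on_def)
      have "(i, j) \<in> lam" "(\<beta>, j) \<in> lam" using lamtr(1) m j by (blast dest: transD)+
      moreover have "i \<noteq> j" "\<beta> \<noteq> j" using antisymD[OF lamtr(2)] m j by blast+
      ultimately have "E2 \<beta> \<in> EE j" "(i, j) \<in> lam" "i \<noteq> j" using \<beta> by (auto simp: EE_def underS_def)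
      then show "x \<in> E2 \<beta>" using e(5) px(2) lt_imp_le[OF px(3)] by blast
    qed
    obtain n where n: "n \<in> X c" "le s c n (lg s c e)" "entries c (E2 \<beta>) e n"
      "\<And>m. m \<in> X c \<Longrightarrow> le s c m (lg s c e) \<and> entries c (E2 \<beta>) e m \<Longrightarrow> le s c m n"
      using ex_greatest_entries[OF c e(1) dE2[OF \<beta>] lt_imp_le[OF ent_lt[OF c e(1) e(2)[OF i0]]] ents[OF i0]] by blast
    have kn: "le s c (k i) n" if i: "i \<in> Field lam" for i
      using n(4)[OF kX[OF i]] ents[OF i] lt_imp_le[OF ent_lt[OF c e(1) e(2)[OF i]]] by blast
    have kn': "lt s c (k i) n" if i: "i \<in> Field lam" for i
    proof -
      obtain j where j: "j \<in> Field lam" "(i, j) \<in> lam" "i \<noteq> j" using lam_next[OF i] by blast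
      show ?thesis using lt_le_trans[OF c e(3)[OF j(2,3)] kn[OF j(1)]] .
    qed
    \<comment> \<open>\<open>n\<close> may be the length of \<open>e\<close>, where no entry exists.
      Its predecessor carries an entry and is still beyond the tower.\<close>
    obtain m where m: "lt s c m n" "\<And>u. lt s c u n \<Longrightarrow> le s c u m" using ex_pred[OF c kn'[OF i0]] by blast
    have km: "lt s c (k i) m" if i: "i \<in> Field lam" for i
    proof -
      obtain j where j: "j \<in> Field lam" "(i, j) \<in> lam" "i \<noteq> j" using lam_next[OF i] by blast
      show ?thesis using lt_le_trans[OF c e(3)[OF j(2,3)] m(2)[OF kn'[OF j(1)]]] .
    qed
    obtain x where x: "ent c e m x" using ent_ex[OF c e(1) lt_le_trans[OF c m(1) n(2)]] by blast
    obtain t d where td: "pq t d x" using ent_pq[OF x] by blast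
    have "entries c (E2 \<beta>) e m" using n(3) lt_trans[OF c _ m(1)] unfolding entries_def by blast
    then show "\<exists>\<epsilon>\<in>Field \<kappa>. \<exists>n x t d. ent c e n x \<and> pq t d x \<and> (A \<epsilon> = t \<or> lt s a (A \<epsilon>) t) \<and> entries c (E2 \<beta>) e n"
      using above[OF km x td] x td by blast
  qed
  then obtain eps where eps: "\<And>\<beta>. \<beta> \<in> I \<Longrightarrow> eps \<beta> \<in> Field \<kappa>"
    "\<And>\<beta>. \<beta> \<in> I \<Longrightarrow> \<exists>n x t d. ent c e n x \<and> pq t d x \<and> (A (eps \<beta>) = t \<or> lt s a (A (eps \<beta>)) t) \<and> entries c (E2 \<beta>) e n"
    by metis
  obtain \<epsilon> where \<epsilon>: "\<epsilon> \<in> Field \<kappa>" "\<not> |{\<beta> \<in> I. eps \<beta> = \<epsilon>}| \<le>o \<kappa>"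
    using infinite_pigeonhole_card[OF \<kappa>(1) Ibig, of eps] eps(1) by blast
  define W where "W = {\<beta> \<in> I. eps \<beta> = \<epsilon>}"
  have Wbig: "\<not> |W| \<le>o \<kappa>" using \<epsilon>(2) by (simp add: W_def)
  have WI: "\<beta> \<in> I" if "\<beta> \<in> W" for \<beta> using that by (simp add: W_def)
  \<comment> \<open>The last position with first component before \<open>A \<epsilon>\<close> is
    beyond the tower, and it precedes the position found for every \<open>\<beta> \<in> W\<close>.
    Its set \<open>d\<close> is thus subject to all these \<open>E2 \<beta>\<close> at once.\<close>
  define Q where "Q n \<longleftrightarrow> (\<exists>x\<in>X c. \<exists>t\<in>X a. \<exists>d\<in>X a. ent c e n x \<and> pq t d x \<and> lt s a t (A \<epsilon>))" for n
  have Qk: "Q (k i)" if i: "i \<in> Field lam" for i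
    unfolding Q_def using e(2)[OF i] V[OF i] g(5)[OF i \<epsilon>(1)] g(1)[OF i] D(1)[OF i] ent_X(2)[OF e(2)[OF i]] by blast
  have "\<exists>n\<in>X c. Q n \<and> (\<forall>m\<in>X c. Q m \<longrightarrow> le s c m n)"
  proof (rule ex_greatest(1)[OF c kX[OF i0]])
    show "Q (k i0)" by (rule Qk[OF i0])
    show "DP (\<lambda>e. Q (front (ar c) e))" unfolding Q_def pq_def
      by (intro DP_intros DP_isPr[OF pc] a c X_TM[OF g(2)[OF \<epsilon>(1)]] T_TM[OF e(1)] TM_front TM_shift)
  qed
  then obtain n x t d where n: "\<And>m. m \<in> X c \<Longrightarrow> Q m \<Longrightarrow> le s c m n" "ent c e n x" "pq t d x" "lt s a t (A \<epsilon>)"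
    unfolding Q_def by blast
  have kn: "lt s c (k i) n" if i: "i \<in> Field lam" for i
  proof -
    obtain j where j: "j \<in> Field lam" "(i, j) \<in> lam" "i \<noteq> j" using lam_next[OF i] by blast
    show ?thesis using lt_le_trans[OF c e(3)[OF j(2,3)] n(1)[OF kX[OF j(1)] Qk[OF j(1)]]] .
  qed
  have Bt: "lt s a (B i) t" if i: "i \<in> Field lam" for i
    by (rule Rlt[OF e(2)[OF i] n(2) kn[OF i] V[OF i] n(3)])
  have late: "\<exists>p z. ent c e p z \<and> lt s c n p \<and> entries c (E2 \<beta>) e p" if \<beta>: "\<beta> \<in> W" for \<beta>
  proof -
    obtain p z u f where p: "ent c e p z" "pq u f z" "A \<epsilon> = u \<or> lt s a (A \<epsilon>) u" "entries c (E2 \<beta>) e p"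
      using eps(2)[OF WI[OF \<beta>]] \<beta> by (auto simp: W_def)
    have tu: "lt s a t u" using p(3) n(4) lt_trans[OF a n(4)] by auto
    have "n \<noteq> p"
    proof
      assume "n = p"
      then have "x = z" using ent_unique[OF c e(1) n(2)] p(1) by simp
      then show False using pq_inj(1)[OF n(3)] p(2) tu lt_irrefl by auto
    qed
    moreover have "\<not> lt s c p n" using Rlt[OF p(1) n(2) _ p(2) n(3)] nl[OF tu] lt_imp_le by blast
    ultimately have "lt s c n p" using lt_total[OF c ent_X(1)[OF n(2)] ent_X(1)[OF p(1)]] by blast
    then show ?thesis using p by blast
  qed
  \<comment> \<open>A later entry is needed to obtain \<open>x \<in> E0\<close>, because
    \<open>R\<close> imposes \<open>E0\<close> on the earlier of two entries.\<close>
  have "W \<noteq> {}"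
  proof
    assume "W = {}"
    then have "|W| \<le>o \<kappa>" using \<kappa>(1) by (simp add: card_of_empty1)
    then show False using Wbig by simp
  qed
  then obtain \<beta>0 where "\<beta>0 \<in> W" by blast
  then obtain p z where "ent c e p z" "lt s c n p" using late by blast
  then have "x \<in> E0" using e(4)[OF n(2)] by (simp add: R_def)
  then have sepd: "sep b0 b1 N0 N1 d t" using pq_inj[OF _ n(3)] unfolding E0_def by blast
  have memd: "mem b1 d (B \<beta>) (q \<beta>)" if \<beta>: "\<beta> \<in> W" for \<beta>
  proof -
    obtain p z where pz: "ent c e p z" "lt s c n p" "entries c (E2 \<beta>) e p" using late[OF \<beta>] by blast
    then have "x \<in> E2 \<beta>" using n(2) ent_X[OF n(2)] unfolding entries_def by blast
    then show ?thesis
      unfolding E2_def using n(3) pq_X[OF n(3)] lt_imp_le[OF Bt[OF IF[OF WI[OF \<beta>]]]] by blast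
  qed
  \<comment> \<open>\<open>sep\<close> is applied to the pairs of \<open>\<gamma>\<close> and
    \<open>\<beta>\<close>, both in \<open>d\<close>: the function coded by \<open>q \<beta>\<close>
    is evaluated at the smaller argument \<open>B \<gamma>\<close>.\<close>
  have tA: "le s a t (A (h \<beta> \<gamma>))" if W: "\<beta> \<in> W" "\<gamma> \<in> W" "(\<gamma>, \<beta>) \<in> lam" "\<gamma> \<noteq> \<beta>" for \<beta> \<gamma>
  proof -
    note \<beta>I = WI[OF W(1)] and \<gamma>I = WI[OF W(2)]
    have hf: "h \<beta> \<gamma> \<in> Field \<kappa>" by (rule hF[OF \<beta>I W(3)])
    show ?thesis
      by (rule sepd[unfolded sep_def, rule_format, of "B \<gamma>" "q \<gamma>" "B \<beta>" "q \<beta>" "A (h \<beta> \<gamma>)"])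
        (intro conjI g(1)[OF IF[OF \<beta>I]] g(1)[OF IF[OF \<gamma>I]] q(1)[OF \<beta>I] q(1)[OF \<gamma>I] g(2)[OF hf]
          BN1[OF IF[OF \<beta>I]] BN1[OF IF[OF \<gamma>I]] q(2)[OF \<beta>I] q(2)[OF \<gamma>I] AN[OF hf]
          memd[OF W(1)] memd[OF W(2)] g(3)[OF W(3,4)] q(3)[OF \<beta>I W(3)])+
  qed
  \<comment> \<open>Passing to the predecessor of \<open>t\<close> yields an
    \<open>A \<epsilon>2\<close> strictly before \<open>t\<close>. The values in \<open>tA\<close>
    are not before \<open>t\<close>, so, \<open>A\<close> being weakly decreasing, their indices
    come before \<open>\<epsilon>2\<close>.\<close>
  obtain t' where t': "lt s a t' t" "\<And>u. lt s a u t \<Longrightarrow> le s a u t'" using ex_pred[OF a Bt[OF i0]] by blast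
  have "lt s a (B i) t'" if i: "i \<in> Field lam" for i
  proof -
    obtain j where j: "j \<in> Field lam" "(i, j) \<in> lam" "i \<noteq> j" using lam_next[OF i] by blast
    show ?thesis using lt_le_trans[OF a g(3)[OF j(2,3)] t'(2)[OF Bt[OF j(1)]]] .
  qed
  then obtain \<epsilon>2 where \<epsilon>2: "\<epsilon>2 \<in> Field \<kappa>" "A \<epsilon>2 = t' \<or> lt s a (A \<epsilon>2) t'" using g(6)[OF lt_X(1)[OF t'(1)]] by blast
  have A2t: "lt s a (A \<epsilon>2) t" using \<epsilon>2(2) t'(1) lt_trans[OF a _ t'(1)] by auto
  have \<kappa>wo: "Well_order \<kappa>" using \<kappa>(1) by (simp add: card_order_on_well_order_on)
  have small: "h \<beta> \<gamma> \<in> underS \<kappa> \<epsilon>2" if W: "\<beta> \<in> W" "\<gamma> \<in> W" "(\<gamma>, \<beta>) \<in> lam" "\<gamma> \<noteq> \<beta>" for \<beta> \<gamma>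
  proof (rule ccontr)
    assume *: "h \<beta> \<gamma> \<notin> underS \<kappa> \<epsilon>2"
    have hf: "h \<beta> \<gamma> \<in> Field \<kappa>" by (rule hF[OF WI[OF W(1)] W(3)])
    have "(\<epsilon>2, h \<beta> \<gamma>) \<in> \<kappa>"
    proof (cases "\<epsilon>2 = h \<beta> \<gamma>")
      case True
      then show ?thesis
        using \<kappa>wo hf by (auto simp: well_order_on_def linear_order_on_def partial_order_on_def preorder_on_def refl_on_def)
    next
      case False
      then show ?thesis using * \<kappa>wo hf \<epsilon>2(1)
        by (auto simp: underS_def well_order_on_def linear_order_on_def total_on_def)
    qed
    then have "A (h \<beta> \<gamma>) = A \<epsilon>2 \<or> lt s a (A (h \<beta> \<gamma>)) (A \<epsilon>2)" by (rule g(4))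
    then have "lt s a (A (h \<beta> \<gamma>)) t" using A2t lt_trans[OF a _ A2t] by auto
    then show False using nl tA[OF W] by blast
  qed
  have "|W| \<le>o \<kappa>"
  proof (rule card_of_ordLeq_if_initial_segments_small[OF lam_wo])
    show "W \<subseteq> Field lam" using IF WI by blast
    show "Card_order \<kappa>" using \<kappa>(1) by simp
    fix \<beta> assume \<beta>: "\<beta> \<in> W"
    have "|W \<inter> underS lam \<beta>| \<le>o |underS \<kappa> \<epsilon>2|"
    proof (rule card_of_ordLeqI[of "h \<beta>"])
      show "inj_on (h \<beta>) (W \<inter> underS lam \<beta>)"
        by (rule inj_on_subset[OF h[OF WI[OF \<beta>]]]) (auto simp: underS_def under_def)
      show "h \<beta> \<gamma> \<in> underS \<kappa> \<epsilon>2" if "\<gamma> \<in> W \<inter> underS lam \<beta>" for \<gamma>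
        using small[OF \<beta>, of \<gamma>] that by (auto simp: underS_def)
    qed
    also have "|underS \<kappa> \<epsilon>2| <o \<kappa>" using card_of_underS[of \<kappa> \<epsilon>2] \<kappa>(1) \<epsilon>2(1) by simp
    finally show "|W \<inter> underS lam \<beta>| <o \<kappa>" .
  qed
  then show False using Wbig by simp
qed

end

text \<open>The two codings are nested: the one with indices up to \<open>bnd a\<close> determines
  \<open>N1\<close>, and the one with indices up to \<open>N1\<close> determines \<open>N0\<close>,
  below which the gap is then moved.\<close>

lemma (in minimal_cut) no_asymmetric_gap:
  assumes a: "a \<in> Or"
    and dp: "drel a prec" and tp: "transp prec" and ir: "\<And>x. \<not> prec x x"
    and gap: "gap a prec lam v \<kappa> w" and \<kappa>: "Cinfinite \<kappa>" "\<kappa> <o lam"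
  shows False
proof -
  obtain c Pr where c: "c \<in> Or" "is_pairing s a a c Pr"
    using products a unfolding has_products_def by blast
  obtain c3 Pr3 where c3: "c3 \<in> Or" "is_pairing s a c c3 Pr3"
    using products a c(1) unfolding has_products_def by blast
  interpret coded_cut s lam a c c3 Pr Pr3
    by unfold_locales (use a c c3 in auto)
  obtain N1 b1 where N1: "N1 \<in> X a" "infinite {x. lt s a x N1}" "le s a N1 (bnd a)"
    "b1 \<in> T c3" "codes b1 (bnd a) N1"
    using ex_codes[OF OrD(3,4)[OF a]] by blast
  obtain N0 b0 where N0: "N0 \<in> X a" "le s a N0 N1" "infinite {x. lt s a x N0}"
    "b0 \<in> T c3" "codes b0 N1 N0"
    using ex_codes[OF N1(1,2)] by blast
  have ne: "Field \<kappa> \<noteq> {}" using \<kappa>(1) by (auto simp: cinfinite_def)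
  obtain B A where BA: "gap a (lt s a) lam B \<kappa> A" "\<forall>i\<in>Field lam. lt s a (B i) N0"
    "\<forall>j\<in>Field \<kappa>. lt s a (A j) N0"
    using gap_of_positions[OF a N0(1) le_trans[OF a N0(2) N1(3)] N0(3) dp tp ir gap ne] by blast
  show False
    by (rule no_asymmetric_gap_aux[OF \<kappa> N0(1) N1(1) N0(2,4,5) N1(4,5) BA(1)])
      (use BA(2,3) lt_imp_le in auto)
qed

text \<open>If \<open>\<kappa>\<close> is not shorter than \<open>lam\<close>, the two are
  isomorphic, and reindexing \<open>w\<close> reduces to the symmetric case.\<close>

lemma (in minimal_cut) no_gap:
  assumes a: "a \<in> Or"
    and dp: "drel a prec" and tp: "transp prec" and ir: "\<And>x. \<not> prec x x"
    and gap: "gap a prec lam v \<kappa> w" and \<kappa>: "Cinfinite \<kappa>" "\<kappa> \<le>o lam"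
  shows False
proof (cases "\<kappa> <o lam")
  case True
  then show False using no_asymmetric_gap[OF a dp tp ir gap \<kappa>(1)] by blast
next
  case False
  then have "\<kappa> =o lam" using \<kappa>(2) by (simp add: ordLeq_iff_ordLess_or_ordIso)
  then have "lam =o \<kappa>" by (rule ordIso_symmetric)
  then obtain f where "iso lam \<kappa> f" unfolding ordIso_def by auto
  then have bij: "bij_betw f (Field lam) (Field \<kappa>)"
    and mono: "\<forall>i\<in>Field lam. \<forall>j\<in>Field lam. (i, j) \<in> lam \<longleftrightarrow> (f i, f j) \<in> \<kappa>"
    by (simp_all add: iso_iff2)
  have f: "f ` Field lam = Field \<kappa>" using bij by (simp add: bij_betw_def)
  have fmono: "(f i, f j) \<in> \<kappa>" if "(i, j) \<in> lam" for i j
    using mono that FieldI1[OF that] FieldI2[OF that] by simp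
  note g = gapD[OF gap]
  have fF: "f i \<in> Field \<kappa>" if "i \<in> Field lam" for i using f that by blast
  have "gap a prec lam v lam (\<lambda>i. w (f i))" unfolding gap_def
  proof (intro conjI ballI allI impI)
    show "\<exists>j\<in>Field lam. w (f j) = x \<or> prec (w (f j)) x"
      if x: "x \<in> X a" "\<forall>i\<in>Field lam. prec (v i) x" for x
    proof -
      obtain j where "j \<in> Field \<kappa>" "w j = x \<or> prec (w j) x" using g(6)[OF x(1)] x(2) by blast
      then show ?thesis using f by (metis imageE)
    qed
  qed (use g(1-5) fF fmono in auto)
  then show False by (rule no_symmetric_gap[OF a dp tp ir])
qed

section \<open>Choice of the minimal cut and conclusion\<close>

lemma least_card_le:
  assumes "r \<in> Z" "\<And>r. r \<in> Z \<Longrightarrow> Card_order r"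
  shows "least_card Z \<in> Z" "least_card Z \<le>o r"
proof -
  have "\<exists>r\<in>Z. \<forall>r'\<in>Z. r \<le>o r'" by (rule exists_minim_Card_order) (use assms in auto)
  then have "\<exists>r. r \<in> Z \<and> (\<forall>r'\<in>Z. r \<le>o r')" by auto
  then have *: "least_card Z \<in> Z \<and> (\<forall>r'\<in>Z. least_card Z \<le>o r')" unfolding least_card_def by (rule someI_ex)
  then show "least_card Z \<in> Z" "least_card Z \<le>o r" using assms(1) by auto
qed

text \<open>Reflexivity of \<open>=o\<close> needs a well-order, and the choice in
  \<open>least_card\<close> provides one only when there are candidates; the whole field is
  one.\<close>

lemma cf_ordIso_refl:
  assumes "Well_order r"
  shows "cf r =o cf r"
proof -
  define Z where "Z = {|K| | K. K \<subseteq> Field r \<and> (\<forall>i\<in>Field r. \<exists>j\<in>K. (i, j) \<in> r)}"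
  have "(i, i) \<in> r" if "i \<in> Field r" for i
    using assms that by (auto simp: well_order_on_def linear_order_on_def partial_order_on_def preorder_on_def refl_on_def)
  then have "|Field r| \<in> Z" unfolding Z_def by blast
  then have "least_card Z \<in> Z" by (rule least_card_le) (auto simp: Z_def card_of_Card_order)
  then obtain K where "cf r = |K|" unfolding cf_def Z_def by blast
  then show ?thesis using card_of_refl by simp
qed

theorem theorem3p66:
  fixes s :: "('f, 'r, 'a) csp"
  assumes "cofinality_spectrum_problem s"
  shows "cut_spectrum_below s (t_of s) = {}"
proof (rule ccontr)
  assume "cut_spectrum_below s (t_of s) \<noteq> {}"
  then obtain \<mu>1 \<mu>2 where \<mu>: "(\<mu>1, \<mu>2) \<in> cut_spectrum s" "\<mu>1 +c \<mu>2 <o t_of s"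
    by (auto simp: cut_spectrum_below_def)
  interpret spectrum s by unfold_locales (rule assms)
  define Z where "Z = {\<kappa>1 +c \<kappa>2 | \<kappa>1 \<kappa>2. (\<kappa>1, \<kappa>2) \<in> cut_spectrum s}"
  have "\<exists>r\<in>Z. \<forall>r'\<in>Z. r \<le>o r'"
    by (rule exists_minim_Card_order) (use \<mu>(1) in \<open>auto simp: Z_def Card_order_csum\<close>)
  then obtain \<kappa>1 \<kappa>2 where \<kappa>: "(\<kappa>1, \<kappa>2) \<in> cut_spectrum s"
    and min: "\<And>\<nu>1 \<nu>2. (\<nu>1, \<nu>2) \<in> cut_spectrum s \<Longrightarrow> \<kappa>1 +c \<kappa>2 \<le>o \<nu>1 +c \<nu>2"
    unfolding Z_def by blast
  have t: "\<kappa>1 +c \<kappa>2 <o t_of s" using min[OF \<mu>(1)] \<mu>(2) by (rule ordLeq_ordLess_trans)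
  have C: "Cinfinite \<kappa>1" "Cinfinite \<kappa>2" using \<kappa> by (auto simp: cut_spectrum_def)
  obtain a C1 C2 where a: "a \<in> Or" and cut: "is_cut s a \<kappa>1 \<kappa>2 C1 C2"
    using \<kappa> by (auto simp: cut_spectrum_def)
  \<comment> \<open>The sum is equivalent to the longer side, and either side can be the longer one;
    hence the general \<open>lam\<close>.\<close>
  have mc: "minimal_cut s lam" if lam: "Cinfinite lam" "\<kappa>1 +c \<kappa>2 =o lam" for lam
  proof unfold_locales
    show "Cinfinite lam" by (rule lam(1))
    show False if n: "(\<nu>1, \<nu>2) \<in> cut_spectrum s" "\<nu>1 <o lam" "\<nu>2 <o lam" for \<nu>1 \<nu>2
    proof -
      have "\<nu>1 +c \<nu>2 <o lam"
      proof -
        have "Card_order \<nu>1" "Card_order \<nu>2" using n(1) by (auto simp: cut_spectrum_def)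
        then have "|Field \<nu>1| <o lam" "|Field \<nu>2| <o lam"
          using n(2,3) card_of_Field_ordIso ordIso_ordLess_trans by auto
        then have "|Field \<nu>1 <+> Field \<nu>2| <o lam"
          using lam(1) by (intro card_of_Plus_ordLess_infinite_Field) (auto simp: cinfinite_def)
        then show ?thesis by (simp add: csum_def)
      qed
      moreover have "lam \<le>o \<nu>1 +c \<nu>2"
        using ordIso_ordLeq_trans[OF ordIso_symmetric[OF lam(2)] min[OF n(1)]] .
      ultimately show False using not_ordLess_ordLeq by auto
    qed
    show "\<not> unbounded_tower s b \<kappa> f" if "b \<in> Or" "Cinfinite \<kappa>" "\<kappa> \<le>o lam" for b \<kappa> f
    proof
      assume u: "unbounded_tower s b \<kappa> f"
      let ?Z = "{\<kappa>. Cinfinite \<kappa> \<and> (\<exists>a\<in>Or. \<exists>\<delta> b. Well_order \<delta> \<and> cf \<delta> =o cf \<kappa> \<and> unbounded_tower s a \<delta> b)}"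
      have wo: "Well_order \<kappa>" using that(2) by (simp add: card_order_on_well_order_on)
      \<comment> \<open>With \<open>\<delta>\<close> taken to be \<open>\<kappa>\<close> itself, the
        unbounded tower makes \<open>\<kappa>\<close> a candidate for \<open>t_of s\<close>.\<close>
      have "\<exists>a\<in>Or. \<exists>\<delta> b. Well_order \<delta> \<and> cf \<delta> =o cf \<kappa> \<and> unbounded_tower s a \<delta> b"
        using that(1) wo cf_ordIso_refl[OF wo] u by blast
      then have "\<kappa> \<in> ?Z" using that(2) by simp
      then have "t_of s \<le>o \<kappa>" unfolding t_of_def by (rule least_card_le(2)) simp
      then have "t_of s \<le>o lam" using that(3) by (rule ordLeq_transitive)
      then have "t_of s \<le>o \<kappa>1 +c \<kappa>2" using ordIso_symmetric[OF lam(2)] by (rule ordLeq_ordIso_trans)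
      then show False using not_ordLess_ordLeq[OF t] by simp
    qed
  qed
  have cutD: "C1 \<union> C2 = X a" "\<And>x y. x \<in> C1 \<Longrightarrow> y \<in> C2 \<Longrightarrow> lt s a x y"
    using cut by (simp_all add: is_cut_def)
  from cut obtain f where f0: "f ` Field \<kappa>1 \<subseteq> C1" "\<forall>i j. (i, j) \<in> \<kappa>1 \<and> i \<noteq> j \<longrightarrow> lt s a (f i) (f j)"
    "\<forall>x\<in>C1. \<exists>i\<in>Field \<kappa>1. le s a x (f i)"
    unfolding is_cut_def by (elim conjE exE) (rule that)
  from cut obtain g where g0: "g ` Field \<kappa>2 \<subseteq> C2" "\<forall>i j. (i, j) \<in> \<kappa>2 \<and> i \<noteq> j \<longrightarrow> lt s a (g j) (g i)"
    "\<forall>x\<in>C2. \<exists>i\<in>Field \<kappa>2. le s a (g i) x"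
    unfolding is_cut_def by (elim conjE exE) (rule that)
  note f = f0(1) f0(2)[rule_format, OF conjI] f0(3)[rule_format]
    and g = g0(1) g0(2)[rule_format, OF conjI] g0(3)[rule_format]
  have fX: "f i \<in> C1" "f i \<in> X a" if "i \<in> Field \<kappa>1" for i using f(1) cutD(1) that by auto
  have gX: "g i \<in> C2" "g i \<in> X a" if "i \<in> Field \<kappa>2" for i using g(1) cutD(1) that by auto
  show False
  proof (cases "\<kappa>1 \<le>o \<kappa>2")
    case True
    interpret minimal_cut s \<kappa>2
      by (rule mc[OF C(2) csum_absorb2[OF C(2) True]])
    \<comment> \<open>Here the upper side is the longer one (or both are equally long), so the order
      is read backwards.\<close>
    have gap: "gap a (\<lambda>x y. lt s a y x) \<kappa>2 g \<kappa>1 f" unfolding gap_def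
    proof (intro conjI ballI allI impI)
      fix x assume x: "x \<in> X a" "\<forall>i\<in>Field \<kappa>2. lt s a x (g i)"
      have "x \<notin> C2" using g(3)[of x] x(2) lt_asym[OF a] by blast
      then have "x \<in> C1" using x(1) cutD(1) by auto
      then obtain i where "i \<in> Field \<kappa>1" "le s a x (f i)" using f(3) by blast
      then show "\<exists>j\<in>Field \<kappa>1. f j = x \<or> lt s a x (f j)" by (auto simp: lt_def)
    next
      fix j j' assume "(j, j') \<in> \<kappa>1"
      then show "f j' = f j \<or> lt s a (f j) (f j')" using f(2) by (cases "j = j'") auto
    qed (use fX gX cutD g(2) in auto)
    show False
    proof (rule no_gap[OF a _ _ _ gap C(1) True])
      show "drel a (\<lambda>x y. lt s a y x)" unfolding drel_def by (intro allI impI DP_lt a)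
      show "transp (\<lambda>x y. lt s a y x)" by (rule transpI) (rule lt_trans[OF a])
    qed (rule lt_irrefl)
  next
    case False
    then have le: "\<kappa>2 \<le>o \<kappa>1"
      using C ordLeq_total[OF card_order_on_well_order_on card_order_on_well_order_on] by auto
    interpret minimal_cut s \<kappa>1
      by (rule mc[OF C(1) csum_absorb1[OF C(1) le]])
    have gap: "gap a (lt s a) \<kappa>1 f \<kappa>2 g" unfolding gap_def
    proof (intro conjI ballI allI impI)
      fix x assume x: "x \<in> X a" "\<forall>i\<in>Field \<kappa>1. lt s a (f i) x"
      have "x \<notin> C1" using f(3)[of x] x(2) lt_asym[OF a] by blast
      then have "x \<in> C2" using x(1) cutD(1) by auto
      then obtain i where "i \<in> Field \<kappa>2" "le s a (g i) x" using g(3) by blast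
      then show "\<exists>j\<in>Field \<kappa>2. g j = x \<or> lt s a (g j) x" by (auto simp: lt_def)
    next
      fix j j' assume "(j, j') \<in> \<kappa>2"
      then show "g j' = g j \<or> lt s a (g j') (g j)" using g(2) by (cases "j = j'") auto
    qed (use fX gX cutD f(2) in auto)
    show False
    proof (rule no_gap[OF a _ _ _ gap C(2) le])
      show "drel a (lt s a)" unfolding drel_def by (intro allI impI DP_lt a)
      show "transp (lt s a)" by (rule transpI) (rule lt_trans[OF a])
    qed (rule lt_irrefl)
  qed
qed

end
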